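(* Let $n\ge1$ and let $F\colon\mathbb{G}_n\to\mathbb{G}_n$ be a proper holomorphic map of the symmetrized polydisc. Then $$F^*g_n\le\min\left\{n,(\deg F)^{1/n}\right\}g_n .$$ The constant is sharp: for each $n\ge 1$ and each integer $m$ that is the degree of some proper holomorphic self-map of $\mathbb{G}_n$, there is no real $C<\min\{n,m^{1/n}\}$ such that $F^*g_n\le C\,g_n$ on $\mathbb{G}_n$ for all proper holomorphic maps $F\colon\mathbb{G}_n\to\mathbb{G}_n$ with $\deg F=m$.
   Context: $\mathbb{D}$ is the open unit disk in $\mathbb{C}$. Let $\pi_n(Z)=(\sigma_1(Z),\ldots,\sigma_n(Z))$, where $\sigma_k(Z)=\sum_{1\le i_1<\cdots<i_k\le n}z_{i_1}\cdots z_{i_k}$ is the $k$th elementary symmetric polynomial. The symmetrized polydisc is $\mathbb{G}_n=\pi_n(\mathbb{D}^n)$, a domain in $\mathbb{C}^n$. Let $S_n$ be the Szegő kernel of $\mathbb{G}_n$; it is the function on $\mathbb{G}_n\times\mathbb{G}_n$, holomorphic in the first and antiholomorphic in the second variable, determined by $$S_n(\pi_n(Z),\pi_n(W))=\prod_{i,j=1}^n\frac{1}{1-z_i\overline{w_j}},\qquad Z,W\in\mathbb{D}^n$$ (this known formula may be taken as the definition of $S_n$). The Hermitian metric $g_n$ on $\mathbb{G}_n$ has, in the coordinates $u=(u_1,\ldots,u_n)\in\mathbb{G}_n$, the matrix $$[g_n(u)]_{\alpha\beta}=\frac{\partial^2}{\partial u_\beta\,\partial\overline{u_\alpha}}\log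 S_n(u,u),$$ so that $v\in\mathbb{C}^n$ has squared length $v^*g_n(u)v$ at $u$. For a holomorphic map $F\colon\mathbb{G}_n\to\mathbb{G}_n$ with complex Jacobian matrix $DF$, the pullback $F^*g_n$ is the Hermitian form with matrix $DF(u)^*\,g_n(F(u))\,DF(u)$ at $u$. An inequality $F^*g_n\le C\,g_n$ means that at every $u\in\mathbb{G}_n$ the matrix $C\,g_n(u)-DF(u)^*g_n(F(u))DF(u)$ is positive semidefinite. A map is proper if preimages of compact sets are compact. The degree $\deg F$ of a proper holomorphic map $F\colon\mathbb{G}_n\to\mathbb{G}_n$ is the number of preimages of a generic point, i.e. of any regular value of $F$. *)

theory Defs
  imports "HOL-Complex_Analysis.Complex_Analysis"
begin

text \<open>
  The dimension is \<open>n = CARD('n)\<close>, for an arbitrary finite linearly ordered index type \<open>'n\<close>; the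
  order serves to number the coordinates \<open>1, ..., n\<close>, so that the coordinate with index \<open>i\<close> has
  number \<open>card {j. j \<le> i}\<close>.
\<close>

definition esymm :: "nat \<Rightarrow> complex^'n \<Rightarrow> complex" where
  "esymm k Z = (\<Sum>I | card I = k. \<Prod>i\<in>I. Z $ i)"

definition symmetrization ::
  "complex^('n::{finite,linorder}) \<Rightarrow> complex^('n::{finite,linorder})" where
  "symmetrization Z = (\<chi> i. esymm (card {j. j \<le> i}) Z)"

definition polydisc :: "(complex^'n) set" where
  "polydisc = {Z. \<forall>i. Z $ i \<in> ball 0 1}"

definition sym_polydisc :: "(complex^('n::{finite,linorder})) set" where
  "sym_polydisc = symmetrization ` polydisc"

definition szego_prod :: "complex^'n \<Rightarrow> complex^'n \<Rightarrow> complex" where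
  "szego_prod Z W = (\<Prod>i\<in>UNIV. \<Prod>j\<in>UNIV. 1 / (1 - Z $ i * cnj (W $ j)))"

text \<open>Meaningful only on the symmetrized polydisc; well-definedness is \<open>szego_symmetrization\<close> below.\<close>

definition szego ::
  "complex^('n::{finite,linorder}) \<Rightarrow> complex^('n::{finite,linorder}) \<Rightarrow> complex" where
  "szego u v = (THE s. \<exists>Z\<in>polydisc. \<exists>W\<in>polydisc.
     symmetrization Z = u \<and> symmetrization W = v \<and> s = szego_prod Z W)"

lemma ex_coordinate_number:
  assumes "1 \<le> k" "k \<le> CARD('n::{finite,linorder})"
  shows "\<exists>i::'n. card {j. j \<le> i} = k"
proof -
  let ?f = "\<lambda>i::'n. card {j. j \<le> i}"
  have "strict_mono ?f"
    by (rule strict_monoI, rule psubset_card_mono) (auto simp: psubset_eq set_eq_iff intro: exI dest: leD)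
  then have inj: "inj ?f"
    by (rule strict_mono_imp_inj_on)
  have sub: "range ?f \<subseteq> {1..CARD('n)}"
  proof clarify
    fix i :: 'n
    have "card {i} \<le> ?f i" by (rule card_mono) auto
    moreover have "?f i \<le> CARD('n)" by (rule card_mono) auto
    ultimately show "?f i \<in> {1..CARD('n)}" by simp
  qed
  have "range ?f = {1..CARD('n)}"
    by (rule card_subset_eq) (use sub inj in \<open>auto simp: card_image\<close>)
  with assms have "k \<in> range ?f" by simp
  then show ?thesis by auto
qed

lemma esymm_eq_if_symmetrization_eq:
  fixes Z W :: "complex^('n::{finite,linorder})"
  assumes "symmetrization Z = symmetrization W"
  shows "esymm k Z = esymm k W"
proof (cases "1 \<le> k \<and> k \<le> CARD('n)")
  case True
  then obtain i :: 'n where "card {j. j \<le> i} = k"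
    using ex_coordinate_number by blast
  with assms show ?thesis
    by (auto simp: symmetrization_def vec_eq_iff)
next
  case False
  have "k = 0 \<or> {I :: 'n set. card I = k} = {}"
    using False card_mono[of "UNIV :: 'n set"] by fastforce
  then show ?thesis
    by (auto simp: esymm_def)
qed

lemma prod_one_minus_esymm:
  fixes Z :: "complex^('n::{finite,linorder})"
  shows "(\<Prod>i\<in>UNIV. 1 - Z $ i * c) = (\<Sum>k\<le>CARD('n). esymm k Z * (- c) ^ k)"
proof -
  have "(\<Prod>i\<in>UNIV. 1 - Z $ i * c) = (\<Prod>i\<in>UNIV. Z $ i * (- c) + 1)"
    by simp
  also have "\<dots> = (\<Sum>I\<in>Pow UNIV. (\<Prod>i\<in>I. Z $ i * (- c)) * (\<Prod>i\<in>UNIV - I. 1))"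
    by (rule prod_add) simp
  also have "\<dots> = (\<Sum>I\<in>UNIV. (\<Prod>i\<in>I. Z $ i) * (- c) ^ card I)"
    by (simp only: prod.distrib prod_constant Pow_UNIV power_one mult_1_right)
  also have "\<dots> = (\<Sum>k\<le>CARD('n). \<Sum>I | I \<in> UNIV \<and> card I = k. (\<Prod>i\<in>I. Z $ i) * (- c) ^ card I)"
    by (rule sum.group[symmetric]) (auto intro: card_mono)
  also have "\<dots> = (\<Sum>k\<le>CARD('n). esymm k Z * (- c) ^ k)"
    by (simp add: esymm_def sum_distrib_right)
  finally show ?thesis .
qed

lemma szego_symmetrization:
  fixes Z W :: "complex^('n::{finite,linorder})"
  assumes "Z \<in> polydisc" "W \<in> polydisc"
  shows "szego (symmetrization Z) (symmetrization W) = szego_prod Z W"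
proof -
  have fst_arg: "szego_prod Z W = szego_prod Z' W"
    if "symmetrization Z = symmetrization Z'" for Z Z' W :: "complex^('n::{finite,linorder})"
  proof -
    have *: "szego_prod X W = (\<Prod>j\<in>UNIV. 1 / (\<Prod>i\<in>UNIV. 1 - X $ i * cnj (W $ j)))" for X
      unfolding szego_prod_def by (subst prod.swap) (simp add: prod_dividef)
    show ?thesis
      unfolding * prod_one_minus_esymm
      by (simp add: esymm_eq_if_symmetrization_eq[OF that])
  qed
  have swap: "szego_prod Z W = cnj (szego_prod W Z)" for Z W :: "complex^('n::{finite,linorder})"
    unfolding szego_prod_def by (subst prod.swap) (simp add: mult.commute)
  have "szego_prod Z' W' = szego_prod Z W"
    if "symmetrization Z' = symmetrization Z" "symmetrization W' = symmetrization W" for Z' W'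
    using fst_arg[OF that(1)] fst_arg[OF that(2)] swap by metis
  then show ?thesis
    unfolding szego_def using assms by (intro the_equality) blast+
qed

definition dir_deriv :: "(complex^'n \<Rightarrow> complex) \<Rightarrow> complex^'n \<Rightarrow> complex^'n \<Rightarrow> complex" where
  "dir_deriv f v u = vector_derivative (\<lambda>t::real. f (u + t *\<^sub>R v)) (at 0)"

text \<open>
  The Wirtinger derivatives \<open>\<partial>/\<partial>u\<^sub>i = (\<partial>/\<partial>x\<^sub>i - \<i> \<partial>/\<partial>y\<^sub>i)/2\<close> and their conjugates
  \<open>(\<partial>/\<partial>x\<^sub>i + \<i> \<partial>/\<partial>y\<^sub>i)/2\<close>, where \<open>u\<^sub>i = x\<^sub>i + \<i> y\<^sub>i\<close>.
\<close>

definition wirtinger :: "'n \<Rightarrow> (complex^'n \<Rightarrow> complex) \<Rightarrow> complex^'n \<Rightarrow> complex" where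
  "wirtinger i f u = (dir_deriv f (axis i 1) u - \<i> * dir_deriv f (axis i \<i>) u) / 2"

definition wirtinger_cnj :: "'n \<Rightarrow> (complex^'n \<Rightarrow> complex) \<Rightarrow> complex^'n \<Rightarrow> complex" where
  "wirtinger_cnj i f u = (dir_deriv f (axis i 1) u + \<i> * dir_deriv f (axis i \<i>) u) / 2"

text \<open>
  The diagonal value \<open>szego u u\<close> is a positive real on the symmetrized polydisc (off-diagonal factors
  of \<open>szego_prod Z Z\<close> come in conjugate pairs), so \<open>Ln\<close> is the real logarithm there.
\<close>

definition szego_metric ::
  "complex^('n::{finite,linorder}) \<Rightarrow> complex^('n::{finite,linorder})^('n::{finite,linorder})" where
  "szego_metric u = (\<chi> \<alpha> \<beta>. wirtinger \<beta> (wirtinger_cnj \<alpha> (\<lambda>w. Ln (szego w w))) u)"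

definition holomorphic_map_on ::
  "(complex^'n \<Rightarrow> complex^'m) \<Rightarrow> (complex^'n) set \<Rightarrow> bool" (infixl "holomorphic'_map'_on" 50) where
  "F holomorphic_map_on S \<longleftrightarrow>
     (\<forall>u\<in>S. \<exists>A :: complex^'n^'m. (F has_derivative (\<lambda>h. A *v h)) (at u within S))"

definition complex_jacobian :: "(complex^'n \<Rightarrow> complex^'m) \<Rightarrow> complex^'n \<Rightarrow> complex^'n^'m" where
  "complex_jacobian F u = (\<chi> i j. deriv (\<lambda>t. F (u + axis j t) $ i) 0)"

definition conj_transpose :: "complex^'n^'m \<Rightarrow> complex^'m^'n" where
  "conj_transpose A = (\<chi> i j. cnj (A $ j $ i))"

definition pos_semidef :: "complex^'n^'n \<Rightarrow> bool" where
  "pos_semidef A \<longleftrightarrow> conj_transpose A = A \<and>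
     (\<forall>v. 0 \<le> Re (\<Sum>i\<in>UNIV. cnj (v $ i) * (A *v v) $ i))"

definition pullback_metric ::
  "(complex^'n \<Rightarrow> complex^'m) \<Rightarrow> (complex^'m \<Rightarrow> complex^'m^'m) \<Rightarrow> complex^'n \<Rightarrow> complex^'n^'n" where
  "pullback_metric F g u =
     conj_transpose (complex_jacobian F u) ** g (F u) ** complex_jacobian F u"

definition pullback_le ::
  "(complex^('n::{finite,linorder}) \<Rightarrow> complex^('n::{finite,linorder})) \<Rightarrow> real \<Rightarrow> bool" where
  "pullback_le F C \<longleftrightarrow> (\<forall>u\<in>sym_polydisc.
     pos_semidef (C *\<^sub>R szego_metric u - pullback_metric F szego_metric u))"

definition proper_holomorphic_self_map ::
  "(complex^('n::{finite,linorder}) \<Rightarrow> complex^('n::{finite,linorder})) \<Rightarrow> bool" where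
  "proper_holomorphic_self_map F \<longleftrightarrow>
     F ` sym_polydisc \<subseteq> sym_polydisc \<and> F holomorphic_map_on sym_polydisc \<and>
     (\<forall>K. compact K \<and> K \<subseteq> sym_polydisc \<longrightarrow> compact {u \<in> sym_polydisc. F u \<in> K})"

definition regular_value ::
  "(complex^('n::{finite,linorder}) \<Rightarrow> complex^('n::{finite,linorder})) \<Rightarrow> complex^('n::{finite,linorder}) \<Rightarrow> bool" where
  "regular_value F w \<longleftrightarrow> w \<in> sym_polydisc \<and>
     (\<forall>u\<in>sym_polydisc. F u = w \<longrightarrow> det (complex_jacobian F u) \<noteq> 0)"

text \<open>
  For a proper holomorphic self-map, regular values exist and their fibres are compact and discrete,
  hence finite, with a common number of elements.
\<close>

definition map_degree :: "(complex^('n::{finite,linorder}) \<Rightarrow> complex^('n::{finite,linorder})) \<Rightarrow> nat" where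
  "map_degree F =
     (THE m. \<forall>w. regular_value F w \<longrightarrow> card {u \<in> sym_polydisc. F u = w} = m)"

end

theory Submission
  imports Defs "HOL-Computational_Algebra.Fundamental_Theorem_Algebra" "HOL-Combinatorics.Permutations"
begin

text \<open>
  A point \<open>u\<close> of the symmetrized polydisc is the multiset of roots of a monic polynomial (\<open>root_poly u\<close>),
  so a self-map \<open>F\<close> is a rule that assigns to \<open>n\<close> points of the disc \<open>n\<close> points of the disc. The proof
  rests on a description of the proper maps and on an inequality for Gram matrices.

  Proper maps (\<open>proper_self_map_induced_by_blaschke\<close>): every proper \<open>F\<close> applies one finite Blaschke
  product \<open>b\<close> to each of the \<open>n\<close> points. Move \<open>Z\<close> and \<open>Z'\<close> to the boundary along a common coordinate
  \<open>a\<close>. Properness drives a root for \<open>Z\<close> to the unit circle, and by the theorems of Montel and Hurwitz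
  the roots for \<open>Z'\<close> have to follow. Hence the resultant of the two polynomials tends to \<open>0\<close> at the
  boundary of the \<open>a\<close>-disc and vanishes by the maximum principle: two points with a common coordinate
  have images with a common coordinate (\<open>proper_root_family_share_root\<close>). An identity theorem turns
  this into roots that depend on one coordinate only, and counting shows that each coordinate
  contributes exactly one (\<open>proper_root_family_structure\<close>). The resulting function of one variable is
  a proper map of the disc, thus a finite Blaschke product, of degree \<open>d\<close> say.

  Metric: pulled back to the polydisc by the symmetrization, \<open>log S\<close> is the sum of
  \<open>- log (1 - z\<^sub>j cnj z\<^sub>k)\<close> over all \<open>j\<close> and \<open>k\<close>, so the metric becomes the matrix
  \<open>1 / (1 - z\<^sub>j cnj z\<^sub>k)\<^sup>2\<close> (\<open>sesq_szego_metric\<close>), the Gram matrix of the Bergman kernel. The claim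
  \<open>F\<^sup>*g \<le> C g\<close> then says that passing from the points \<open>z\<^sub>j\<close> with weights \<open>v\<^sub>j\<close> to the points \<open>b(z\<^sub>j)\<close>
  with weights \<open>b'(z\<^sub>j) v\<^sub>j\<close> enlarges the quadratic form at most by the factor \<open>C\<close>.
  The comparison is made at points with distinct coordinates, where the symmetrization is a local
  biholomorphism; the remaining points follow by continuity.

  Upper bound (\<open>bergman_form_le\<close>): the quotient \<open>(1 - b(z) cnj b(w)) / (1 - z cnj w)\<close> is the kernel of
  a space of dimension \<open>d\<close>, and in two suitable bases of it \<open>b' = \<Sum> e\<^sub>k e'\<^sub>k\<close>. This exhibits the form
  for \<open>b(z)\<close> as the squared norm of a partial trace over \<open>d\<close> dimensions of a tensor whose squared norm
  is the form for \<open>z\<close>. The Cauchy-Schwarz inequality bounds the trace with the factor \<open>d\<close>; since the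
  tensor has rank at most \<open>n\<close>, also the factor \<open>n\<close> suffices.

  Degree (\<open>map_degree_induced\<close>): a regular value has coordinates \<open>w\<^sub>i\<close> with \<open>d\<close> simple preimages under
  \<open>b\<close> each, and they combine freely to \<open>d ^ n\<close> points of the fibre. So \<open>(deg F) ^ (1/n) = d\<close>.

  Sharpness (\<open>ex_proper_map_not_pullback_le\<close>): the form is the sum of
  \<open>(m + 1) |\<Sum> v\<^sub>j z\<^sub>j ^ m|\<^sup>2\<close> over all \<open>m\<close>. For points at \<open>r\<close> times the \<open>n\<close>-th roots of unity, the weights can be chosen such
  that only the term \<open>m = k - 1\<close> survives in the limit \<open>r \<rightarrow> 0\<close>, where \<open>k = min n d\<close>; the form tends
  to \<open>k\<close>. The Blaschke product \<open>z ^ k ((z + a) / (1 + a z)) ^ (d - k)\<close> has derivative about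
  \<open>k a ^ (d - k) z ^ (k - 1)\<close> near \<open>0\<close>, and the term \<open>m = 0\<close> of the form of the images tends to
  \<open>k\<^sup>2 a ^ (2 (d - k))\<close>. The quotient comes arbitrarily close to \<open>k\<close> as \<open>a \<rightarrow> 1\<close>.
\<close>

(* Formal power series also use the dollar sign, for their coefficients. *)
no_notation fps_nth (infixl "$" 75)

section \<open>The symmetrization map and its fibres\<close>

definition coord_number :: "'n::{finite,linorder} \<Rightarrow> nat" where
  "coord_number i = card {j. j \<le> i}"

lemma bij_betw_coord_number:
  "bij_betw coord_number (UNIV :: 'n::{finite,linorder} set) {1..CARD('n)}"
proof -
  have "strict_mono (coord_number :: 'n \<Rightarrow> nat)"
    unfolding coord_number_def
    by (rule strict_monoI, rule psubset_card_mono) (auto simp: psubset_eq set_eq_iff intro: exI dest: leD)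
  then have inj: "inj (coord_number :: 'n \<Rightarrow> nat)"
    by (rule strict_mono_imp_inj_on)
  have "range (coord_number :: 'n \<Rightarrow> nat) = {1..CARD('n)}"
  proof
    show "range (coord_number :: 'n \<Rightarrow> nat) \<subseteq> {1..CARD('n)}"
      unfolding coord_number_def
      by (auto intro!: card_mono simp: Suc_le_eq card_gt_0_iff)
    show "{1..CARD('n)} \<subseteq> range (coord_number :: 'n \<Rightarrow> nat)"
      using ex_coordinate_number[where 'n='n] unfolding coord_number_def by fastforce
  qed
  with inj show ?thesis by (simp add: bij_betw_def)
qed

lemma coord_number_bounds: "1 \<le> coord_number i" "coord_number (i :: 'n::{finite,linorder}) \<le> CARD('n)"
  using bij_betw_coord_number[where 'n='n] unfolding bij_betw_def by fastforce+

text \<open>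
  By Vieta's formulas, \<open>root_poly (symmetrization Z)\<close> is the monic polynomial with roots \<open>Z $
  i\<close>.
\<close>

definition root_poly :: "complex^('n::{finite,linorder}) \<Rightarrow> complex poly" where
  "root_poly u = monom 1 CARD('n)
     + (\<Sum>i\<in>UNIV. monom ((- 1) ^ coord_number i * u $ i) (CARD('n) - coord_number i))"

lemma poly_root_poly:
  fixes u :: "complex^('n::{finite,linorder})"
  shows "poly (root_poly u) x =
    x ^ CARD('n) + (\<Sum>i\<in>UNIV. (- 1) ^ coord_number i * u $ i * x ^ (CARD('n) - coord_number i))"
  by (simp add: root_poly_def poly_sum poly_monom)

lemma poly_root_poly_symmetrization:
  fixes Z :: "complex^('n::{finite,linorder})"
  shows "poly (root_poly (symmetrization Z)) x = (\<Prod>i\<in>UNIV. x - Z $ i)"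
proof -
  have "(\<Prod>i\<in>UNIV. x - Z $ i) = (\<Prod>i\<in>UNIV. (- 1) * Z $ i + x)"
    by simp
  also have "\<dots> = (\<Sum>I\<in>Pow UNIV. (\<Prod>i\<in>I. (- 1) * Z $ i) * (\<Prod>i\<in>UNIV - I. x))"
    by (rule prod_add) simp
  also have "\<dots> = (\<Sum>I\<in>UNIV. (- 1) ^ card I * (\<Prod>i\<in>I. Z $ i) * x ^ (CARD('n) - card I))"
    by (simp only: prod.distrib prod_constant Pow_UNIV) (simp add: card_Diff_subset)
  also have "\<dots> = (\<Sum>k\<le>CARD('n). \<Sum>I | I \<in> UNIV \<and> card I = k.
      (- 1) ^ card I * (\<Prod>i\<in>I. Z $ i) * x ^ (CARD('n) - card I))"
    by (rule sum.group[symmetric]) (auto intro: card_mono)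
  also have "\<dots> = (\<Sum>k\<le>CARD('n). (- 1) ^ k * esymm k Z * x ^ (CARD('n) - k))"
    by (simp add: esymm_def sum_distrib_right sum_distrib_left)
  also have "\<dots> = x ^ CARD('n) + (\<Sum>k\<in>{1..CARD('n)}. (- 1) ^ k * esymm k Z * x ^ (CARD('n) - k))"
  proof -
    have "{I :: 'n set. I = {}} = {{}}" by auto
    then show ?thesis
      by (subst sum.atMost_shift) (simp add: esymm_def sum.atLeast1_atMost_eq atLeast0LessThan lessThan_Suc_atMost)
  qed
  also have "(\<Sum>k\<in>{1..CARD('n)}. (- 1) ^ k * esymm k Z * x ^ (CARD('n) - k)) =
     (\<Sum>i\<in>(UNIV::'n set). (- 1) ^ coord_number i * esymm (coord_number i) Z * x ^ (CARD('n) - coord_number i))"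
    by (rule sum.reindex_bij_betw[symmetric, OF bij_betw_coord_number])
  finally show ?thesis
    by (simp add: poly_root_poly symmetrization_def coord_number_def)
qed

lemma root_poly_symmetrization:
  fixes Z :: "complex^('n::{finite,linorder})"
  shows "root_poly (symmetrization Z) = (\<Prod>i\<in>UNIV. [:- Z $ i, 1:])"
  by (rule poly_ext) (simp add: poly_root_poly_symmetrization poly_prod)

lemma coeff_root_poly:
  fixes u :: "complex^('n::{finite,linorder})"
  shows "coeff (root_poly u) (CARD('n) - coord_number i) = (- 1) ^ coord_number i * u $ i"
proof -
  have "(CARD('n) - coord_number j = CARD('n) - coord_number i) = (j = i)" for j :: 'n
    using coord_number_bounds[of i] coord_number_bounds[of j]
      bij_betw_coord_number[where 'n='n] by (auto simp: bij_betw_def inj_on_def)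
  moreover have "CARD('n) - coord_number i \<noteq> CARD('n)"
    using coord_number_bounds[of i] by simp
  ultimately show ?thesis
    by (simp add: root_poly_def coeff_sum)
qed

lemma root_poly_inject:
  fixes u v :: "complex^('n::{finite,linorder})"
  shows "root_poly u = root_poly v \<longleftrightarrow> u = v"
proof
  assume eq: "root_poly u = root_poly v"
  show "u = v"
    unfolding vec_eq_iff
  proof
    fix i :: 'n
    show "u $ i = v $ i"
      using coeff_root_poly[of u i] coeff_root_poly[of v i] eq by simp
  qed
qed simp

lemma degree_root_poly:
  "degree (root_poly (u :: complex^('n::{finite,linorder}))) = CARD('n)"
  and lead_coeff_root_poly: "coeff (root_poly u) CARD('n) = 1"
proof -
  let ?s = "\<Sum>i\<in>UNIV. monom ((- 1) ^ coord_number i * u $ i) (CARD('n) - coord_number i)"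
  have 1: "coeff ?s k = 0" if "k \<ge> CARD('n)" for k
    unfolding coeff_sum
  proof (rule sum.neutral, rule)
    fix i :: 'n
    show "coeff (monom ((- 1) ^ coord_number i * u $ i) (CARD('n) - coord_number i)) k = 0"
      using coord_number_bounds[of i] that by (auto simp: coeff_monom)
  qed
  show 2: "coeff (root_poly u) CARD('n) = 1"
    using 1[of "CARD('n)"] by (simp add: root_poly_def)
  show "degree (root_poly u) = CARD('n)"
  proof (rule antisym)
    show "degree (root_poly u) \<le> CARD('n)"
      using 1 by (intro degree_le) (auto simp: root_poly_def coeff_monom)
    show "CARD('n) \<le> degree (root_poly u)"
      using 2 by (intro le_degree) simp
  qed
qed

lemma root_poly_nonzero [simp]: "root_poly u \<noteq> 0"
  using lead_coeff_root_poly[of u] by auto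

text \<open>
  The reciprocal polynomial of \<open>root_poly u\<close>. Unlike the latter, it detects roots outside the
  open disc as zeros in the compact closed disc.
\<close>

definition rev_root_poly :: "complex^('n::{finite,linorder}) \<Rightarrow> complex poly" where
  "rev_root_poly u = 1 + (\<Sum>i\<in>UNIV. monom ((- 1) ^ coord_number i * u $ i) (coord_number i))"

lemma poly_rev_root_poly_symmetrization:
  fixes Z :: "complex^('n::{finite,linorder})"
  shows "poly (rev_root_poly (symmetrization Z)) c = (\<Prod>i\<in>UNIV. 1 - Z $ i * c)"
proof -
  have "(\<Prod>i\<in>UNIV. 1 - Z $ i * c) = (\<Sum>k\<le>CARD('n). esymm k Z * (- c) ^ k)"
    by (rule prod_one_minus_esymm)
  also have "\<dots> = 1 + (\<Sum>k\<in>{1..CARD('n)}. esymm k Z * (- c) ^ k)"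
  proof -
    have "{I :: 'n set. I = {}} = {{}}" by auto
    then show ?thesis
      by (subst sum.atMost_shift) (simp add: esymm_def sum.atLeast1_atMost_eq)
  qed
  also have "(\<Sum>k\<in>{1..CARD('n)}. esymm k Z * (- c) ^ k) =
     (\<Sum>i\<in>(UNIV::'n set). esymm (coord_number i) Z * (- c) ^ coord_number i)"
    by (rule sum.reindex_bij_betw[symmetric, OF bij_betw_coord_number])
  finally show ?thesis
    by (simp add: rev_root_poly_def poly_sum poly_monom symmetrization_def coord_number_def power_minus[of c] mult_ac)
qed

lemma poly_rev_root_poly:
  fixes u :: "complex^('n::{finite,linorder})"
  shows "poly (rev_root_poly u) c = 1 + (\<Sum>i\<in>UNIV. (- 1) ^ coord_number i * u $ i * c ^ coord_number i)"
  by (simp add: rev_root_poly_def poly_sum poly_monom)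

lemma ex_image_mset_eq:
  assumes "finite A" "size M = card A"
  shows "\<exists>f. image_mset f (mset_set A) = M"
  using assms
proof (induction A arbitrary: M)
  case (insert a A)
  then have "size M \<noteq> 0" by simp
  then obtain x where "x \<in># M" by (metis multiset_nonemptyE size_empty)
  then obtain M' where M: "M = add_mset x M'" by (metis insert_DiffM)
  with insert obtain f where "image_mset f (mset_set A) = M'" by force
  then have "image_mset (f(a := x)) (mset_set (insert a A)) = M"
    using insert.hyps by (simp add: M) (auto intro: image_mset_cong)
  then show ?case by blast
qed simp

text \<open>
  By the fundamental theorem of algebra; any enumeration of the roots serves.
\<close>

lemma symmetrization_surj:
  fixes u :: "complex^('n::{finite,linorder})"
  obtains Z where "symmetrization Z = u"
proof -
  have "size (proots (root_poly u)) = card (UNIV :: 'n set)"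
    by (simp add: size_proots_complex degree_root_poly)
  then obtain f where f: "image_mset f (mset_set (UNIV :: 'n set)) = proots (root_poly u)"
    using ex_image_mset_eq[of "UNIV :: 'n set"] by auto
  have "root_poly u = (\<Prod>x\<in>#proots (root_poly u). [:-x, 1:])"
    using complex_poly_decompose_multiset[of "root_poly u"]
    by (simp add: degree_root_poly lead_coeff_root_poly)
  also have "\<dots> = (\<Prod>i\<in>UNIV. [:- f i, 1:])"
    by (simp flip: f add: image_mset.compositionality o_def prod_unfold_prod_mset)
  also have "\<dots> = root_poly (symmetrization (\<chi> i. f i))"
    by (simp add: root_poly_symmetrization)
  finally show ?thesis
    using that root_poly_inject by metis
qed

lemma proots_root_poly_symmetrization:
  fixes Z :: "complex^('n::{finite,linorder})"
  shows "proots (root_poly (symmetrization Z)) = image_mset (($) Z) (mset_set UNIV)"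
  by (simp add: root_poly_symmetrization proots_prod sum_unfold_sum_mset)
   
text \<open>
  A monic polynomial determines the multiset of its roots.
\<close>

lemma symmetrization_eq_iff:
  fixes Z W :: "complex^('n::{finite,linorder})"
  shows "symmetrization Z = symmetrization W \<longleftrightarrow> (\<exists>\<sigma>. \<sigma> permutes UNIV \<and> W = (\<chi> i. Z $ \<sigma> i))"
proof
  assume "symmetrization Z = symmetrization W"
  then have "image_mset (($) W) (mset_set UNIV) = image_mset (($) Z) (mset_set UNIV)"
    by (metis proots_root_poly_symmetrization)
  then obtain \<sigma> where "\<sigma> permutes UNIV" "\<forall>i\<in>UNIV. W $ i = Z $ \<sigma> i"
    by (rule image_mset_eq_implies_permutes[rotated]) auto
  then show "\<exists>\<sigma>. \<sigma> permutes UNIV \<and> W = (\<chi> i. Z $ \<sigma> i)"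
    by (auto simp: vec_eq_iff)
next
  assume "\<exists>\<sigma>. \<sigma> permutes UNIV \<and> W = (\<chi> i. Z $ \<sigma> i)"
  then obtain \<sigma> where \<sigma>: "\<sigma> permutes UNIV" "W = (\<chi> i. Z $ \<sigma> i)" by blast
  have "root_poly (symmetrization W) = (\<Prod>i\<in>UNIV. [:- Z $ \<sigma> i, 1:])"
    by (simp add: root_poly_symmetrization \<sigma>)
  also have "\<dots> = root_poly (symmetrization Z)"
    unfolding root_poly_symmetrization
    by (rule prod.reindex_bij_betw) (use \<sigma> in \<open>auto dest: permutes_bij\<close>)
  finally show "symmetrization Z = symmetrization W"
    by (simp add: root_poly_inject)
qed

lemma symmetrization_permute:
  "\<sigma> permutes UNIV \<Longrightarrow> symmetrization (\<chi> i. Z $ \<sigma> i) = symmetrization Z"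
  using symmetrization_eq_iff[of Z "\<chi> i. Z $ \<sigma> i"] by auto

lemma symmetrization_in_sym_polydisc_iff [simp]:
  "symmetrization Z \<in> sym_polydisc \<longleftrightarrow> Z \<in> polydisc"
proof
  assume "symmetrization Z \<in> sym_polydisc"
  then obtain W where "W \<in> polydisc" "symmetrization W = symmetrization Z"
    by (auto simp: sym_polydisc_def)
  then show "Z \<in> polydisc"
    by (auto simp: symmetrization_eq_iff polydisc_def)
qed (auto simp: sym_polydisc_def)

lemma polydisc_iff: "Z \<in> polydisc \<longleftrightarrow> (\<forall>i. norm (Z $ i) < 1)"
  by (simp add: polydisc_def)

lemma continuous_symmetrization: "continuous_on UNIV symmetrization"
  unfolding symmetrization_def esymm_def
  by (intro continuous_on_vec_lambda continuous_intros)

lemma open_polydisc: "open (polydisc :: (complex^'n) set)"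
proof -
  have "polydisc = (\<Inter>i. (\<lambda>Z::complex^'n. Z $ i) -` ball 0 1)"
    by (auto simp: polydisc_def)
  also have "open \<dots>"
    by (intro open_INT ballI open_vimage continuous_intros) auto
  finally show ?thesis .
qed

lemma convex_polydisc: "convex (polydisc :: (complex^'n) set)"
proof -
  have "polydisc = (\<Inter>i. (\<lambda>Z::complex^'n. Z $ i) -` ball 0 1)"
    by (auto simp: polydisc_def)
  also have "convex \<dots>"
    by (intro convex_INT convex_linear_vimage convex_ball)
       (auto intro!: linearI)
  finally show ?thesis .
qed

text \<open>
  The complement consists of those \<open>u\<close> whose reciprocal polynomial has a zero in the closed
  disc. It is the projection of a closed set along a compact one, hence closed.
\<close>

lemma open_sym_polydisc: "open (sym_polydisc :: (complex^('n::{finite,linorder})) set)"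
proof -
  have "- sym_polydisc = {u ::  (complex,'n) vec. \<exists>c. c \<in> cball 0 1 \<and> poly (rev_root_poly u) c = 0}"
  proof (intro set_eqI)
    fix u :: "(complex,'n) vec"
    obtain Z where Z: "symmetrization Z = u" by (rule symmetrization_surj)
    have "Z \<notin> polydisc \<longleftrightarrow> (\<exists>i. \<exists>c. norm c \<le> 1 \<and> 1 - Z $ i * c = 0)"
    proof -
      have "(\<not> norm x < 1) = (\<exists>c. norm c \<le> 1 \<and> 1 - x * c = 0)" for x :: complex
      proof
        assume "\<not> norm x < 1"
        then show "\<exists>c. norm c \<le> 1 \<and> 1 - x * c = 0"
          by (intro exI[of _ "1 / x"]) (auto simp: norm_divide)
      next
        assume "\<exists>c. norm c \<le> 1 \<and> 1 - x * c = 0"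
        then obtain c where "norm c \<le> 1" "x * c = 1" by auto
        then show "\<not> norm x < 1"
          by (metis less_eq_real_def mult_left_le mult_left_mono norm_ge_zero norm_mult norm_one
              mult.right_neutral order.strict_trans1 not_less)
      qed
      then show ?thesis by (auto simp: polydisc_iff)
    qed
    also have "\<dots> \<longleftrightarrow> (\<exists>c. norm c \<le> 1 \<and> poly (rev_root_poly u) c = 0)"
      by (subst Z[symmetric]) (auto simp: poly_rev_root_poly_symmetrization)
    finally show "u \<in> - sym_polydisc \<longleftrightarrow> u \<in> {u. \<exists>c. c \<in> cball 0 1 \<and> poly (rev_root_poly u) c = 0}"
      using symmetrization_in_sym_polydisc_iff[of Z] by (simp add: Z)
  qed
  moreover have "closed {p :: complex \<times> (complex,'n) vec. poly (rev_root_poly (snd p)) (fst p) = 0}"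
    unfolding poly_rev_root_poly by (intro closed_Collect_eq continuous_intros)
  then have "closed {u ::  (complex,'n) vec. \<exists>c. c \<in> cball 0 1 \<and> poly (rev_root_poly u) c = 0}"
    using closed_compact_projection[of "cball (0 :: complex) 1" "{p. poly (rev_root_poly (snd p)) (fst p) = 0}"]
    by simp
  ultimately show ?thesis
    by (simp add: open_closed)
qed

definition closed_polydisc :: "real \<Rightarrow> (complex^'n) set" where
  "closed_polydisc r = {Z. \<forall>i. norm (Z $ i) \<le> r}"

lemma compact_closed_polydisc: "compact (closed_polydisc r :: (complex^'n) set)"
proof (rule compact_eq_bounded_closed[THEN iffD2], rule conjI)
  have "norm Z \<le> (\<Sum>i\<in>(UNIV::'n set). r)" if "Z \<in> closed_polydisc r" for Z :: "complex^'n"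
  proof -
    have "norm Z \<le> (\<Sum>i\<in>UNIV. norm (Z $ i))"
      unfolding norm_vec_def by (rule L2_set_le_sum) simp
    also have "\<dots> \<le> (\<Sum>i\<in>(UNIV::'n set). r)"
      by (rule sum_mono) (use that in \<open>auto simp: closed_polydisc_def\<close>)
    finally show ?thesis .
  qed
  then show "bounded (closed_polydisc r :: (complex^'n) set)"
    by (auto simp: bounded_iff)
  have "closed_polydisc r = (\<Inter>i. (\<lambda>Z::complex^'n. Z $ i) -` cball 0 r)"
    by (auto simp: closed_polydisc_def)
  also have "closed \<dots>"
    by (intro closed_INT ballI closed_vimage continuous_intros) auto
  finally show "closed (closed_polydisc r :: (complex^'n) set)" .
qed

lemma compact_symmetrization_closed_polydisc:
  "compact (symmetrization ` (closed_polydisc r :: (complex^('n::{finite,linorder})) set))"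
  by (intro compact_continuous_image compact_closed_polydisc continuous_on_subset[OF continuous_symmetrization]) auto

lemma symmetrization_closed_polydisc_subset:
  assumes "r < 1"
  shows "symmetrization ` (closed_polydisc r :: (complex^('n::{finite,linorder})) set) \<subseteq> sym_polydisc"
proof (rule image_subsetI)
  fix Z :: "(complex,'n) vec" assume "Z \<in> closed_polydisc r"
  then have "norm (Z $ i) \<le> r" for i by (simp add: closed_polydisc_def)
  from le_less_trans[OF this assms] show "symmetrization Z \<in> sym_polydisc" by (simp add: polydisc_iff)
qed

text \<open>
  The symmetrization is proper: the preimage of \<open>K\<close> is closed, and it is bounded since it lies
  in the polydisc. So each coordinate attains its largest modulus there.
\<close>

lemma compact_subset_sym_polydisc:
  fixes K :: "(complex^('n::{finite,linorder})) set"
  assumes "compact K" "K \<subseteq> sym_polydisc"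
  obtains r where "0 < r" "r < 1" "symmetrization -` K \<subseteq> closed_polydisc r"
proof -
  let ?V = "symmetrization -` K"
  have sub: "?V \<subseteq> polydisc" using assms(2) by auto
  also have "\<dots> \<subseteq> closed_polydisc 1" by (auto simp: polydisc_iff closed_polydisc_def less_imp_le)
  finally have "bounded ?V"
    using compact_closed_polydisc compact_imp_bounded bounded_subset by blast
  moreover have "closed ?V"
    using assms(1) by (intro closed_vimage compact_imp_closed continuous_symmetrization)
  ultimately have "compact ?V" by (simp add: compact_eq_bounded_closed)
  have "\<exists>r. r < 1 \<and> (\<forall>Z\<in>?V. norm (Z $ i) \<le> r)" for i
  proof (cases "?V = {}")
    case False
    from continuous_attains_sup[OF \<open>compact ?V\<close> False, of "\<lambda>Z. norm (Z $ i)"]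
    obtain Z where "Z \<in> ?V" "\<forall>Y\<in>?V. norm (Y $ i) \<le> norm (Z $ i)"
      by (force intro: continuous_intros)
    with sub show ?thesis by (intro exI[of _ "norm (Z $ i)"]) (auto simp: polydisc_iff)
  qed (auto intro: exI[of _ 0])
  then obtain r where r: "r i < 1" "\<forall>Z\<in>?V. norm (Z $ i) \<le> r i" for i by metis
  define R where "R = Max (insert (1/2) (range r))"
  have "R < 1" using r by (simp add: R_def)
  moreover have "1/2 \<le> R" "r i \<le> R" for i
    unfolding R_def by (intro Max_ge; simp)+
  moreover have "?V \<subseteq> closed_polydisc R"
    unfolding closed_polydisc_def using r(2) \<open>\<And>i. r i \<le> R\<close> by (blast intro: order_trans)
  ultimately show ?thesis by (intro that[of R]) auto
qed

section \<open>An inequality for Gram matrices of the Bergman kernel\<close>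

lemma norm_sum_mult_sq_le:
  fixes f g :: "'a \<Rightarrow> complex"
  shows "(norm (\<Sum>i\<in>A. f i * g i))\<^sup>2 \<le> (\<Sum>i\<in>A. (norm (f i))\<^sup>2) * (\<Sum>i\<in>A. (norm (g i))\<^sup>2)"
proof -
  have "norm (\<Sum>i\<in>A. f i * g i) \<le> (\<Sum>i\<in>A. norm (f i) * norm (g i))"
    by (rule order_trans[OF norm_sum]) (simp add: norm_mult)
  then have "(norm (\<Sum>i\<in>A. f i * g i))\<^sup>2 \<le> (\<Sum>i\<in>A. norm (f i) * norm (g i))\<^sup>2"
    by (rule power_mono) simp
  also have "\<dots> \<le> (\<Sum>i\<in>A. (norm (f i))\<^sup>2) * (\<Sum>i\<in>A. (norm (g i))\<^sup>2)"
    by (rule Cauchy_Schwarz_ineq_sum)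
  finally show ?thesis .
qed

lemma sum_mult_cnj_self: "(\<Sum>i\<in>A. f i * cnj (f i)) = of_real (\<Sum>i\<in>A. (norm (f i))\<^sup>2)"
  by (simp only: of_real_sum complex_norm_square)

text \<open>
  Gram-Schmidt for a family that may be linearly dependent: the zero vector stands in for a
  vector \<open>Y a\<close> in the span of the previous ones.
\<close>

lemma ex_gram_schmidt_vectors:
  fixes Y :: "'i \<Rightarrow> 'w \<Rightarrow> complex"
  assumes "finite I" "finite \<Omega>"
  shows "\<exists>t u. (\<forall>i\<in>I. \<forall>\<omega>\<in>\<Omega>. Y i \<omega> = (\<Sum>p\<in>I. t i p * u p \<omega>)) \<and>
    (\<forall>p\<in>I. \<forall>q\<in>I. p \<noteq> q \<longrightarrow> (\<Sum>\<omega>\<in>\<Omega>. u p \<omega> * cnj (u q \<omega>)) = 0) \<and>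
    (\<forall>p\<in>I. (\<forall>\<omega>\<in>\<Omega>. u p \<omega> = 0) \<or> (\<Sum>\<omega>\<in>\<Omega>. u p \<omega> * cnj (u p \<omega>)) = 1)"
  using \<open>finite I\<close>
proof (induction I)
  case (insert a I)
  from insert.IH obtain t u where tu: "(\<forall>i\<in>I. \<forall>\<omega>\<in>\<Omega>. Y i \<omega> = (\<Sum>p\<in>I. t i p * u p \<omega>)) \<and>
    (\<forall>p\<in>I. \<forall>q\<in>I. p \<noteq> q \<longrightarrow> (\<Sum>\<omega>\<in>\<Omega>. u p \<omega> * cnj (u q \<omega>)) = 0) \<and>
    (\<forall>p\<in>I. (\<forall>\<omega>\<in>\<Omega>. u p \<omega> = 0) \<or> (\<Sum>\<omega>\<in>\<Omega>. u p \<omega> * cnj (u p \<omega>)) = 1)"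
    by (elim exE)
  then have
    t: "\<And>i \<omega>. i \<in> I \<Longrightarrow> \<omega> \<in> \<Omega> \<Longrightarrow> Y i \<omega> = (\<Sum>p\<in>I. t i p * u p \<omega>)" and
    orth: "\<And>p q. p \<in> I \<Longrightarrow> q \<in> I \<Longrightarrow> p \<noteq> q \<Longrightarrow> (\<Sum>\<omega>\<in>\<Omega>. u p \<omega> * cnj (u q \<omega>)) = 0" and
    one: "\<And>p. p \<in> I \<Longrightarrow> (\<forall>\<omega>\<in>\<Omega>. u p \<omega> = 0) \<or> (\<Sum>\<omega>\<in>\<Omega>. u p \<omega> * cnj (u p \<omega>)) = 1"
    by simp_all
  define c where "c p = (\<Sum>\<omega>\<in>\<Omega>. Y a \<omega> * cnj (u p \<omega>))" for p
  define y where "y \<omega> = Y a \<omega> - (\<Sum>p\<in>I. c p * u p \<omega>)" for \<omega>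
  define r where "r = (\<Sum>\<omega>\<in>\<Omega>. (norm (y \<omega>))\<^sup>2)"
  have y_orth: "(\<Sum>\<omega>\<in>\<Omega>. y \<omega> * cnj (u q \<omega>)) = 0" if q: "q \<in> I" for q
  proof (cases "\<forall>\<omega>\<in>\<Omega>. u q \<omega> = 0")
    case False
    have "(\<Sum>\<omega>\<in>\<Omega>. \<Sum>p\<in>I. c p * u p \<omega> * cnj (u q \<omega>)) = (\<Sum>p\<in>I. c p * (\<Sum>\<omega>\<in>\<Omega>. u p \<omega> * cnj (u q \<omega>)))"
      by (subst sum.swap) (simp add: sum_distrib_left mult.assoc)
    also have "\<dots> = (\<Sum>p\<in>I. if p = q then c q else 0)"
      by (rule sum.cong) (use orth[OF _ q] one[OF q] False in auto)
    also have "\<dots> = c q" using q insert.hyps by simp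
    finally show ?thesis
      by (simp add: y_def c_def left_diff_distrib sum_subtractf sum_distrib_right)
  qed simp
  have r0: "y \<omega> = 0" if "r = 0" "\<omega> \<in> \<Omega>" for \<omega>
  proof -
    have "\<forall>\<omega>\<in>\<Omega>. (norm (y \<omega>))\<^sup>2 = 0"
      using that(1) \<open>finite \<Omega>\<close> unfolding r_def by (subst (asm) sum_nonneg_eq_0_iff) auto
    then show ?thesis using that by simp
  qed
  have "r \<ge> 0" unfolding r_def by (rule sum_nonneg) simp
  define s where "s = complex_of_real (sqrt r)"
  have s: "s * cnj s = of_real r" using \<open>r \<ge> 0\<close> by (simp add: s_def flip: of_real_mult)
  define u' where "u' = u(a := \<lambda>\<omega>. y \<omega> / s)"
  define t' where "t' i p = (if i = a then (if p = a then s else c p) else if p = a then 0 else t i p)" for i p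
  have yr: "y \<omega> = s * (y \<omega> / s)" if "\<omega> \<in> \<Omega>" for \<omega>
    using r0[OF _ that] by (cases "r = 0") (auto simp: s_def)
  have old: "u' p = u p" "p \<noteq> a" if "p \<in> I" for p
    using insert.hyps that by (auto simp: u'_def)
  have sum_insert: "(\<Sum>p\<in>insert a I. t' i p * u' p \<omega>) = t' i a * (y \<omega> / s) + (\<Sum>p\<in>I. t' i p * u p \<omega>)" for i \<omega>
    using insert.hyps by (auto simp: u'_def intro!: sum.cong)
  have "Y i \<omega> = (\<Sum>p\<in>insert a I. t' i p * u' p \<omega>)" if "i \<in> insert a I" "\<omega> \<in> \<Omega>" for i \<omega>
  proof (cases "i = a")
    case True
    have "(\<Sum>p\<in>I. t' a p * u p \<omega>) = (\<Sum>p\<in>I. c p * u p \<omega>)"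
      using old by (intro sum.cong) (auto simp: t'_def)
    then show ?thesis
      using yr[OF that(2)] by (simp only: True sum_insert) (simp add: t'_def y_def)
  next
    case False
    have "(\<Sum>p\<in>I. t' i p * u p \<omega>) = (\<Sum>p\<in>I. t i p * u p \<omega>)"
      using old False by (intro sum.cong) (auto simp: t'_def)
    with False that t[of i \<omega>] show ?thesis
      by (simp only: sum_insert) (simp add: t'_def)
  qed
  moreover have "(\<Sum>\<omega>\<in>\<Omega>. u' p \<omega> * cnj (u' q \<omega>)) = 0" if "p \<in> insert a I" "q \<in> insert a I" "p \<noteq> q" for p q
  proof -
    have 1: "(\<Sum>\<omega>\<in>\<Omega>. u' a \<omega> * cnj (u' q \<omega>)) = 0" if "q \<in> I" for q
      using y_orth[OF that] old[OF that]
      by (simp add: u'_def flip: sum_divide_distrib)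
    moreover have "(\<Sum>\<omega>\<in>\<Omega>. u' q \<omega> * cnj (u' a \<omega>)) = 0" if "q \<in> I" for q
      using arg_cong[OF 1[OF that], of cnj] by (simp add: mult.commute)
    ultimately show ?thesis
      using that orth old by (cases "p = a"; cases "q = a") auto
  qed
  moreover have "(\<forall>\<omega>\<in>\<Omega>. u' p \<omega> = 0) \<or> (\<Sum>\<omega>\<in>\<Omega>. u' p \<omega> * cnj (u' p \<omega>)) = 1" if "p \<in> insert a I" for p
  proof (cases "p = a")
    case True
    show ?thesis
    proof (cases "r = 0")
      case False
      have "(\<Sum>\<omega>\<in>\<Omega>. u' a \<omega> * cnj (u' a \<omega>)) = (\<Sum>\<omega>\<in>\<Omega>. y \<omega> * cnj (y \<omega>)) / (s * cnj s)"
        by (simp add: u'_def sum_divide_distrib)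
      also have "\<dots> = 1"
        using False by (simp only: s sum_mult_cnj_self r_def[symmetric]) simp
      finally show ?thesis by (simp add: True)
    qed (auto simp: u'_def True s_def)
  next
    case False
    with that one[of p] old[of p] show ?thesis by simp
  qed
  ultimately show ?case by blast
qed simp

text \<open>
  The coordinates \<open>t i\<close> of the vectors \<open>Y i\<close> have the same Gram matrix as the vectors themselves
  but only as many entries as there are vectors, whatever the size of \<open>\<Omega>\<close>.
\<close>

lemma gram_schmidt:
  fixes Y :: "'i \<Rightarrow> 'w \<Rightarrow> complex"
  assumes "finite I" "finite \<Omega>"
  obtains t u where
    "\<And>i \<omega>. i \<in> I \<Longrightarrow> \<omega> \<in> \<Omega> \<Longrightarrow> Y i \<omega> = (\<Sum>p\<in>I. t i p * u p \<omega>)"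
    "\<And>i j. i \<in> I \<Longrightarrow> j \<in> I \<Longrightarrow> (\<Sum>\<omega>\<in>\<Omega>. Y i \<omega> * cnj (Y j \<omega>)) = (\<Sum>p\<in>I. t i p * cnj (t j p))"
    "\<And>p. p \<in> I \<Longrightarrow> (\<Sum>\<omega>\<in>\<Omega>. (norm (u p \<omega>))\<^sup>2) \<le> 1"
proof -
  from ex_gram_schmidt_vectors[OF assms, of Y] obtain t u where tu: "(\<forall>i\<in>I. \<forall>\<omega>\<in>\<Omega>. Y i \<omega> = (\<Sum>p\<in>I. t i p * u p \<omega>)) \<and>
    (\<forall>p\<in>I. \<forall>q\<in>I. p \<noteq> q \<longrightarrow> (\<Sum>\<omega>\<in>\<Omega>. u p \<omega> * cnj (u q \<omega>)) = 0) \<and>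
    (\<forall>p\<in>I. (\<forall>\<omega>\<in>\<Omega>. u p \<omega> = 0) \<or> (\<Sum>\<omega>\<in>\<Omega>. u p \<omega> * cnj (u p \<omega>)) = 1)"
    by (elim exE)
  then have
    t: "\<And>i \<omega>. i \<in> I \<Longrightarrow> \<omega> \<in> \<Omega> \<Longrightarrow> Y i \<omega> = (\<Sum>p\<in>I. t i p * u p \<omega>)" and
    orth: "\<And>p q. p \<in> I \<Longrightarrow> q \<in> I \<Longrightarrow> p \<noteq> q \<Longrightarrow> (\<Sum>\<omega>\<in>\<Omega>. u p \<omega> * cnj (u q \<omega>)) = 0" and
    one: "\<And>p. p \<in> I \<Longrightarrow> (\<forall>\<omega>\<in>\<Omega>. u p \<omega> = 0) \<or> (\<Sum>\<omega>\<in>\<Omega>. u p \<omega> * cnj (u p \<omega>)) = 1"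
    by simp_all
  define N where "N p = (\<Sum>\<omega>\<in>\<Omega>. u p \<omega> * cnj (u p \<omega>))" for p
  have N: "(\<forall>\<omega>\<in>\<Omega>. u p \<omega> = 0) \<and> N p = 0 \<or> N p = 1" if "p \<in> I" for p
    using one[OF that] by (auto simp: N_def)
  \<comment> \<open>The factor \<open>N p\<close>, which is \<open>0\<close> or \<open>1\<close>, removes the coordinates along zero vectors. These are
    arbitrary so far, and would spoil the Gram matrix.\<close>
  show ?thesis
  proof (rule that[of "\<lambda>i p. t i p * N p" u])
    show "Y i \<omega> = (\<Sum>p\<in>I. t i p * N p * u p \<omega>)" if "i \<in> I" "\<omega> \<in> \<Omega>" for i \<omega>
      unfolding t[OF that] by (rule sum.cong) (use N that(2) in force)+
    show "(\<Sum>\<omega>\<in>\<Omega>. (norm (u p \<omega>))\<^sup>2) \<le> 1" if "p \<in> I" for p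
    proof -
      have "N p = of_real (\<Sum>\<omega>\<in>\<Omega>. (norm (u p \<omega>))\<^sup>2)"
        by (simp only: N_def sum_mult_cnj_self)
      moreover have "N p = of_real 0 \<or> N p = of_real 1" using N[OF that] by auto
      ultimately show ?thesis by (metis of_real_eq_iff order_refl zero_le_one)
    qed
    fix i j assume ij: "i \<in> I" "j \<in> I"
    have "(\<Sum>\<omega>\<in>\<Omega>. Y i \<omega> * cnj (Y j \<omega>)) =
      (\<Sum>\<omega>\<in>\<Omega>. \<Sum>p\<in>I. \<Sum>q\<in>I. t i p * cnj (t j q) * (u p \<omega> * cnj (u q \<omega>)))"
      by (rule sum.cong) (simp_all add: t ij sum_product mult_ac)
    also have "\<dots> = (\<Sum>p\<in>I. \<Sum>q\<in>I. t i p * cnj (t j q) * (\<Sum>\<omega>\<in>\<Omega>. u p \<omega> * cnj (u q \<omega>)))"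
      unfolding sum_distrib_left by (subst sum.swap, rule sum.cong[OF refl], rule sum.swap)
    also have "\<dots> = (\<Sum>p\<in>I. \<Sum>q\<in>I. if q = p then t i p * cnj (t j p) * N p else 0)"
      by (intro sum.cong) (auto simp: N_def orth)
    also have "\<dots> = (\<Sum>p\<in>I. t i p * N p * cnj (t j p * N p))"
      using assms(1) by (intro sum.cong) (auto dest!: N)
    finally show "(\<Sum>\<omega>\<in>\<Omega>. Y i \<omega> * cnj (Y j \<omega>)) = (\<Sum>p\<in>I. t i p * N p * cnj (t j p * N p))" .
  qed
qed

lemma sum_norm_sq_bilinear:
  fixes v :: "'i \<Rightarrow> complex" and X :: "'i \<Rightarrow> 'a \<Rightarrow> complex" and Y :: "'i \<Rightarrow> 'b \<Rightarrow> complex"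
  shows "of_real (\<Sum>a\<in>A. \<Sum>b\<in>B. (norm (\<Sum>i\<in>I. v i * X i a * Y i b))\<^sup>2) =
    (\<Sum>i\<in>I. \<Sum>j\<in>I. v i * cnj (v j) * (\<Sum>a\<in>A. X i a * cnj (X j a)) * (\<Sum>b\<in>B. Y i b * cnj (Y j b)))"
proof -
  have "of_real (\<Sum>a\<in>A. \<Sum>b\<in>B. (norm (\<Sum>i\<in>I. v i * X i a * Y i b))\<^sup>2) =
    (\<Sum>a\<in>A. \<Sum>b\<in>B. \<Sum>i\<in>I. \<Sum>j\<in>I. v i * cnj (v j) * (X i a * cnj (X j a)) * (Y i b * cnj (Y j b)))"
    unfolding of_real_sum complex_norm_square
    by (intro sum.cong refl) (simp add: sum_product mult_ac)
  also have "\<dots> = (\<Sum>a\<in>A. \<Sum>i\<in>I. \<Sum>j\<in>I. \<Sum>b\<in>B. v i * cnj (v j) * (X i a * cnj (X j a)) * (Y i b * cnj (Y j b)))"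
    by (intro sum.cong refl, subst sum.swap, intro sum.cong refl, subst sum.swap, rule refl)
  also have "\<dots> = (\<Sum>i\<in>I. \<Sum>j\<in>I. \<Sum>a\<in>A. \<Sum>b\<in>B. v i * cnj (v j) * (X i a * cnj (X j a)) * (Y i b * cnj (Y j b)))"
    by (subst sum.swap, intro sum.cong refl, subst sum.swap, rule refl)
  also have "\<dots> = (\<Sum>i\<in>I. \<Sum>j\<in>I. v i * cnj (v j) * (\<Sum>a\<in>A. X i a * cnj (X j a)) * (\<Sum>b\<in>B. Y i b * cnj (Y j b)))"
    by (intro sum.cong refl, subst sum.swap) (simp add: sum_distrib_left sum_distrib_right mult.assoc)
  finally show ?thesis .
qed

text \<open>
  The tensor \<open>A = \<Sum> v i (X i \<otimes> Y i)\<close> has rank at most \<open>card I\<close>, so its trace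
  pairing with an operator \<open>M\<close> involves \<open>M\<close> only on a space of that dimension. There the squared
  Hilbert-Schmidt norm of \<open>M\<close> is at most \<open>card I\<close> times its squared operator norm. The
  right-hand side contains the squared norm of \<open>A\<close> in terms of the Gram matrices of \<open>X\<close> and \<open>Y\<close>,
  as in the preceding lemma.
\<close>

lemma pairing_le_card:
  fixes X Y :: "'i \<Rightarrow> 'w \<Rightarrow> complex" and M :: "'w \<Rightarrow> 'w \<Rightarrow> complex" and c :: real
  assumes fin: "finite I" "finite \<Omega>" and c: "c \<ge> 0"
    and op: "\<And>y. (\<Sum>\<omega>\<in>\<Omega>. (norm (\<Sum>\<omega>'\<in>\<Omega>. M \<omega> \<omega>' * y \<omega>'))\<^sup>2) \<le> c * (\<Sum>\<omega>\<in>\<Omega>. (norm (y \<omega>))\<^sup>2)"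
  shows "(norm (\<Sum>i\<in>I. v i * (\<Sum>\<omega>\<in>\<Omega>. X i \<omega> * (\<Sum>\<omega>'\<in>\<Omega>. M \<omega> \<omega>' * Y i \<omega>'))))\<^sup>2 \<le>
    real (card I) * c * Re (\<Sum>i\<in>I. \<Sum>j\<in>I. v i * cnj (v j) *
      (\<Sum>\<omega>\<in>\<Omega>. X i \<omega> * cnj (X j \<omega>)) * (\<Sum>\<omega>\<in>\<Omega>. Y i \<omega> * cnj (Y j \<omega>)))"
proof -
  from gram_schmidt[OF fin, of Y] obtain t u where
    Y: "\<And>i \<omega>. i \<in> I \<Longrightarrow> \<omega> \<in> \<Omega> \<Longrightarrow> Y i \<omega> = (\<Sum>p\<in>I. t i p * u p \<omega>)" and
    gram: "\<And>i j. i \<in> I \<Longrightarrow> j \<in> I \<Longrightarrow> (\<Sum>\<omega>\<in>\<Omega>. Y i \<omega> * cnj (Y j \<omega>)) = (\<Sum>p\<in>I. t i p * cnj (t j p))" and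
    u: "\<And>p. p \<in> I \<Longrightarrow> (\<Sum>\<omega>\<in>\<Omega>. (norm (u p \<omega>))\<^sup>2) \<le> 1"
    by blast
  define W where "W p \<omega> = (\<Sum>i\<in>I. v i * X i \<omega> * t i p)" for p \<omega>
  define D where "D p \<omega> = (\<Sum>\<omega>'\<in>\<Omega>. M \<omega> \<omega>' * u p \<omega>')" for p \<omega>
  have MY: "(\<Sum>\<omega>'\<in>\<Omega>. M \<omega> \<omega>' * Y i \<omega>') = (\<Sum>p\<in>I. t i p * D p \<omega>)" if "i \<in> I" for i \<omega>
  proof -
    have "(\<Sum>\<omega>'\<in>\<Omega>. M \<omega> \<omega>' * Y i \<omega>') = (\<Sum>\<omega>'\<in>\<Omega>. \<Sum>p\<in>I. t i p * (M \<omega> \<omega>' * u p \<omega>'))"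
      by (rule sum.cong) (simp_all add: Y that sum_distrib_left mult_ac)
    then show ?thesis
      by (subst (asm) sum.swap) (simp add: D_def sum_distrib_left)
  qed
  have "(\<Sum>i\<in>I. v i * (\<Sum>\<omega>\<in>\<Omega>. X i \<omega> * (\<Sum>\<omega>'\<in>\<Omega>. M \<omega> \<omega>' * Y i \<omega>'))) =
    (\<Sum>i\<in>I. \<Sum>\<omega>\<in>\<Omega>. \<Sum>p\<in>I. v i * X i \<omega> * t i p * D p \<omega>)"
    by (rule sum.cong) (simp_all add: MY sum_distrib_left mult_ac)
  also have "\<dots> = (\<Sum>\<omega>\<in>\<Omega>. \<Sum>i\<in>I. \<Sum>p\<in>I. v i * X i \<omega> * t i p * D p \<omega>)"
    by (rule sum.swap)
  also have "\<dots> = (\<Sum>\<omega>\<in>\<Omega>. \<Sum>p\<in>I. \<Sum>i\<in>I. v i * X i \<omega> * t i p * D p \<omega>)"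
    by (rule sum.cong[OF refl], rule sum.swap)
  also have "\<dots> = (\<Sum>(\<omega>, p)\<in>\<Omega> \<times> I. W p \<omega> * D p \<omega>)"
    by (simp only: W_def sum_distrib_right sum.cartesian_product[symmetric])
  finally have eq: "(\<Sum>i\<in>I. v i * (\<Sum>\<omega>\<in>\<Omega>. X i \<omega> * (\<Sum>\<omega>'\<in>\<Omega>. M \<omega> \<omega>' * Y i \<omega>'))) = \<dots>" .
  have CS: "(norm (\<Sum>(\<omega>, p)\<in>\<Omega> \<times> I. W p \<omega> * D p \<omega>))\<^sup>2 \<le>
    (\<Sum>\<omega>\<in>\<Omega>. \<Sum>p\<in>I. (norm (W p \<omega>))\<^sup>2) * (\<Sum>\<omega>\<in>\<Omega>. \<Sum>p\<in>I. (norm (D p \<omega>))\<^sup>2)"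
    using norm_sum_mult_sq_le[of "\<lambda>(\<omega>, p). W p \<omega>" "\<lambda>(\<omega>, p). D p \<omega>" "\<Omega> \<times> I"]
    by (simp add: sum.cartesian_product case_prod_unfold)
  have D: "(\<Sum>\<omega>\<in>\<Omega>. \<Sum>p\<in>I. (norm (D p \<omega>))\<^sup>2) \<le> real (card I) * c"
  proof -
    have "(\<Sum>\<omega>\<in>\<Omega>. \<Sum>p\<in>I. (norm (D p \<omega>))\<^sup>2) = (\<Sum>p\<in>I. \<Sum>\<omega>\<in>\<Omega>. (norm (D p \<omega>))\<^sup>2)"
      by (rule sum.swap)
    also have "\<dots> \<le> (\<Sum>p\<in>I. c)"
    proof (rule sum_mono)
      fix p assume "p \<in> I"
      have "(\<Sum>\<omega>\<in>\<Omega>. (norm (D p \<omega>))\<^sup>2) \<le> c * (\<Sum>\<omega>\<in>\<Omega>. (norm (u p \<omega>))\<^sup>2)"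
        unfolding D_def by (rule op)
      also have "\<dots> \<le> c * 1" using u[OF \<open>p \<in> I\<close>] c by (rule mult_left_mono)
      finally show "(\<Sum>\<omega>\<in>\<Omega>. (norm (D p \<omega>))\<^sup>2) \<le> c" by simp
    qed
    finally show ?thesis by simp
  qed
  have W: "(\<Sum>\<omega>\<in>\<Omega>. \<Sum>p\<in>I. (norm (W p \<omega>))\<^sup>2) = Re (\<Sum>i\<in>I. \<Sum>j\<in>I. v i * cnj (v j) *
      (\<Sum>\<omega>\<in>\<Omega>. X i \<omega> * cnj (X j \<omega>)) * (\<Sum>\<omega>\<in>\<Omega>. Y i \<omega> * cnj (Y j \<omega>)))"
  proof -
    have "of_real (\<Sum>\<omega>\<in>\<Omega>. \<Sum>p\<in>I. (norm (W p \<omega>))\<^sup>2) = (\<Sum>i\<in>I. \<Sum>j\<in>I. v i * cnj (v j) *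
      (\<Sum>\<omega>\<in>\<Omega>. X i \<omega> * cnj (X j \<omega>)) * (\<Sum>p\<in>I. t i p * cnj (t j p)))"
      unfolding W_def by (rule sum_norm_sq_bilinear)
    also have "\<dots> = (\<Sum>i\<in>I. \<Sum>j\<in>I. v i * cnj (v j) *
      (\<Sum>\<omega>\<in>\<Omega>. X i \<omega> * cnj (X j \<omega>)) * (\<Sum>\<omega>\<in>\<Omega>. Y i \<omega> * cnj (Y j \<omega>)))"
      by (intro sum.cong refl) (simp add: gram)
    finally show ?thesis by (metis Re_complex_of_real)
  qed
  have "(\<Sum>\<omega>\<in>\<Omega>. \<Sum>p\<in>I. (norm (W p \<omega>))\<^sup>2) \<ge> 0"
    by (intro sum_nonneg) auto
  from order_trans[OF CS mult_left_mono[OF D this]] show ?thesis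
    unfolding eq W by (simp only: mult.commute)
qed

lemma sum_Times: "(\<Sum>\<omega>\<in>A \<times> B. g \<omega>) = (\<Sum>a\<in>A. \<Sum>b\<in>B. g (a, b))"
  by (simp add: sum.cartesian_product)

text \<open>
  The quadratic form of the Gram matrix of the Bergman kernel of the disc, up to the factor
  \<open>\<pi>\<close>.
\<close>

definition bergman_form :: "'i set \<Rightarrow> ('i \<Rightarrow> complex) \<Rightarrow> ('i \<Rightarrow> complex) \<Rightarrow> complex" where
  "bergman_form I z v = (\<Sum>i\<in>I. \<Sum>j\<in>I. v i * cnj (v j) / (1 - z i * cnj (z j))\<^sup>2)"

text \<open>
  Write \<open>k z\<close> for the matrix \<open>1 / (1 - z i cnj (z j))\<close>, and similarly \<open>k w\<close>. By assumption \<open>k w\<close>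
  is the Gram matrix of the vectors \<open>f\<close>, and \<open>k z\<close> is the Gram matrix of \<open>X = e \<otimes> f\<close> as
  well as of \<open>Y = e' \<otimes> f\<close>. The entrywise square of \<open>k z\<close> is therefore the Gram matrix of
  \<open>X \<otimes> Y\<close>, and the form \<open>h\<close> for \<open>z\<close> is the squared norm of \<open>A = \<Sum> v i (X i
  \<otimes> Y i)\<close>. Since \<open>b\<close> is the pairing of \<open>e\<close> with \<open>e'\<close>, the form \<open>S\<close> for \<open>w\<close> is the
  squared norm of the partial trace of \<open>A\<close> over the factors \<open>e\<close> and \<open>e'\<close>, which is \<open>cnj
  \<gamma>\<close>. Pairing it with \<open>\<gamma>\<close> expresses \<open>S\<close> linearly in \<open>A\<close>. The Cauchy-Schwarz
  inequality for this pairing gives \<open>S\<^sup>2 \<le> d S h\<close>, and \<open>pairing_le_card\<close> gives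
  \<open>S\<^sup>2 \<le> card I S h\<close>.
\<close>

lemma bergman_form_le:
  fixes z w v b :: "'i \<Rightarrow> complex" and e e' f :: "nat \<Rightarrow> 'i \<Rightarrow> complex"
  assumes "finite I"
    and e: "\<And>i j. i \<in> I \<Longrightarrow> j \<in> I \<Longrightarrow>
        1 - w i * cnj (w j) = (1 - z i * cnj (z j)) * (\<Sum>k<d. e k i * cnj (e k j))"
    and e': "\<And>i j. i \<in> I \<Longrightarrow> j \<in> I \<Longrightarrow>
        1 - w i * cnj (w j) = (1 - z i * cnj (z j)) * (\<Sum>k<d. e' k i * cnj (e' k j))"
    and f: "\<And>i j. i \<in> I \<Longrightarrow> j \<in> I \<Longrightarrow>
        1 = (1 - w i * cnj (w j)) * (\<Sum>m<N. f m i * cnj (f m j))"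
    and b: "\<And>i. i \<in> I \<Longrightarrow> b i = (\<Sum>k<d. e k i * e' k i)"
  shows "Re (bergman_form I w (\<lambda>i. b i * v i)) \<le> min (card I) d * Re (bergman_form I z v)"
proof -
  define v' where "v' i = b i * v i" for i
  define \<gamma> where "\<gamma> m m' = cnj (\<Sum>i\<in>I. v' i * f m i * f m' i)" for m m'
  define X where "X i = (\<lambda>(k, m). e k i * f m i)" for i
  define Y where "Y i = (\<lambda>(k, m). e' k i * f m i)" for i
  define S where "S = (\<Sum>m<N. \<Sum>m'<N. (norm (\<gamma> m m'))\<^sup>2)"
  define h where "h = Re (bergman_form I z v)"
  let ?\<Omega> = "{..<d} \<times> {..<N}"
  have Kw: "(\<Sum>m<N. f m i * cnj (f m j)) = 1 / (1 - w i * cnj (w j))"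
    and Kw0: "1 - w i * cnj (w j) \<noteq> 0"
    and Kz0: "1 - z i * cnj (z j) \<noteq> 0" if "i \<in> I" "j \<in> I" for i j
    using f[OF that] e[OF that] by (auto simp: divide_simps mult.commute)
  have gX: "(\<Sum>\<omega>\<in>?\<Omega>. X i \<omega> * cnj (X j \<omega>)) = 1 / (1 - z i * cnj (z j))" if "i \<in> I" "j \<in> I" for i j
  proof -
    have "(\<Sum>\<omega>\<in>?\<Omega>. X i \<omega> * cnj (X j \<omega>)) = (\<Sum>k<d. e k i * cnj (e k j)) * (\<Sum>m<N. f m i * cnj (f m j))"
      unfolding sum_product by (simp add: sum.cartesian_product X_def mult_ac case_prod_unfold)
    also have "\<dots> = 1 / (1 - z i * cnj (z j))"
      using e[OF that] Kw[OF that] Kw0[OF that] Kz0[OF that] by (simp add: divide_simps mult_ac)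
    finally show ?thesis .
  qed
  have gY: "(\<Sum>\<omega>\<in>?\<Omega>. Y i \<omega> * cnj (Y j \<omega>)) = 1 / (1 - z i * cnj (z j))" if "i \<in> I" "j \<in> I" for i j
  proof -
    have "(\<Sum>\<omega>\<in>?\<Omega>. Y i \<omega> * cnj (Y j \<omega>)) = (\<Sum>k<d. e' k i * cnj (e' k j)) * (\<Sum>m<N. f m i * cnj (f m j))"
      unfolding sum_product by (simp add: sum.cartesian_product Y_def mult_ac case_prod_unfold)
    also have "\<dots> = 1 / (1 - z i * cnj (z j))"
      using e'[OF that] Kw[OF that] Kw0[OF that] Kz0[OF that] by (simp add: divide_simps mult_ac)
    finally show ?thesis .
  qed
  have hXY: "(\<Sum>i\<in>I. \<Sum>j\<in>I. v i * cnj (v j) *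
      (\<Sum>\<omega>\<in>?\<Omega>. X i \<omega> * cnj (X j \<omega>)) * (\<Sum>\<omega>\<in>?\<Omega>. Y i \<omega> * cnj (Y j \<omega>))) = bergman_form I z v"
    unfolding bergman_form_def
    by (intro sum.cong refl) (simp only: gX gY, simp add: power2_eq_square)
  have h: "h = (\<Sum>\<omega>\<in>?\<Omega>. \<Sum>\<omega>'\<in>?\<Omega>. (norm (\<Sum>i\<in>I. v i * X i \<omega> * Y i \<omega>'))\<^sup>2)"
    using arg_cong[OF sum_norm_sq_bilinear[of v X Y I ?\<Omega> ?\<Omega>], of Re]
    unfolding h_def hXY by (simp only: Re_complex_of_real)
  have "complex_of_real S = bergman_form I w v'"
  proof -
    have "complex_of_real S = (\<Sum>i\<in>I. \<Sum>j\<in>I. v' i * cnj (v' j) *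
        (\<Sum>m<N. f m i * cnj (f m j)) * (\<Sum>m<N. f m i * cnj (f m j)))"
      unfolding S_def \<gamma>_def complex_mod_cnj
      using sum_norm_sq_bilinear[of v' "\<lambda>i m. f m i" "\<lambda>i m. f m i" I "{..<N}" "{..<N}"] .
    also have "\<dots> = bergman_form I w v'"
      unfolding bergman_form_def
      by (intro sum.cong refl) (simp only: Kw, simp add: power2_eq_square)
    finally show ?thesis .
  qed
  then have S: "S = Re (bergman_form I w v')"
    using Re_complex_of_real[of S] by simp
  have "S \<ge> 0" unfolding S_def by (intro sum_nonneg) auto
  have "h \<ge> 0" unfolding h by (intro sum_nonneg) auto
  have S_eq: "complex_of_real S = (\<Sum>m<N. \<Sum>m'<N. \<Sum>k<d. \<gamma> m m' * (\<Sum>i\<in>I. v i * X i (k, m) * Y i (k, m')))"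
  proof -
    have "complex_of_real S = (\<Sum>m<N. \<Sum>m'<N. \<gamma> m m' * (\<Sum>i\<in>I. v' i * f m i * f m' i))"
      unfolding S_def of_real_sum complex_norm_square by (simp add: \<gamma>_def)
    also have "\<dots> = (\<Sum>m<N. \<Sum>m'<N. \<gamma> m m' * (\<Sum>i\<in>I. \<Sum>k<d. v i * X i (k, m) * Y i (k, m')))"
      by (intro sum.cong refl arg_cong2[where f="(*)"])
         (simp_all add: v'_def b X_def Y_def sum_distrib_left sum_distrib_right mult_ac)
    also have "\<dots> = (\<Sum>m<N. \<Sum>m'<N. \<Sum>k<d. \<gamma> m m' * (\<Sum>i\<in>I. v i * X i (k, m) * Y i (k, m')))"
      unfolding sum.swap[where A=I and B="{..<d}"] by (simp only: sum_distrib_left)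
    finally show ?thesis .
  qed
  have "S\<^sup>2 \<le> d * S * h"
  proof -
    have "(norm (complex_of_real S))\<^sup>2 \<le> (\<Sum>m<N. \<Sum>m'<N. \<Sum>k<d. (norm (\<gamma> m m'))\<^sup>2) *
       (\<Sum>m<N. \<Sum>m'<N. \<Sum>k<d. (norm (\<Sum>i\<in>I. v i * X i (k, m) * Y i (k, m')))\<^sup>2)"
      unfolding S_eq
      using norm_sum_mult_sq_le[of "\<lambda>(m, m', k). \<gamma> m m'"
          "\<lambda>(m, m', k). \<Sum>i\<in>I. v i * X i (k, m) * Y i (k, m')" "{..<N} \<times> {..<N} \<times> {..<d}"]
      by (simp add: sum.cartesian_product case_prod_unfold del: sum_constant)
    then have "S\<^sup>2 \<le> (\<Sum>m<N. \<Sum>m'<N. \<Sum>k<d. (norm (\<gamma> m m'))\<^sup>2) *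
       (\<Sum>m<N. \<Sum>m'<N. \<Sum>k<d. (norm (\<Sum>i\<in>I. v i * X i (k, m) * Y i (k, m')))\<^sup>2)"
      by simp
    also have "(\<Sum>m<N. \<Sum>m'<N. \<Sum>k<d. (norm (\<gamma> m m'))\<^sup>2) = d * S"
      by (simp add: S_def sum_distrib_left)
    finally have "S\<^sup>2 \<le> d * S *
       (\<Sum>m<N. \<Sum>m'<N. \<Sum>k<d. (norm (\<Sum>i\<in>I. v i * X i (k, m) * Y i (k, m')))\<^sup>2)" .
    moreover have "(\<Sum>m<N. \<Sum>m'<N. \<Sum>k<d. (norm (\<Sum>i\<in>I. v i * X i (k, m) * Y i (k, m')))\<^sup>2) \<le> h"
    proof -
      \<comment> \<open>The partial trace uses only the entries of \<open>A\<close> with \<open>k = k'\<close>.\<close>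
      define q where "q \<omega> \<omega>' = (norm (\<Sum>i\<in>I. v i * X i \<omega> * Y i \<omega>'))\<^sup>2" for \<omega> \<omega>'
      have "(\<Sum>m<N. \<Sum>m'<N. \<Sum>k<d. q (k, m) (k, m')) \<le> (\<Sum>m<N. \<Sum>m'<N. \<Sum>k<d. \<Sum>k'<d. q (k, m) (k', m'))"
        by (intro sum_mono member_le_sum[of _ _ "\<lambda>k'. q (_, _) (k', _)"]) (auto simp: q_def)
      also have "\<dots> = (\<Sum>k<d. \<Sum>m<N. \<Sum>k'<d. \<Sum>m'<N. q (k, m) (k', m'))"
        by (simp only: sum.swap[where A="{..<N}" and B="{..<d}"])
      also have "\<dots> = h"
        unfolding h q_def[symmetric] sum_Times ..
      finally show ?thesis unfolding q_def .
    qed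
    ultimately show ?thesis
      using \<open>S \<ge> 0\<close> by (meson mult_left_mono mult_nonneg_nonneg of_nat_0_le_iff order_trans)
  qed
  moreover have "S\<^sup>2 \<le> card I * S * h"
  proof -
    \<comment> \<open>The operator \<open>1 \<otimes> \<gamma>\<close>, whose operator norm is at most the Hilbert-Schmidt norm of \<open>\<gamma>\<close>.\<close>
    define M :: "nat \<times> nat \<Rightarrow> nat \<times> nat \<Rightarrow> complex" where "M = (\<lambda>(k, m) (k', m'). if k = k' then \<gamma> m m' else 0)"
    have M: "(\<Sum>\<omega>'\<in>?\<Omega>. M (k, m) \<omega>' * y \<omega>') = (\<Sum>m'<N. \<gamma> m m' * y (k, m'))" if "k < d" for k m y
    proof -
      have "(\<Sum>\<omega>'\<in>?\<Omega>. M (k, m) \<omega>' * y \<omega>') = (\<Sum>k'<d. \<Sum>m'<N. if k' = k then \<gamma> m m' * y (k, m') else 0)"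
        unfolding sum_Times by (intro sum.cong refl) (simp add: M_def)
      also have "\<dots> = (\<Sum>m'<N. \<gamma> m m' * y (k, m'))"
        using that by (subst sum.swap) simp
      finally show ?thesis .
    qed
    have op: "(\<Sum>\<omega>\<in>?\<Omega>. (norm (\<Sum>\<omega>'\<in>?\<Omega>. M \<omega> \<omega>' * y \<omega>'))\<^sup>2) \<le> S * (\<Sum>\<omega>\<in>?\<Omega>. (norm (y \<omega>))\<^sup>2)" for y
    proof -
      have "(\<Sum>\<omega>\<in>?\<Omega>. (norm (\<Sum>\<omega>'\<in>?\<Omega>. M \<omega> \<omega>' * y \<omega>'))\<^sup>2) =
          (\<Sum>k<d. \<Sum>m<N. (norm (\<Sum>m'<N. \<gamma> m m' * y (k, m')))\<^sup>2)"
        by (subst sum_Times, intro sum.cong refl) (simp add: M)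
      also have "\<dots> \<le> (\<Sum>k<d. \<Sum>m<N. (\<Sum>m'<N. (norm (\<gamma> m m'))\<^sup>2) * (\<Sum>m'<N. (norm (y (k, m')))\<^sup>2))"
        by (intro sum_mono norm_sum_mult_sq_le)
      also have "\<dots> = S * (\<Sum>\<omega>\<in>?\<Omega>. (norm (y \<omega>))\<^sup>2)"
        by (simp only: S_def sum_Times sum_distrib_left[symmetric] sum_distrib_right[symmetric])
      finally show ?thesis .
    qed
    have "complex_of_real S = (\<Sum>i\<in>I. v i * (\<Sum>\<omega>\<in>?\<Omega>. X i \<omega> * (\<Sum>\<omega>'\<in>?\<Omega>. M \<omega> \<omega>' * Y i \<omega>')))"
    proof -
      have "(\<Sum>\<omega>\<in>?\<Omega>. X i \<omega> * (\<Sum>\<omega>'\<in>?\<Omega>. M \<omega> \<omega>' * Y i \<omega>')) =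
          (\<Sum>k<d. \<Sum>m<N. \<Sum>m'<N. X i (k, m) * (\<gamma> m m' * Y i (k, m')))" for i
        by (subst sum_Times, intro sum.cong refl) (simp add: M sum_distrib_left)
      then have "(\<Sum>i\<in>I. v i * (\<Sum>\<omega>\<in>?\<Omega>. X i \<omega> * (\<Sum>\<omega>'\<in>?\<Omega>. M \<omega> \<omega>' * Y i \<omega>'))) =
          (\<Sum>i\<in>I. \<Sum>k<d. \<Sum>m<N. \<Sum>m'<N. \<gamma> m m' * (v i * X i (k, m) * Y i (k, m')))"
        by (simp add: sum_distrib_left mult_ac)
      also have "\<dots> = (\<Sum>m<N. \<Sum>m'<N. \<Sum>k<d. \<Sum>i\<in>I. \<gamma> m m' * (v i * X i (k, m) * Y i (k, m')))"
      proof -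
        define q where "q i k m m' = \<gamma> m m' * (v i * X i (k, m) * Y i (k, m'))" for i k m m'
        have "(\<Sum>i\<in>I. \<Sum>k<d. \<Sum>m<N. \<Sum>m'<N. q i k m m') = (\<Sum>m<N. \<Sum>m'<N. \<Sum>k<d. \<Sum>i\<in>I. q i k m m')"
          by (simp only: sum.swap[where A=I and B="{..<N}"] sum.swap[where A="{..<d}" and B="{..<N}"]
              sum.swap[where A=I and B="{..<d}"])
        then show ?thesis unfolding q_def .
      qed
      finally show ?thesis by (simp add: S_eq sum_distrib_left)
    qed
    then have "S\<^sup>2 = (norm (\<Sum>i\<in>I. v i * (\<Sum>\<omega>\<in>?\<Omega>. X i \<omega> * (\<Sum>\<omega>'\<in>?\<Omega>. M \<omega> \<omega>' * Y i \<omega>'))))\<^sup>2"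
      by (metis norm_of_real power2_abs)
    also have "\<dots> \<le> card I * S * h"
      unfolding h_def hXY[symmetric]
      by (rule pairing_le_card[OF assms(1) _ \<open>S \<ge> 0\<close> op]) simp
    finally show ?thesis .
  qed
  ultimately have "S \<le> d * h" "S \<le> card I * h"
    using \<open>S \<ge> 0\<close> \<open>h \<ge> 0\<close> by (cases "S = 0"; simp add: power2_eq_square)+
  then show ?thesis
    unfolding S h_def v'_def[abs_def] by (auto simp: min_def)
qed

section \<open>Finite Blaschke products\<close>

definition blaschke_factor :: "complex \<Rightarrow> complex \<Rightarrow> complex" where
  "blaschke_factor a z = (z - a) / (1 - cnj a * z)"

definition blaschke :: "complex \<Rightarrow> complex list \<Rightarrow> complex \<Rightarrow> complex" where
  "blaschke c as z = c * (\<Prod>a\<leftarrow>as. blaschke_factor a z)"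

lemma blaschke_Nil [simp]: "blaschke c [] z = c"
  by (simp add: blaschke_def)

lemma blaschke_Cons: "blaschke c (a # as) z = blaschke_factor a z * blaschke c as z"
  by (simp add: blaschke_def)

lemma one_minus_cnj_mult_nonzero:
  assumes "norm a < 1" "norm z \<le> 1"
  shows "1 - cnj a * z \<noteq> 0"
proof
  assume "1 - cnj a * z = 0"
  then have "norm a * norm z = 1" by (metis complex_mod_cnj eq_iff_diff_eq_0 norm_mult norm_one)
  with assms show False
    by (metis mult_left_le mult.commute norm_ge_zero not_less order.trans)
qed

lemma one_minus_mult_cnj_nonzero:
  assumes "norm z < 1" "norm w < 1"
  shows "1 - z * cnj w \<noteq> 0"
  using one_minus_cnj_mult_nonzero[of w z] assms by (simp add: mult.commute)

lemma one_minus_blaschke_factor: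
  assumes "norm a < 1" "norm z < 1" "norm w < 1"
  shows "1 - blaschke_factor a z * cnj (blaschke_factor a w) =
    (1 - z * cnj w) * ((sqrt (1 - (norm a)\<^sup>2) / (1 - cnj a * z)) * cnj (sqrt (1 - (norm a)\<^sup>2) / (1 - cnj a * w)))"
proof -
  have nz: "1 - cnj a * z \<noteq> 0" "1 - a * cnj w \<noteq> 0"
    using one_minus_cnj_mult_nonzero[of a z] one_minus_mult_cnj_nonzero[of a w] assms by auto
  have "(norm a)\<^sup>2 \<le> 1" using assms by (simp add: abs_square_le_1)
  then have "complex_of_real (sqrt (1 - (norm a)\<^sup>2)) * complex_of_real (sqrt (1 - (norm a)\<^sup>2)) =
    of_real (1 - (norm a)\<^sup>2)"
    by (simp flip: of_real_mult)
  also have "\<dots> = 1 - a * cnj a"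
    by (simp only: of_real_diff complex_norm_square of_real_1)
  finally have "(sqrt (1 - (norm a)\<^sup>2) / (1 - cnj a * z)) * cnj (sqrt (1 - (norm a)\<^sup>2) / (1 - cnj a * w)) =
    (1 - a * cnj a) / ((1 - cnj a * z) * (1 - a * cnj w))"
    by simp
  with nz show ?thesis
    by (simp add: blaschke_factor_def divide_simps) (simp add: algebra_simps)
qed

lemma has_field_derivative_blaschke_factor:
  assumes "norm a < 1" "norm z < 1"
  shows "(blaschke_factor a has_field_derivative (sqrt (1 - (norm a)\<^sup>2) / (1 - cnj a * z))\<^sup>2) (at z)"
proof -
  have nz: "1 - cnj a * z \<noteq> 0"
    using one_minus_cnj_mult_nonzero[of a z] assms by auto
  have "(norm a)\<^sup>2 \<le> 1" using assms by (simp add: abs_square_le_1)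
  then have "(complex_of_real (sqrt (1 - (norm a)\<^sup>2)))\<^sup>2 = of_real (1 - (norm a)\<^sup>2)"
    by (simp flip: of_real_power)
  also have "\<dots> = 1 - a * cnj a"
    by (simp only: of_real_diff complex_norm_square of_real_1)
  finally have *: "(complex_of_real (sqrt (1 - (norm a)\<^sup>2)))\<^sup>2 = 1 - a * cnj a" .
  have "(blaschke_factor a has_field_derivative
     ((1 - cnj a * z) - (z - a) * (- cnj a)) / ((1 - cnj a * z) * (1 - cnj a * z))) (at z)"
    unfolding blaschke_factor_def[abs_def] using nz
    by (auto intro!: derivative_eq_intros)
  then show ?thesis
    by (simp add: power_divide *) (simp add: algebra_simps power2_eq_square)
qed

text \<open>
  The quotient \<open>(1 - b(z) cnj (b(w))) / (1 - z cnj w)\<close> is the reproducing kernel of the model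
  space of the Blaschke product \<open>b\<close>, of dimension \<open>length as\<close>. The functions \<open>e\<close> and \<open>e'\<close> are its orthonormal bases of
  Takenaka and Malmquist for the zeros in both orders. When a zero \<open>a\<close> is added, the two ways of
  telescoping \<open>1 - b(z) cnj (b(w))\<close> over the factors produce these bases, and the product rule
  matches them up in the derivative.
\<close>

lemma ex_blaschke_kernel_expansion:
  assumes "norm c = 1" "\<forall>a\<in>set as. norm a < 1"
  shows "\<exists>e e'. \<forall>z. norm z < 1 \<longrightarrow>
    (blaschke c as has_field_derivative (\<Sum>k<length as. e k z * e' k z)) (at z) \<and>
    (\<forall>w. norm w < 1 \<longrightarrow>
      1 - blaschke c as z * cnj (blaschke c as w) = (1 - z * cnj w) * (\<Sum>k<length as. e k z * cnj (e k w)) \<and>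
      1 - blaschke c as z * cnj (blaschke c as w) = (1 - z * cnj w) * (\<Sum>k<length as. e' k z * cnj (e' k w)))"
  using assms(2)
proof (induction as)
  case Nil
  have "(blaschke c [] has_field_derivative 0) (at z)" for z
    by (simp add: blaschke_def[abs_def])
  moreover have "c * cnj c = 1"
    using assms(1) complex_norm_square[of c] by simp
  ultimately show ?case by simp
next
  case (Cons a as)
  let ?B = "blaschke c as" and ?b = "blaschke_factor a"
  define \<kappa> where "\<kappa> z = complex_of_real (sqrt (1 - (norm a)\<^sup>2)) / (1 - cnj a * z)" for z
  obtain e e' where "\<forall>z. norm z < 1 \<longrightarrow>
    (?B has_field_derivative (\<Sum>k<length as. e k z * e' k z)) (at z) \<and>
    (\<forall>w. norm w < 1 \<longrightarrow>
      1 - ?B z * cnj (?B w) = (1 - z * cnj w) * (\<Sum>k<length as. e k z * cnj (e k w)) \<and>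
      1 - ?B z * cnj (?B w) = (1 - z * cnj w) * (\<Sum>k<length as. e' k z * cnj (e' k w)))"
    using Cons by auto
  then have
    D: "\<And>z. norm z < 1 \<Longrightarrow> (?B has_field_derivative (\<Sum>k<length as. e k z * e' k z)) (at z)" and
    e: "\<And>z w. norm z < 1 \<Longrightarrow> norm w < 1 \<Longrightarrow>
      1 - ?B z * cnj (?B w) = (1 - z * cnj w) * (\<Sum>k<length as. e k z * cnj (e k w))" and
    e': "\<And>z w. norm z < 1 \<Longrightarrow> norm w < 1 \<Longrightarrow>
      1 - ?B z * cnj (?B w) = (1 - z * cnj w) * (\<Sum>k<length as. e' k z * cnj (e' k w))"
    by blast+
  define E where "E k z = (case k of 0 \<Rightarrow> \<kappa> z * ?B z | Suc k \<Rightarrow> e k z)" for k z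
  define E' where "E' k z = (case k of 0 \<Rightarrow> \<kappa> z | Suc k \<Rightarrow> ?b z * e' k z)" for k z
  have a: "norm a < 1" using Cons.prems by simp
  have b: "1 - ?b z * cnj (?b w) = (1 - z * cnj w) * (\<kappa> z * cnj (\<kappa> w))" if "norm z < 1" "norm w < 1" for z w
    unfolding \<kappa>_def by (rule one_minus_blaschke_factor[OF a that])
  have "(blaschke c (a # as) has_field_derivative (\<Sum>k<length (a # as). E k z * E' k z)) (at z)"
    if z: "norm z < 1" for z
  proof -
    have "((\<lambda>z. ?b z * ?B z) has_field_derivative
        (\<kappa> z)\<^sup>2 * ?B z + (\<Sum>k<length as. e k z * e' k z) * ?b z) (at z)"
      by (rule DERIV_mult[OF has_field_derivative_blaschke_factor[OF a z, folded \<kappa>_def] D[OF z]])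
    then show ?thesis
      by (simp add: blaschke_Cons[abs_def] sum.lessThan_Suc_shift E_def E'_def power2_eq_square
          sum_distrib_left sum_distrib_right mult_ac del: sum.lessThan_Suc)
  qed
  moreover have "1 - blaschke c (a # as) z * cnj (blaschke c (a # as) w) =
      (1 - z * cnj w) * (\<Sum>k<length (a # as). E k z * cnj (E k w))"
    if z: "norm z < 1" "norm w < 1" for z w
  proof -
    have "1 - blaschke c (a # as) z * cnj (blaschke c (a # as) w) =
       ?B z * cnj (?B w) * (1 - ?b z * cnj (?b w)) + (1 - ?B z * cnj (?B w))"
      by (simp add: blaschke_Cons algebra_simps)
    also have "\<dots> = (1 - z * cnj w) * (\<Sum>k<length (a # as). E k z * cnj (E k w))"
      unfolding b[OF z] e[OF z]
      by (simp add: sum.lessThan_Suc_shift E_def distrib_left mult_ac del: sum.lessThan_Suc)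
    finally show ?thesis .
  qed
  moreover have "1 - blaschke c (a # as) z * cnj (blaschke c (a # as) w) =
      (1 - z * cnj w) * (\<Sum>k<length (a # as). E' k z * cnj (E' k w))"
    if z: "norm z < 1" "norm w < 1" for z w
  proof -
    have "1 - blaschke c (a # as) z * cnj (blaschke c (a # as) w) =
       (1 - ?b z * cnj (?b w)) + ?b z * cnj (?b w) * (1 - ?B z * cnj (?B w))"
      by (simp add: blaschke_Cons algebra_simps)
    also have "\<dots> = (1 - z * cnj w) * (\<Sum>k<length (a # as). E' k z * cnj (E' k w))"
      unfolding b[OF z] e'[OF z]
      by (simp add: sum.lessThan_Suc_shift E'_def distrib_left sum_distrib_left mult_ac del: sum.lessThan_Suc)
    finally show ?thesis .
  qed
  ultimately show ?case by blast
qed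

lemma blaschke_kernel_expansionE:
  assumes "norm c = 1" "\<forall>a\<in>set as. norm a < 1"
  obtains e e' where
    "\<And>z. norm z < 1 \<Longrightarrow> (blaschke c as has_field_derivative (\<Sum>k<length as. e k z * e' k z)) (at z)"
    "\<And>z w. norm z < 1 \<Longrightarrow> norm w < 1 \<Longrightarrow>
      1 - blaschke c as z * cnj (blaschke c as w) = (1 - z * cnj w) * (\<Sum>k<length as. e k z * cnj (e k w))"
    "\<And>z w. norm z < 1 \<Longrightarrow> norm w < 1 \<Longrightarrow>
      1 - blaschke c as z * cnj (blaschke c as w) = (1 - z * cnj w) * (\<Sum>k<length as. e' k z * cnj (e' k w))"
proof -
  from ex_blaschke_kernel_expansion[OF assms] obtain e e' where *: "\<forall>z. norm z < 1 \<longrightarrow>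
    (blaschke c as has_field_derivative (\<Sum>k<length as. e k z * e' k z)) (at z) \<and>
    (\<forall>w. norm w < 1 \<longrightarrow>
      1 - blaschke c as z * cnj (blaschke c as w) = (1 - z * cnj w) * (\<Sum>k<length as. e k z * cnj (e k w)) \<and>
      1 - blaschke c as z * cnj (blaschke c as w) = (1 - z * cnj w) * (\<Sum>k<length as. e' k z * cnj (e' k w)))"
    by (elim exE)
  show ?thesis
    by (rule that[of e e']) (use * in blast)+
qed

lemma has_field_derivative_blaschke:
  assumes "norm c = 1" "\<forall>a\<in>set as. norm a < 1" "norm z < 1"
  shows "(blaschke c as has_field_derivative deriv (blaschke c as) z) (at z)"
proof (rule blaschke_kernel_expansionE[OF assms(1,2)])
  fix e e' :: "nat \<Rightarrow> complex \<Rightarrow> complex"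
  assume "\<And>z. norm z < 1 \<Longrightarrow> (blaschke c as has_field_derivative (\<Sum>k<length as. e k z * e' k z)) (at z)"
  from this[OF assms(3)] show ?thesis
    by (subst DERIV_imp_deriv)
qed

lemma holomorphic_on_blaschke:
  assumes "norm c = 1" "\<forall>a\<in>set as. norm a < 1"
  shows "blaschke c as holomorphic_on ball 0 1"
  unfolding holomorphic_on_open[OF open_ball]
  by (intro ballI exI, rule has_field_derivative_blaschke[OF assms]) simp

lemma norm_blaschke_factor_less_1:
  assumes "norm a < 1" "norm z < 1"
  shows "norm (blaschke_factor a z) < 1"
proof -
  let ?k = "(sqrt (1 - (norm a)\<^sup>2) / (1 - cnj a * z))"
  have "complex_of_real (1 - (norm (blaschke_factor a z))\<^sup>2) = of_real ((1 - (norm z)\<^sup>2) * (norm ?k)\<^sup>2)"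
    using one_minus_blaschke_factor[OF assms assms(2)]
    by (simp only: complex_norm_square of_real_diff of_real_mult of_real_1)
  then have "1 - (norm (blaschke_factor a z))\<^sup>2 = (1 - (norm z)\<^sup>2) * (norm ?k)\<^sup>2"
    by (simp only: of_real_eq_iff)
  also have "\<dots> > 0"
  proof (rule mult_pos_pos)
    show "0 < 1 - (norm z)\<^sup>2" using assms by (simp add: abs_square_less_1)
    have "sqrt (1 - (norm a)\<^sup>2) > 0" using assms by (simp add: abs_square_less_1)
    moreover have "1 - cnj a * z \<noteq> 0" using one_minus_cnj_mult_nonzero[of a z] assms by auto
    ultimately show "0 < (norm ?k)\<^sup>2" by (simp add: zero_less_power2)
  qed
  finally show ?thesis by (simp add: abs_square_less_1)
qed

lemma norm_blaschke_less_1: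
  assumes "norm c = 1" "\<forall>a\<in>set as. norm a < 1" "as \<noteq> []" "norm z < 1"
  shows "norm (blaschke c as z) < 1"
  using assms(2,3)
proof (induction as)
  case (Cons a as)
  have "norm (blaschke_factor a z) < 1" using Cons.prems assms(4) by (simp add: norm_blaschke_factor_less_1)
  moreover have "norm (blaschke c as z) \<le> 1"
    using Cons assms(1) by (cases "as = []") (auto simp: less_imp_le)
  ultimately have "norm (blaschke_factor a z) * norm (blaschke c as z) < 1"
    by (metis mult_left_le norm_ge_zero order.strict_trans1)
  then show ?case
    by (simp add: blaschke_Cons norm_mult)
qed simp

lemma norm_blaschke_factor_eq_1:
  assumes "norm a < 1" "norm z = 1"
  shows "norm (blaschke_factor a z) = 1"
proof -
  have "z * cnj z = 1" using assms(2) complex_norm_square[of z] by simp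
  then have "z - a = z * cnj (1 - cnj a * z)" by (simp add: algebra_simps)
  then have "norm (z - a) = norm (1 - cnj a * z)"
    by (metis assms(2) complex_mod_cnj mult_1 norm_mult)
  then show ?thesis
    using one_minus_cnj_mult_nonzero[of a z] assms by (simp add: blaschke_factor_def norm_divide)
qed

lemma norm_blaschke_eq_1:
  assumes "norm c = 1" "\<forall>a\<in>set as. norm a < 1" "norm z = 1"
  shows "norm (blaschke c as z) = 1"
  using assms(2)
  by (induction as) (use assms in \<open>auto simp: blaschke_Cons norm_mult norm_blaschke_factor_eq_1\<close>)

lemma continuous_on_blaschke:
  assumes "\<forall>a\<in>set as. norm a < 1"
  shows "continuous_on (cball 0 1) (blaschke c as)"
  using assms
proof (induction as)
  case (Cons a as)
  then have "\<forall>z\<in>cball 0 1. 1 - cnj a * z \<noteq> 0"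
    using one_minus_cnj_mult_nonzero[of a] by (metis dist_0_norm list.set_intros(1) mem_cball)
  then have "continuous_on (cball 0 1) (blaschke_factor a)"
    unfolding blaschke_factor_def[abs_def]
    by (intro continuous_intros)
  with Cons show ?case
    by (auto simp: blaschke_Cons[abs_def] intro!: continuous_intros)
qed (simp add: blaschke_def[abs_def])

text \<open>
  The set where \<open>\<bar>b\<bar> \<le> r\<close> is compact in the closed disc and misses the unit
  circle.
\<close>

lemma blaschke_proper:
  assumes "norm c = 1" "\<forall>a\<in>set as. norm a < 1" "r < 1"
  obtains s where "s < 1" "\<And>z. norm z < 1 \<Longrightarrow> norm (blaschke c as z) \<le> r \<Longrightarrow> norm z \<le> s"
proof (cases "\<exists>z\<in>cball 0 1. norm (blaschke c as z) \<le> r")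
  case True
  let ?K = "{z \<in> cball 0 1. norm (blaschke c as z) \<le> r}"
  have "?K = cball 0 1 \<inter> (\<lambda>z. norm (blaschke c as z)) -` {..r}" by auto
  moreover have "closed (cball 0 1 \<inter> (\<lambda>z. norm (blaschke c as z)) -` {..r})"
    by (rule continuous_closed_preimage[OF continuous_on_norm[OF continuous_on_blaschke[OF assms(2)]]]) auto
  ultimately have "closed ?K" by simp
  moreover have "bounded ?K" by (rule bounded_subset[OF bounded_cball[of 0 1]]) auto
  ultimately have "compact ?K" by (simp add: compact_eq_bounded_closed)
  moreover have "?K \<noteq> {}" using True by blast
  ultimately obtain z where z: "z \<in> ?K" "\<forall>y\<in>?K. norm y \<le> norm z"
    using continuous_attains_sup[of ?K norm] continuous_on_norm_id by blast
  have "norm z \<noteq> 1"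
    using z(1) norm_blaschke_eq_1[OF assms(1,2)] assms(3) by force
  with z show ?thesis
    by (intro that[of "norm z"]) auto
next
  case False
  then show ?thesis by (intro that[of 0]) auto
qed

text \<open>
  The vectors \<open>f\<close> required by \<open>bergman_form_le\<close> come from the kernel of a second Blaschke
  product, the one that vanishes at all points \<open>blaschke c as (z i)\<close>: at its zeros the kernel
  expansion reads \<open>1 = (1 - z cnj w) \<Sum> f cnj f\<close>.
\<close>

lemma bergman_form_blaschke_le:
  assumes c: "norm c = 1" "\<forall>a\<in>set as. norm a < 1" "as \<noteq> []"
    and I: "finite I" "\<And>i. i \<in> I \<Longrightarrow> norm (z i) < 1"
  shows "Re (bergman_form I (\<lambda>i. blaschke c as (z i)) (\<lambda>i. deriv (blaschke c as) (z i) * v i))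
    \<le> min (card I) (length as) * Re (bergman_form I z v)"
proof -
  let ?B = "blaschke c as"
  obtain e e' where
    D: "\<And>z. norm z < 1 \<Longrightarrow> (?B has_field_derivative (\<Sum>k<length as. e k z * e' k z)) (at z)" and
    e: "\<And>z w. norm z < 1 \<Longrightarrow> norm w < 1 \<Longrightarrow>
      1 - ?B z * cnj (?B w) = (1 - z * cnj w) * (\<Sum>k<length as. e k z * cnj (e k w))" and
    e': "\<And>z w. norm z < 1 \<Longrightarrow> norm w < 1 \<Longrightarrow>
      1 - ?B z * cnj (?B w) = (1 - z * cnj w) * (\<Sum>k<length as. e' k z * cnj (e' k w))"
    by (fact blaschke_kernel_expansionE[OF c(1,2)])
  obtain ws where ws: "set ws = (\<lambda>i. ?B (z i)) ` I"
    using finite_list[OF finite_imageI[OF I(1)]] by metis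
  have Bz: "norm (?B (z i)) < 1" if "i \<in> I" for i
    using norm_blaschke_less_1[OF c] I(2)[OF that] .
  then have ws1: "\<forall>w\<in>set ws. norm w < 1" by (auto simp: ws)
  obtain f where f: "\<And>z w. norm z < 1 \<Longrightarrow> norm w < 1 \<Longrightarrow>
      1 - blaschke 1 ws z * cnj (blaschke 1 ws w) = (1 - z * cnj w) * (\<Sum>k<length ws. f k z * cnj (f k w))"
  proof (rule blaschke_kernel_expansionE[OF norm_one ws1])
  qed (rule that)
  have zero: "blaschke 1 ws w = 0" if "w \<in> set ws" for w
    using that by (induction ws) (auto simp: blaschke_Cons blaschke_factor_def)
  show ?thesis
  proof (rule bergman_form_le[where e="\<lambda>k i. e k (z i)" and e'="\<lambda>k i. e' k (z i)" and f="\<lambda>k i. f k (?B (z i))" and N="length ws"])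
    fix i j assume "i \<in> I" "j \<in> I"
    then show "1 = (1 - ?B (z i) * cnj (?B (z j))) * (\<Sum>m<length ws. f m (?B (z i)) * cnj (f m (?B (z j))))"
      using f[of "?B (z i)" "?B (z j)"] zero[of "?B (z i)"] Bz by (auto simp: ws)
  qed (use I e e' DERIV_imp_deriv[OF D] in auto)
qed

section \<open>Fibres of Blaschke products\<close>

lemma poly_blaschke_numerator: "poly (\<Prod>a\<leftarrow>as. [:- a, 1:]) z = (\<Prod>a\<leftarrow>as. z - a)"
  for z :: complex
  by (induction as) (auto simp: algebra_simps)

lemma poly_blaschke_denominator: "poly (\<Prod>a\<leftarrow>as. [:1, - cnj a:]) z = (\<Prod>a\<leftarrow>as. 1 - cnj a * z)"
  by (induction as) (auto simp: algebra_simps)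

lemma blaschke_eq_quotient: "blaschke c as z = c * (\<Prod>a\<leftarrow>as. z - a) / (\<Prod>a\<leftarrow>as. 1 - cnj a * z)"
proof -
  have "(\<Prod>a\<leftarrow>as. blaschke_factor a z) = (\<Prod>a\<leftarrow>as. z - a) / (\<Prod>a\<leftarrow>as. 1 - cnj a * z)"
    by (induction as) (simp_all add: blaschke_factor_def)
  then show ?thesis by (simp add: blaschke_def)
qed

lemma blaschke_denominator_nonzero:
  assumes "\<forall>a\<in>set as. norm a < 1" "norm z < 1"
  shows "(\<Prod>a\<leftarrow>as. 1 - cnj a * z) \<noteq> 0"
  using assms(1) one_minus_cnj_mult_nonzero[of _ z] assms(2) by (induction as) auto

text \<open>
  With \<open>b = p / q\<close>, the polynomial is \<open>p - w q\<close>. Its leading coefficient is nonzero because that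
  of \<open>q\<close> has modulus at most \<open>1 = \<bar>c\<bar>\<close> while \<open>\<bar>w\<bar> < 1\<close>, and it has no root
  outside the disc, where \<open>\<bar>q\<bar> \<le> \<bar>p\<bar>\<close>. At a root in the disc its
  derivative is \<open>b' q\<close>, so noncritical preimages are simple roots.
\<close>

lemma blaschke_fibre_poly:
  assumes "norm c = 1" "\<forall>a\<in>set as. norm a < 1" "norm w < 1"
  obtains P where "degree P = length as" "\<And>z. poly P z = 0 \<longleftrightarrow> norm z < 1 \<and> blaschke c as z = w"
    "\<And>z. norm z < 1 \<Longrightarrow> blaschke c as z = w \<Longrightarrow> deriv (blaschke c as) z \<noteq> 0 \<Longrightarrow> poly (pderiv P) z \<noteq> 0"
    "P \<noteq> 0"
proof -
  define p where "p = smult c (\<Prod>a\<leftarrow>as. [:- a, 1:])"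
  define q where "q = (\<Prod>a\<leftarrow>as. [:1, - cnj a:])"
  define P where "P = p - smult w q"
  have p: "poly p z = c * (\<Prod>a\<leftarrow>as. z - a)" for z
    by (simp add: p_def poly_blaschke_numerator)
  have q: "poly q z = (\<Prod>a\<leftarrow>as. 1 - cnj a * z)" for z
    by (simp add: q_def poly_blaschke_denominator)
  have B: "blaschke c as z = poly p z / poly q z" for z
    by (simp add: p q blaschke_eq_quotient)
  have q0: "poly q z \<noteq> 0" if "norm z < 1" for z
    unfolding q by (rule blaschke_denominator_nonzero[OF assms(2) that])
  have p1: "degree p = length as" "coeff p (length as) = c"
  proof -
    have "degree (\<Prod>a\<leftarrow>as. [:- a, 1:]) = length as \<and> lead_coeff (\<Prod>a\<leftarrow>as. [:- a, 1:]) = 1"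
    proof (induction as)
      case (Cons a as)
      let ?R = "\<Prod>a\<leftarrow>as. [:- a, 1:]"
      have "?R \<noteq> 0" using Cons by auto
      then have "degree ([:- a, 1:] * ?R) = Suc (length as)"
        using Cons by (subst degree_mult_eq) auto
      moreover have "lead_coeff ([:- a, 1:] * ?R) = 1"
        by (subst lead_coeff_mult) (use Cons in auto)
      ultimately show ?case by (simp only: list.map prod_list.Cons list.size add_Suc_right add_0_right)
    qed simp
    moreover have "c \<noteq> 0" using assms(1) by auto
    ultimately show "degree p = length as" "coeff p (length as) = c"
      by (auto simp: p_def)
  qed
  have q1: "degree q \<le> length as \<and> norm (coeff q (length as)) \<le> 1"
    unfolding q_def using assms(2)
  proof (induction as)
    case (Cons a as)
    have "[:1, - cnj a:] * r = r - smult (cnj a) (pCons 0 r)" for r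
      by simp
    then have *: "(\<Prod>a\<leftarrow>a # as. [:1, - cnj a:]) = (\<Prod>a\<leftarrow>as. [:1, - cnj a:]) - smult (cnj a) (pCons 0 (\<Prod>a\<leftarrow>as. [:1, - cnj a:]))"
      by simp
    have "degree (\<Prod>a\<leftarrow>a # as. [:1, - cnj a:]) \<le> length (a # as)"
      using Cons unfolding list.map prod_list.Cons by (intro order_trans[OF degree_mult_le]) auto
    moreover have "coeff (\<Prod>a\<leftarrow>as. [:1, - cnj a:]) (Suc (length as)) = 0"
      using Cons by (intro coeff_eq_0) auto
    then have "norm (coeff (\<Prod>a\<leftarrow>a # as. [:1, - cnj a:]) (length (a # as))) =
        norm a * norm (coeff (\<Prod>a\<leftarrow>as. [:1, - cnj a:]) (length as))"
      unfolding * by (simp add: norm_mult)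
    moreover have "\<dots> \<le> 1"
      using Cons by (intro mult_le_one) auto
    ultimately show ?case by simp
  qed simp
  have "coeff P (length as) \<noteq> 0"
  proof
    assume "coeff P (length as) = 0"
    then have "c = w * coeff q (length as)" by (simp add: P_def p1)
    then have "1 = norm w * norm (coeff q (length as))" using assms(1) by (metis norm_mult)
    also have "\<dots> \<le> norm w" using q1 by (intro mult_left_le) auto
    finally show False using assms(3) by simp
  qed
  then have "degree P \<ge> length as" by (rule le_degree)
  moreover have "degree P \<le> length as"
    unfolding P_def using q1 p1 by (intro degree_diff_le) auto
  ultimately have "degree P = length as" by simp
  moreover have "P \<noteq> 0" using \<open>coeff P (length as) \<noteq> 0\<close> by auto
  moreover have root: "poly P z = 0 \<longleftrightarrow> norm z < 1 \<and> blaschke c as z = w" for z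
  proof (cases "norm z < 1")
    case True
    with q0[OF True] show ?thesis by (simp add: P_def B divide_simps)
  next
    case False
    have "norm (z - a) \<ge> norm (1 - cnj a * z)" if "a \<in> set as" for a
    proof -
      have "norm a < 1" using that assms(2) by simp
      have "complex_of_real ((norm (z - a))\<^sup>2 - (norm (1 - cnj a * z))\<^sup>2) =
         complex_of_real (((norm z)\<^sup>2 - 1) * (1 - (norm a)\<^sup>2))"
        by (simp only: of_real_diff of_real_mult complex_norm_square of_real_1) (simp add: algebra_simps)
      then have "(norm (z - a))\<^sup>2 - (norm (1 - cnj a * z))\<^sup>2 = ((norm z)\<^sup>2 - 1) * (1 - (norm a)\<^sup>2)"
        by (simp only: of_real_eq_iff)
      also have "\<dots> \<ge> 0"
        using False \<open>norm a < 1\<close> by (intro mult_nonneg_nonneg) (auto simp: abs_square_le_1)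
      finally have "(norm (1 - cnj a * z))\<^sup>2 \<le> (norm (z - a))\<^sup>2" by simp
      then show ?thesis by (rule power2_le_imp_le) simp
    qed
    then have "norm (poly q z) \<le> norm (poly p z)"
      unfolding p q using assms(1)
      by (induction as) (auto simp: norm_mult intro!: mult_mono)
    moreover have "poly p z \<noteq> 0"
      unfolding p using assms(1,2) False by (auto simp: prod_list_zero_iff)
    ultimately have "norm w * norm (poly q z) < norm (poly p z)"
      using assms(3)
      by (cases "poly q z = 0") (auto intro: order.strict_trans2[of _ "1 * norm (poly q z)"] mult_strict_right_mono)
    then have "poly P z \<noteq> 0" by (auto simp: P_def norm_mult)
    with False show ?thesis by simp
  qed
  moreover have "poly (pderiv P) z \<noteq> 0"
    if z: "norm z < 1" "blaschke c as z = w" "deriv (blaschke c as) z \<noteq> 0" for z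
  proof -
    have "((\<lambda>z. (blaschke c as z - w) * poly q z) has_field_derivative
        deriv (blaschke c as) z * poly q z) (at z)"
      using z(2) by (auto intro!: derivative_eq_intros has_field_derivative_blaschke assms z(1) poly_DERIV)
    moreover have "\<forall>\<^sub>F y in nhds z. (blaschke c as y - w) * poly q y = poly P y"
    proof -
      have "\<forall>\<^sub>F y in nhds z. y \<in> ball 0 1"
        using z by (intro eventually_nhds_in_open) auto
      then show ?thesis
        by eventually_elim (use q0 in \<open>auto simp: B P_def field_simps\<close>)
    qed
    ultimately have "(poly P has_field_derivative deriv (blaschke c as) z * poly q z) (at z)"
      by (simp add: DERIV_cong_ev[OF refl _ refl])
    then have "poly (pderiv P) z = deriv (blaschke c as) z * poly q z"
      using DERIV_unique poly_DERIV by blast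
    with z q0 show ?thesis by simp
  qed
  ultimately show ?thesis using that by blast
qed

lemma card_blaschke_fibre:
  assumes "norm c = 1" "\<forall>a\<in>set as. norm a < 1" "norm w < 1"
    and "\<And>z. norm z < 1 \<Longrightarrow> blaschke c as z = w \<Longrightarrow> deriv (blaschke c as) z \<noteq> 0"
  shows "card {z. norm z < 1 \<and> blaschke c as z = w} = length as"
    "finite {z. norm z < 1 \<and> blaschke c as z = w}"
proof -
  obtain P where P: "degree P = length as" "\<And>z. poly P z = 0 \<longleftrightarrow> norm z < 1 \<and> blaschke c as z = w"
    "\<And>z. norm z < 1 \<Longrightarrow> blaschke c as z = w \<Longrightarrow> deriv (blaschke c as) z \<noteq> 0 \<Longrightarrow> poly (pderiv P) z \<noteq> 0"
    "P \<noteq> 0"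
    by (fact blaschke_fibre_poly[OF assms(1-3)])
  have "rsquarefree P"
    unfolding rsquarefree_roots using P assms(4) by metis
  then have "count (proots P) z = 1" if "poly P z = 0" for z
    using that P(4) by (simp add: rsquarefree_root_order)
  then have "size (proots P) = card {z. poly P z = 0}"
    using P(4) by (simp add: size_multiset_overloaded_eq)
  then show "card {z. norm z < 1 \<and> blaschke c as z = w} = length as"
    using P(1,2) by (simp add: size_proots_complex)
  show "finite {z. norm z < 1 \<and> blaschke c as z = w}"
    using poly_roots_finite[OF P(4)] P(2) by simp
qed

lemma blaschke_surj:
  assumes "norm c = 1" "\<forall>a\<in>set as. norm a < 1" "norm w < 1" "as \<noteq> []"
  obtains z where "norm z < 1" "blaschke c as z = w"
proof -
  obtain P where P: "degree P = length as" "\<And>z. poly P z = 0 \<longleftrightarrow> norm z < 1 \<and> blaschke c as z = w"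
    "\<And>z. norm z < 1 \<Longrightarrow> blaschke c as z = w \<Longrightarrow> deriv (blaschke c as) z \<noteq> 0 \<Longrightarrow> poly (pderiv P) z \<noteq> 0"
    "P \<noteq> 0"
    by (fact blaschke_fibre_poly[OF assms(1-3)])
  have "\<not> constant (poly P)"
    using P(1) assms(4) by (simp add: constant_degree)
  then obtain z where "poly P z = 0"
    using fundamental_theorem_of_algebra by blast
  then show ?thesis using that P(2) by blast
qed

lemma open_imp_fsigma:
  fixes S :: "'a::euclidean_space set"
  assumes "open S"
  shows "fsigma S"
proof -
  obtain C where "\<And>n::nat. compact (C n)" "\<Union>(range C) = S"
    using open_Union_compact_subsets[OF assms] by metis
  then show ?thesis unfolding fsigma_Union_compact by (intro exI[of _ C]) auto
qed

lemma countable_holomorphic_zeros_disc: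
  assumes "f holomorphic_on ball 0 1" "norm a < 1" "f a \<noteq> 0"
  shows "countable {z. norm z < 1 \<and> f z = 0}"
proof (cases "f constant_on ball 0 1")
  case True
  with assms have "f z \<noteq> 0" if "norm z < 1" for z
    using that unfolding constant_on_def by (metis dist_0_norm mem_ball)
  then have "{z. norm z < 1 \<and> f z = 0} = {}" by auto
  then show ?thesis by (simp only: countable_empty)
next
  case False
  then have "countable {z \<in> ball 0 1. f z = 0}"
    by (intro holomorphic_countable_zeros assms) (auto intro: open_imp_fsigma)
  then show ?thesis by simp
qed

text \<open>
  The derivative does not vanish identically, because a nonconstant Blaschke product is onto.
\<close>

lemma countable_blaschke_critical_points:
  assumes "norm c = 1" "\<forall>a\<in>set as. norm a < 1" "as \<noteq> []"
  shows "countable {z. norm z < 1 \<and> deriv (blaschke c as) z = 0}"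
proof -
  let ?B = "blaschke c as"
  have hol: "deriv ?B holomorphic_on ball 0 1"
    by (intro holomorphic_deriv holomorphic_on_blaschke assms) auto
  have "\<exists>a. norm a < 1 \<and> deriv ?B a \<noteq> 0"
  proof (rule ccontr)
    assume "\<not> ?thesis"
    then have zero: "deriv ?B z = 0" if "norm z < 1" for z
      using that by blast
    have "?B constant_on ball 0 1"
      by (rule has_field_derivative_0_imp_constant_on)
         (use zero has_field_derivative_blaschke[OF assms(1,2)] in \<open>auto intro!: has_field_derivative_at_within\<close>)
    moreover obtain z where "norm z < 1" "?B z = 0"
      by (rule blaschke_surj[OF assms(1,2) _ assms(3), of 0]) auto
    moreover obtain z' where "norm z' < 1" "?B z' = 1/2"
      by (rule blaschke_surj[OF assms(1,2) _ assms(3), of "1/2"]) (auto simp: norm_divide)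
    ultimately show False by (auto simp: constant_on_def)
  qed
  then show ?thesis
    using countable_holomorphic_zeros_disc[OF hol] by blast
qed

section \<open>Proper maps of the disc\<close>

text \<open>
  The modulus of \<open>f\<close> tends to \<open>1\<close> at the unit circle; for a self-map of the disc this is properness.
  The condition also covers unimodular constants and is inherited by quotients, which properness is not.
\<close>

definition boundary_modulus_1 :: "(complex \<Rightarrow> complex) \<Rightarrow> bool" where
  "boundary_modulus_1 f \<longleftrightarrow> (\<forall>\<epsilon>>0. \<exists>s<1. \<forall>z. s < norm z \<longrightarrow> norm z < 1 \<longrightarrow> \<bar>norm (f z) - 1\<bar> < \<epsilon>)"

text \<open>
  The maximum principle on discs of radius close to \<open>1\<close>; boundary values need not exist.
\<close>

lemma norm_le_if_limsup_boundary_le: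
  assumes "f holomorphic_on ball 0 1"
    and bd: "\<And>\<epsilon>. \<epsilon> > 0 \<Longrightarrow> \<exists>s<1. \<forall>z. s < norm z \<longrightarrow> norm z < 1 \<longrightarrow> norm (f z) \<le> B + \<epsilon>"
    and "norm z < 1"
  shows "norm (f z) \<le> B"
proof (rule field_le_epsilon)
  fix \<epsilon> :: real assume "\<epsilon> > 0"
  from bd[OF this] obtain s where s: "s < 1" "\<And>z. s < norm z \<Longrightarrow> norm z < 1 \<Longrightarrow> norm (f z) \<le> B + \<epsilon>"
    by blast
  define m where "m = max (max s 0) (norm z)"
  define r where "r = (1 + m) / 2"
  have "0 \<le> m" "s \<le> m" "norm z \<le> m" "m < 1"
    using s(1) assms(3) by (auto simp: m_def)
  then have r: "s < r" "r < 1" "norm z < r" "0 < r"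
    unfolding r_def by auto
  show "norm (f z) \<le> B + \<epsilon>"
  proof (rule maximum_modulus_frontier[of f "cball 0 r"])
    show "f holomorphic_on interior (cball 0 r)"
      using r by (intro holomorphic_on_subset[OF assms(1)]) (auto simp: interior_cball)
    show "continuous_on (closure (cball 0 r)) f"
      using r by (intro continuous_on_subset[OF holomorphic_on_imp_continuous_on[OF assms(1)]]) auto
    show "norm (f w) \<le> B + \<epsilon>" if "w \<in> frontier (cball 0 r)" for w
      using s(2)[of w] r that by (simp add: frontier_cball)
  qed (use r in auto)
qed

lemma norm_le_1_if_boundary_modulus_1:
  assumes "f holomorphic_on ball 0 1" "boundary_modulus_1 f" "norm z < 1"
  shows "norm (f z) \<le> 1"
proof (rule norm_le_if_limsup_boundary_le[OF assms(1) _ assms(3)])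
  fix \<epsilon> :: real assume "\<epsilon> > 0"
  then obtain s where s: "s < 1" "\<And>z. s < norm z \<Longrightarrow> norm z < 1 \<Longrightarrow> \<bar>norm (f z) - 1\<bar> < \<epsilon>"
    using assms(2) unfolding boundary_modulus_1_def by blast
  then show "\<exists>s<1. \<forall>z. s < norm z \<longrightarrow> norm z < 1 \<longrightarrow> norm (f z) \<le> 1 + \<epsilon>"
    by (intro exI[of _ s]) (force simp: abs_less_iff)
qed

text \<open>
  The maximum principle applies to \<open>f\<close> and to \<open>1 / f\<close>.
\<close>

lemma boundary_modulus_1_nonvanishing:
  assumes hol: "f holomorphic_on ball 0 1" and bd: "boundary_modulus_1 f"
    and nz: "\<And>z. norm z < 1 \<Longrightarrow> f z \<noteq> 0"
  obtains c where "norm c = 1" "\<And>z. norm z < 1 \<Longrightarrow> f z = c"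
proof -
  have "boundary_modulus_1 (\<lambda>z. 1 / f z)"
    unfolding boundary_modulus_1_def
  proof (intro allI impI)
    fix \<epsilon> :: real assume "\<epsilon> > 0"
    then have "min (1/2) (\<epsilon>/2) > 0" by simp
    then obtain s where s: "s < 1" "\<And>z. s < norm z \<Longrightarrow> norm z < 1 \<Longrightarrow> \<bar>norm (f z) - 1\<bar> < min (1/2) (\<epsilon>/2)"
      using bd unfolding boundary_modulus_1_def by blast
    have "\<bar>norm (1 / f z) - 1\<bar> < \<epsilon>" if z: "s < norm z" "norm z < 1" for z
    proof -
      define x where "x = norm (f z)"
      have x: "\<bar>x - 1\<bar> < 1/2" "\<bar>x - 1\<bar> < \<epsilon>/2" using s(2)[OF z] by (auto simp: x_def)
      then have "x > 1/2" by linarith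
      have "\<bar>1 / x - 1\<bar> = \<bar>x - 1\<bar> / x"
        using \<open>x > 1/2\<close> by (simp add: field_simps abs_if)
      also have "\<dots> < \<epsilon>"
      proof -
        have "\<bar>x - 1\<bar> < \<epsilon> * (1/2)" using x by simp
        also have "\<dots> \<le> \<epsilon> * x" using \<open>x > 1/2\<close> \<open>\<epsilon> > 0\<close> by (intro mult_left_mono) auto
        finally show ?thesis using \<open>x > 1/2\<close> by (simp add: divide_less_eq)
      qed
      finally show ?thesis by (simp add: x_def norm_divide)
    qed
    then show "\<exists>s<1. \<forall>z. s < norm z \<longrightarrow> norm z < 1 \<longrightarrow> \<bar>norm (1 / f z) - 1\<bar> < \<epsilon>"
      using s(1) by blast
  qed
  moreover have "(\<lambda>z. 1 / f z) holomorphic_on ball 0 1"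
    using nz by (intro holomorphic_intros hol) auto
  ultimately have "norm (1 / f z) \<le> 1" if "norm z < 1" for z
    using norm_le_1_if_boundary_modulus_1 that by blast
  then have "norm (f z) \<ge> 1" if "norm z < 1" for z
    using that nz by (simp add: norm_divide divide_le_eq_1)
  moreover have "norm (f z) \<le> 1" if "norm z < 1" for z
    using norm_le_1_if_boundary_modulus_1[OF hol bd that] .
  ultimately have n1: "norm (f z) = 1" if "norm z < 1" for z
    using that by (meson order_antisym)
  have "f constant_on ball 0 1"
    by (rule maximum_modulus_principle[OF hol, where U="ball 0 1" and \<xi>=0]) (auto simp: n1)
  then obtain c where "\<And>z. norm z < 1 \<Longrightarrow> f z = c"
    by (auto simp: constant_on_def)
  moreover from this[of 0] n1[of 0] have "norm c = 1" by simp
  ultimately show ?thesis using that by blast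
qed

lemma boundary_modulus_1_blaschke_factor:
  assumes "norm a < 1"
  shows "boundary_modulus_1 (blaschke_factor a)"
  unfolding boundary_modulus_1_def
proof (intro allI impI)
  fix \<epsilon> :: real assume "\<epsilon> > 0"
  define r where "r = max 0 (1 - \<epsilon>/2)"
  have r: "r < 1" "1 - r < \<epsilon>" using \<open>\<epsilon> > 0\<close> by (auto simp: r_def)
  obtain s where s: "s < 1" "\<And>z. norm z < 1 \<Longrightarrow> norm (blaschke 1 [a] z) \<le> r \<Longrightarrow> norm z \<le> s"
    by (rule blaschke_proper[of 1 "[a]" r]) (use assms r in auto)
  have "\<bar>norm (blaschke_factor a z) - 1\<bar> < \<epsilon>" if "s < norm z" "norm z < 1" for z
    using s(2)[OF that(2)] that norm_blaschke_factor_less_1[OF assms that(2)] r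
    by (force simp: blaschke_def)
  with s(1) show "\<exists>s<1. \<forall>z. s < norm z \<longrightarrow> norm z < 1 \<longrightarrow> \<bar>norm (blaschke_factor a z) - 1\<bar> < \<epsilon>"
    by blast
qed

lemma boundary_modulus_1_divide:
  assumes f: "boundary_modulus_1 (\<lambda>z. g z * h z)" and h: "boundary_modulus_1 h"
  shows "boundary_modulus_1 g"
  unfolding boundary_modulus_1_def
proof (intro allI impI)
  fix \<epsilon> :: real assume "\<epsilon> > 0"
  define \<delta> where "\<delta> = min (1/2) (\<epsilon>/4)"
  have \<delta>: "\<delta> > 0" "\<delta> \<le> 1/2" "4 * \<delta> \<le> \<epsilon>" using \<open>\<epsilon> > 0\<close> by (auto simp: \<delta>_def)
  obtain s where s: "s < 1" "\<And>z. s < norm z \<Longrightarrow> norm z < 1 \<Longrightarrow> \<bar>norm (g z * h z) - 1\<bar> < \<delta>"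
    using f \<delta> unfolding boundary_modulus_1_def by blast
  obtain t where t: "t < 1" "\<And>z. t < norm z \<Longrightarrow> norm z < 1 \<Longrightarrow> \<bar>norm (h z) - 1\<bar> < \<delta>"
    using h \<delta> unfolding boundary_modulus_1_def by blast
  have "\<bar>norm (g z) - 1\<bar> < \<epsilon>" if z: "max s t < norm z" "norm z < 1" for z
  proof -
    define x y where "x = norm (g z)" and "y = norm (h z)"
    have xy: "\<bar>x * y - 1\<bar> < \<delta>" "\<bar>y - 1\<bar> < \<delta>"
      using s(2)[of z] t(2)[of z] z by (auto simp: x_def y_def norm_mult)
    have "y > 1/2" using xy(2) \<delta> by linarith
    have "\<bar>x - 1\<bar> * y = \<bar>(x * y - 1) - (y - 1)\<bar>"
      using \<open>y > 1/2\<close> by (simp add: left_diff_distrib abs_mult_pos)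
    also have "\<dots> < 2 * \<delta>" using xy by linarith
    also have "\<dots> \<le> \<epsilon> * (1/2)" using \<delta> by simp
    also have "\<dots> \<le> \<epsilon> * y" using \<open>y > 1/2\<close> \<open>\<epsilon> > 0\<close> by (intro mult_left_mono) auto
    finally show ?thesis
      using \<open>y > 1/2\<close> unfolding x_def[symmetric] by simp
  qed
  then show "\<exists>s<1. \<forall>z. s < norm z \<longrightarrow> norm z < 1 \<longrightarrow> \<bar>norm (g z) - 1\<bar> < \<epsilon>"
    using s(1) t(1) by (intro exI[of _ "max s t"]) auto
qed

lemma boundary_modulus_1_blaschke_factor_power:
  assumes "norm a < 1" "boundary_modulus_1 (\<lambda>z. g z * blaschke_factor a z ^ n)"
  shows "boundary_modulus_1 g"
  using assms(2)
proof (induction n)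
  case (Suc n)
  then have "boundary_modulus_1 (\<lambda>z. (g z * blaschke_factor a z ^ n) * blaschke_factor a z)"
    by (simp add: mult_ac)
  from boundary_modulus_1_divide[OF this boundary_modulus_1_blaschke_factor[OF assms(1)]]
  show ?case by (rule Suc.IH)
qed simp

text \<open>
  All zeros lie in a compact disc of radius less than \<open>1\<close>.
\<close>

lemma boundary_modulus_1_finite_zeros:
  assumes hol: "f holomorphic_on ball 0 1" and bd: "boundary_modulus_1 f"
  shows "finite {z. norm z < 1 \<and> f z = 0}"
proof -
  obtain s where s: "s < 1" "\<And>z. s < norm z \<Longrightarrow> norm z < 1 \<Longrightarrow> \<bar>norm (f z) - 1\<bar> < 1/2"
    using bd unfolding boundary_modulus_1_def by (metis half_gt_zero zero_less_one)
  have sub: "{z. norm z < 1 \<and> f z = 0} \<subseteq> {z \<in> cball 0 s. f z = 0}"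
    using s(2) by force
  show ?thesis
  proof (cases "f constant_on ball 0 1")
    case True
    then obtain c where c: "\<And>z. norm z < 1 \<Longrightarrow> f z = c" by (auto simp: constant_on_def)
    define r where "r = (1 + max s 0) / 2"
    have "s < r" "r < 1" "0 < r" using s(1) by (auto simp: r_def field_simps max_def)
    with s(2)[of "of_real r"] c[of "of_real r"] have "c \<noteq> 0" by auto
    with c have "{z. norm z < 1 \<and> f z = 0} = {}" by auto
    then show ?thesis by (simp only: finite.emptyI)
  next
    case False
    have "finite {z \<in> cball 0 s. f z = 0}"
      using s(1) by (intro holomorphic_compact_finite_zeros[OF hol]) (auto simp: False)
    with sub show ?thesis by (rule finite_subset)
  qed
qed

text \<open>
  A zero is divided out with its full multiplicity, so that the quotient has fewer zeros.
\<close>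

lemma divide_zero_blaschke_factor:
  assumes hol: "f holomorphic_on ball 0 1" and bd: "boundary_modulus_1 f"
    and a: "norm a < 1" "f a = 0"
  obtains g n where "g holomorphic_on ball 0 1" "g a \<noteq> 0"
    "\<And>z. norm z < 1 \<Longrightarrow> f z = g z * blaschke_factor a z ^ n"
proof -
  have "\<not> f constant_on ball 0 1"
  proof
    assume "f constant_on ball 0 1"
    then have "f z = 0" if "norm z < 1" for z
      using a that unfolding constant_on_def by (metis dist_0_norm mem_ball)
    then have "{z. norm z < 1 \<and> f z = 0} = ball 0 1" by auto
    with boundary_modulus_1_finite_zeros[OF hol bd] have "finite (ball (0::complex) 1)" by simp
    then show False using not_open_singleton finite_imp_not_open by (metis centre_in_ball empty_iff open_ball zero_less_one)
  qed
  obtain g r n where g: "0 < n" "0 < r" "ball a r \<subseteq> ball 0 1" "g holomorphic_on ball a r"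
    "\<And>w. w \<in> ball a r \<Longrightarrow> f w = (w - a) ^ n * g w" "\<And>w. w \<in> ball a r \<Longrightarrow> g w \<noteq> 0"
    by (rule holomorphic_factor_zero_nonconstant[OF hol _ _ _ a(2) \<open>\<not> f constant_on ball 0 1\<close>]) (use a(1) in auto)
  have nz: "1 - cnj a * z \<noteq> 0" if "norm z < 1" for z
    using one_minus_cnj_mult_nonzero[OF a(1), of z] that by simp
  \<comment> \<open>The value at \<open>a\<close> removes the singularity of the quotient.\<close>
  define h where "h z = (if z = a then g a * (1 - cnj a * a) ^ n else f z / blaschke_factor a z ^ n)" for z
  have h1: "h z = g z * (1 - cnj a * z) ^ n" if "z \<in> ball a r" for z
    using g(5)[OF that] nz[of z] that g(3) by (auto simp: h_def blaschke_factor_def power_divide)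
  have "h holomorphic_on ball a r"
    by (rule holomorphic_transform[of "\<lambda>z. g z * (1 - cnj a * z) ^ n"])
       (auto intro!: holomorphic_intros g(4) simp: h1)
  moreover have "h holomorphic_on ball 0 1 - {a}"
  proof (rule holomorphic_transform[of "\<lambda>z. f z / blaschke_factor a z ^ n"])
    show "(\<lambda>z. f z / blaschke_factor a z ^ n) holomorphic_on ball 0 1 - {a}"
      unfolding blaschke_factor_def
      using nz by (intro holomorphic_intros holomorphic_on_subset[OF hol]) auto
  qed (auto simp: h_def)
  ultimately have "h holomorphic_on ball a r \<union> (ball 0 1 - {a})"
    by (intro holomorphic_on_Un) auto
  then have "h holomorphic_on ball 0 1"
    by (rule holomorphic_on_subset) (use g(2) in auto)
  moreover have "h a \<noteq> 0"
    using h1[of a] g(2) g(6)[of a] nz[of a] a(1) by simp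
  moreover have "f z = h z * blaschke_factor a z ^ n" if "norm z < 1" for z
    using that nz[of z] a(2) g(1) by (auto simp: h_def blaschke_factor_def)
  ultimately show ?thesis using that by blast
qed

text \<open>
  Induction on the number of zeros; a function without zeros is constant.
\<close>

theorem proper_disc_map_is_blaschke:
  assumes "f holomorphic_on ball 0 1" "boundary_modulus_1 f"
  shows "\<exists>c as. norm c = 1 \<and> (\<forall>a\<in>set as. norm a < 1) \<and> (\<forall>z. norm z < 1 \<longrightarrow> f z = blaschke c as z)"
  using assms
proof (induction "card {z. norm z < 1 \<and> f z = 0}" arbitrary: f rule: less_induct)
  case less
  show ?case
  proof (cases "\<exists>a. norm a < 1 \<and> f a = 0")
    case False
    then obtain c where "norm c = 1" "\<And>z. norm z < 1 \<Longrightarrow> f z = c"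
      using boundary_modulus_1_nonvanishing[OF less.prems] by metis
    then show ?thesis by (intro exI[of _ c] exI[of _ "[]"]) auto
  next
    case True
    then obtain a where a: "norm a < 1" "f a = 0" by blast
    obtain g n where g: "g holomorphic_on ball 0 1" "g a \<noteq> 0"
      "\<And>z. norm z < 1 \<Longrightarrow> f z = g z * blaschke_factor a z ^ n"
      using divide_zero_blaschke_factor[OF less.prems a] by metis
    have bd: "boundary_modulus_1 g"
    proof (rule boundary_modulus_1_blaschke_factor_power[OF a(1)])
      show "boundary_modulus_1 (\<lambda>z. g z * blaschke_factor a z ^ n)"
        using less.prems(2) g(3) unfolding boundary_modulus_1_def by metis
    qed
    have "card {z. norm z < 1 \<and> g z = 0} < card {z. norm z < 1 \<and> f z = 0}"
    proof (rule psubset_card_mono)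
      show "finite {z. norm z < 1 \<and> f z = 0}"
        by (rule boundary_modulus_1_finite_zeros[OF less.prems])
      show "{z. norm z < 1 \<and> g z = 0} \<subset> {z. norm z < 1 \<and> f z = 0}"
        using a g(2,3) by auto
    qed
    from less.hyps[OF this g(1) bd] obtain c as where cas: "norm c = 1" "\<forall>a\<in>set as. norm a < 1"
      "\<forall>z. norm z < 1 \<longrightarrow> g z = blaschke c as z"
      by blast
    have "f z = blaschke c (replicate n a @ as) z" if "norm z < 1" for z
      using g(3)[OF that] cas(3) that by (simp add: blaschke_def map_replicate_const)
    moreover have "\<forall>b\<in>set (replicate n a @ as). norm b < 1"
      using cas(2) a(1) by auto
    ultimately show ?thesis using cas(1) by blast
  qed
qed

section \<open>Resultants\<close>

text \<open>
  The resultant of a monic polynomial \<open>p\<close> and \<open>q\<close> is the product of the values of \<open>q\<close> at the roots of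
  \<open>p\<close>. The aim is \<open>resultant_expansion\<close>: it is a polynomial in the coefficients of both. Being a
  polynomial of degree at most \<open>m\<close> in each coefficient of \<open>q\<close>, it can be interpolated from
  polynomials \<open>q\<close> with fixed coefficients, and for fixed \<open>q\<close> it is, up to a constant, the product of the
  values of \<open>p\<close> at the roots of \<open>q\<close>.
\<close>

text \<open>
  Lagrange interpolation at the nodes \<open>0, ..., m\<close>.
\<close>

lemma lagrange_basis:
  "\<exists>l :: nat \<Rightarrow> complex poly. \<forall>f. degree f \<le> m \<longrightarrow> f = (\<Sum>j\<le>m. smult (poly f (of_nat j)) (l j))"
proof -
  define g :: "nat \<Rightarrow> complex poly" where "g j = (\<Prod>i\<in>{..m} - {j}. [:- of_nat i, 1:])" for j
  define l where "l j = smult (1 / poly (g j) (of_nat j)) (g j)" for j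
  have l: "poly (l j) (of_nat i) = (if i = j then 1 else 0)" if "i \<le> m" "j \<le> m" for i j
    using that by (auto simp: l_def g_def poly_prod)
  have deg: "degree (l j) \<le> m" if "j \<le> m" for j
  proof -
    have "degree (g j) \<le> (\<Sum>i\<in>{..m} - {j}. degree [:- of_nat i :: complex, 1:])"
      using degree_prod_sum_le[of "{..m} - {j}" "\<lambda>i. [:- of_nat i :: complex, 1:]"] by (simp add: g_def o_def)
    also have "\<dots> = m" using that by (simp add: card_Diff_singleton)
    finally show ?thesis unfolding l_def by (intro order_trans[OF degree_smult_le])
  qed
  have "f = (\<Sum>j\<le>m. smult (poly f (of_nat j)) (l j))" if f: "degree f \<le> m" for f
  proof (rule poly_eqI_degree[of "of_nat ` {..m}"])
    show "poly f x = poly (\<Sum>j\<le>m. smult (poly f (of_nat j)) (l j)) x" if x: "x \<in> of_nat ` {..m}" for x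
    proof -
      obtain i where i: "x = of_nat i" "i \<le> m" using x by auto
      have "(\<Sum>j\<le>m. poly f (of_nat j) * poly (l j) (of_nat i)) = (\<Sum>j\<le>m. if j = i then poly f (of_nat i) else 0)"
        using i by (intro sum.cong) (auto simp: l)
      then show ?thesis using i by (simp add: poly_sum)
    qed
    have card: "card (of_nat ` {..m} :: complex set) = Suc m"
      by (subst card_image) (auto simp: inj_on_def)
    show "card (of_nat ` {..m} :: complex set) > degree f"
      using f card by simp
    have "degree (\<Sum>j\<le>m. smult (poly f (of_nat j)) (l j)) \<le> m"
      by (intro degree_sum_le order_trans[OF degree_smult_le] deg) auto
    then show "card (of_nat ` {..m} :: complex set) > degree (\<Sum>j\<le>m. smult (poly f (of_nat j)) (l j))"
      using card by simp
  qed
  then show ?thesis by blast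
qed

text \<open>
  Lagrange interpolation in the variables \<open>K\<close>, one after the other, of a function that is a
  polynomial of degree at most \<open>m\<close> in each variable separately.
\<close>

lemma multivariate_lagrange:
  fixes h :: "(nat \<Rightarrow> complex) \<Rightarrow> complex" and l :: "nat \<Rightarrow> complex poly"
  assumes l: "\<And>f. degree f \<le> m \<Longrightarrow> f = (\<Sum>j\<le>m. smult (poly f (of_nat j)) (l j))"
    and h: "\<And>r k. \<exists>f. degree f \<le> m \<and> (\<forall>x. h (r(k := x)) = poly f x)"
    and "finite K"
  shows "h r = (\<Sum>s\<in>K \<rightarrow>\<^sub>E {..m}. (\<Prod>k\<in>K. poly (l (s k)) (r k)) * h (\<lambda>k. if k \<in> K then of_nat (s k) else r k))"
  using \<open>finite K\<close>
proof (induction K)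
  case (insert a K)
  define t where "t s = (\<lambda>k. if k \<in> K then of_nat (s k) else r k)" for s :: "nat \<Rightarrow> nat"
  have exp: "h (t s) = (\<Sum>j\<le>m. poly (l j) (r a) * h ((t s)(a := of_nat j)))" for s
  proof -
    obtain f where f: "degree f \<le> m" "\<And>x. h ((t s)(a := x)) = poly f x" using h by metis
    have "t s a = r a" using insert.hyps by (simp add: t_def)
    then have "h (t s) = poly f (r a)" using f(2)[of "r a"] by (metis fun_upd_triv)
    also have "\<dots> = (\<Sum>j\<le>m. poly f (of_nat j) * poly (l j) (r a))"
      by (subst l[OF f(1)]) (simp add: poly_sum)
    finally show ?thesis by (simp add: f(2) mult.commute)
  qed
  have "h r = (\<Sum>s\<in>K \<rightarrow>\<^sub>E {..m}. \<Sum>j\<le>m. (\<Prod>k\<in>K. poly (l (s k)) (r k)) * (poly (l j) (r a) * h ((t s)(a := of_nat j))))"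
    unfolding insert.IH t_def[symmetric] by (subst exp) (simp add: sum_distrib_left)
  also have "\<dots> = (\<Sum>(j, s)\<in>{..m} \<times> (K \<rightarrow>\<^sub>E {..m}). (\<Prod>k\<in>K. poly (l (s k)) (r k)) * (poly (l j) (r a) * h ((t s)(a := of_nat j))))"
    by (subst sum.swap) (simp add: sum.cartesian_product)
  also have "\<dots> = (\<Sum>(j, s)\<in>{..m} \<times> (K \<rightarrow>\<^sub>E {..m}). (\<Prod>k\<in>insert a K. poly (l ((s(a := j)) k)) (r k)) *
      h (\<lambda>k. if k \<in> insert a K then of_nat ((s(a := j)) k) else r k))"
  proof (intro sum.cong refl, clarify)
    fix j s assume "s \<in> K \<rightarrow>\<^sub>E {..m}"
    have "(\<Prod>k\<in>K. poly (l ((s(a := j)) k)) (r k)) = (\<Prod>k\<in>K. poly (l (s k)) (r k))"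
      using insert.hyps by (intro prod.cong) auto
    moreover have "(\<lambda>k. if k \<in> insert a K then of_nat ((s(a := j)) k) else r k) = (t s)(a := of_nat j)"
      using insert.hyps by (auto simp: t_def)
    ultimately show "(\<Prod>k\<in>K. poly (l (s k)) (r k)) * (poly (l j) (r a) * h ((t s)(a := of_nat j))) =
      (\<Prod>k\<in>insert a K. poly (l ((s(a := j)) k)) (r k)) *
      h (\<lambda>k. if k \<in> insert a K then of_nat ((s(a := j)) k) else r k)"
      using insert.hyps by simp
  qed
  also have "\<dots> = (\<Sum>s\<in>insert a K \<rightarrow>\<^sub>E {..m}. (\<Prod>k\<in>insert a K. poly (l (s k)) (r k)) *
      h (\<lambda>k. if k \<in> insert a K then of_nat (s k) else r k))"
    unfolding PiE_insert_eq
    by (subst sum.reindex[OF inj_combinator]) (use insert.hyps in \<open>auto simp: case_prod_unfold\<close>)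
  finally show ?case .
qed simp

lemma poly_eq_prod_roots:
  fixes p :: "complex poly"
  assumes "lead_coeff p = 1"
  shows "poly p y = (\<Prod>x\<in>#proots p. y - x)"
proof -
  have "p = (\<Prod>x\<in>#proots p. [:-x, 1:])"
    using complex_poly_decompose_multiset[of p] assms by simp
  then have "poly p y = poly (\<Prod>x\<in>#proots p. [:-x, 1:]) y" by simp
  then show ?thesis by (simp add: poly_prod_mset)
qed

text \<open>
  The symmetry of the resultant in its two arguments: both sides multiply the differences of
  roots.
\<close>

lemma prod_mset_poly_roots_swap:
  fixes p R :: "complex poly"
  assumes "lead_coeff p = 1" "degree p = m"
  shows "(\<Prod>x\<in>#proots p. poly R x) = lead_coeff R ^ m * (\<Prod>y\<in>#proots R. (- 1) ^ m * poly p y)"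
proof -
  have size: "size (proots p) = m" using assms by (simp add: size_proots_complex)
  have p: "poly p y = (\<Prod>x\<in>#proots p. y - x)" for y
    using assms(1) by (rule poly_eq_prod_roots)
  have R: "poly R x = lead_coeff R * (\<Prod>y\<in>#proots R. x - y)" for x
  proof -
    have "poly R x = poly (smult (lead_coeff R) (\<Prod>y\<in>#proots R. [:-y, 1:])) x"
      by (simp only: complex_poly_decompose_multiset)
    then show ?thesis by (simp add: poly_prod_mset)
  qed
  have "(\<Prod>x\<in>#proots p. poly R x) = lead_coeff R ^ m * (\<Prod>x\<in>#proots p. \<Prod>y\<in>#proots R. x - y)"
    unfolding R by (simp add: prod_mset.distrib size)
  also have "(\<Prod>x\<in>#proots p. \<Prod>y\<in>#proots R. x - y) = (\<Prod>y\<in>#proots R. \<Prod>x\<in>#proots p. x - y)"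
    by (rule prod_mset.swap)
  also have "\<dots> = (\<Prod>y\<in>#proots R. (- 1) ^ m * poly p y)"
  proof -
    have "(\<Prod>x\<in>#A. x - y) = (- 1) ^ size A * (\<Prod>x\<in>#A. y - x)" for A and y :: complex
      by (induction A) (auto simp: algebra_simps)
    then show ?thesis unfolding p size[symmetric] by simp
  qed
  finally show ?thesis .
qed

text \<open>
  The expansion makes a resultant holomorphic, or a polynomial, in any parameters on which the
  coefficients of \<open>p\<close> and \<open>q\<close> depend in this way.
\<close>

lemma resultant_expansion:
  obtains S :: "(nat \<Rightarrow> nat) set" and l :: "nat \<Rightarrow> complex poly" and R :: "(nat \<Rightarrow> nat) \<Rightarrow> complex poly"
  where "finite S" "\<And>p q. lead_coeff p = 1 \<Longrightarrow> degree p = m \<Longrightarrow> degree q \<le> N \<Longrightarrow>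
    (\<Prod>x\<in>#proots p. poly q x) =
    (\<Sum>s\<in>S. (\<Prod>k\<le>N. poly (l (s k)) (coeff q k)) *
       (lead_coeff (R s) ^ m * (\<Prod>y\<in>#proots (R s). (- 1) ^ m * poly p y)))"
proof -
  obtain l :: "nat \<Rightarrow> complex poly" where
    l: "\<And>f. degree f \<le> m \<Longrightarrow> f = (\<Sum>j\<le>m. smult (poly f (of_nat j)) (l j))"
    using lagrange_basis by metis
  define R :: "(nat \<Rightarrow> nat) \<Rightarrow> complex poly" where "R s = (\<Sum>k\<le>N. monom (of_nat (s k)) k)" for s
  show ?thesis
  proof (rule that[of "{..N} \<rightarrow>\<^sub>E {..m}" l R])
    show "finite ({..N} \<rightarrow>\<^sub>E {..m})" by (intro finite_PiE) auto
    fix p q :: "complex poly"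
    assume p: "lead_coeff p = 1" "degree p = m" and q: "degree q \<le> N"
    define h :: "(nat \<Rightarrow> complex) \<Rightarrow> complex" where "h r = (\<Prod>x\<in>#proots p. \<Sum>k\<le>N. r k * x ^ k)" for r
    have h: "\<exists>f. degree f \<le> m \<and> (\<forall>x. h (r(k := x)) = poly f x)" for r k
    proof -
      define f where "f y = [:\<Sum>i\<in>{..N} - {k}. r i * y ^ i, if k \<le> N then y ^ k else 0:]" for y
      have "(\<Sum>i\<le>N. (r(k := x)) i * y ^ i) = poly (f y) x" for x y
      proof (cases "k \<le> N")
        case True
        then have "(\<Sum>i\<le>N. (r(k := x)) i * y ^ i) = x * y ^ k + (\<Sum>i\<in>{..N} - {k}. (r(k := x)) i * y ^ i)"
          by (subst sum.remove[of _ k]) auto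
        also have "(\<Sum>i\<in>{..N} - {k}. (r(k := x)) i * y ^ i) = (\<Sum>i\<in>{..N} - {k}. r i * y ^ i)"
          by (rule sum.cong) auto
        finally show ?thesis using True by (simp add: f_def)
      next
        case False
        then show ?thesis by (auto simp: f_def intro!: sum.cong)
      qed
      then have "h (r(k := x)) = poly (\<Prod>y\<in>#proots p. f y) x" for x
        by (simp add: h_def poly_prod_mset)
      moreover have "degree (\<Prod>y\<in>#A. f y) \<le> size A" for A
      proof (induction A)
        case (add x A)
        have "degree (f x) \<le> 1" by (simp add: f_def)
        then show ?case
          using add degree_mult_le[of "f x" "\<Prod>y\<in>#A. f y"] by simp
      qed simp
      then have "degree (\<Prod>y\<in>#proots p. f y) \<le> m"
        using p by (metis size_proots_complex)
      ultimately show ?thesis by blast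
    qed
    have "(\<Prod>x\<in>#proots p. poly q x) = h (coeff q)"
    proof -
      have "poly q x = (\<Sum>k\<le>N. coeff q k * x ^ k)" for x
        unfolding poly_altdef using q by (intro sum.mono_neutral_left) (auto simp: coeff_eq_0)
      then show ?thesis by (simp add: h_def)
    qed
    also have "\<dots> = (\<Sum>s\<in>{..N} \<rightarrow>\<^sub>E {..m}. (\<Prod>k\<le>N. poly (l (s k)) (coeff q k)) *
        h (\<lambda>k. if k \<in> {..N} then of_nat (s k) else coeff q k))"
      by (rule multivariate_lagrange[OF l h]) simp_all
    also have "\<dots> = (\<Sum>s\<in>{..N} \<rightarrow>\<^sub>E {..m}. (\<Prod>k\<le>N. poly (l (s k)) (coeff q k)) *
       (lead_coeff (R s) ^ m * (\<Prod>y\<in>#proots (R s). (- 1) ^ m * poly p y)))"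
    proof (intro sum.cong refl arg_cong2[where f="(*)"])
      fix s
      have "h (\<lambda>k. if k \<in> {..N} then of_nat (s k) else coeff q k) = (\<Prod>x\<in>#proots p. poly (R s) x)"
        by (simp add: h_def R_def poly_sum poly_monom)
      then show "h (\<lambda>k. if k \<in> {..N} then of_nat (s k) else coeff q k) =
        lead_coeff (R s) ^ m * (\<Prod>y\<in>#proots (R s). (- 1) ^ m * poly p y)"
        by (simp only: prod_mset_poly_roots_swap[OF p])
    qed
    finally show "(\<Prod>x\<in>#proots p. poly q x) = \<dots>" .
  qed
qed

section \<open>Families of polynomials with a root at the boundary\<close>

definition line_slice :: "complex^'n \<Rightarrow> complex^'n \<Rightarrow> complex set" where
  "line_slice Z V = {t. Z + t *s V \<in> polydisc}"

lemma line_slice_eq: "line_slice Z V = (\<Inter>i. (\<lambda>t. Z $ i + t * V $ i) -` ball 0 1)"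
  by (auto simp: line_slice_def polydisc_iff)

lemma open_line_slice: "open (line_slice Z (V :: complex^'n))"
  unfolding line_slice_eq
  by (intro open_INT ballI open_vimage continuous_intros) auto

lemma convex_line_slice: "convex (line_slice Z (V :: complex^'n))"
  unfolding line_slice_def
proof (rule convexI)
  fix s t :: complex and u v :: real
  assume st: "s \<in> {t. Z + t *s V \<in> polydisc}" "t \<in> {t. Z + t *s V \<in> polydisc}"
    and uv: "0 \<le> u" "0 \<le> v" "u + v = 1"
  have "Z + (u *\<^sub>R s + v *\<^sub>R t) *s V = u *\<^sub>R (Z + s *s V) + v *\<^sub>R (Z + t *s V)"
  proof -
    have "v = 1 - u" using uv(3) by simp
    then show ?thesis
      by (simp add: vec_eq_iff) (simp add: scaleR_conv_of_real algebra_simps)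
  qed
  also have "\<dots> \<in> polydisc"
    using st uv by (intro convexD[OF convex_polydisc]) auto
  finally show "u *\<^sub>R s + v *\<^sub>R t \<in> {t. Z + t *s V \<in> polydisc}" by simp
qed

lemma connected_line_slice: "connected (line_slice Z (V :: complex^'n))"
  by (rule convex_connected[OF convex_line_slice])

text \<open>
  The properties of \<open>Z \<mapsto> root_poly (F (symmetrization Z))\<close> for a proper map \<open>F\<close> that the
  classification of \<open>F\<close> uses: the roots lie in the disc, the coefficients are holomorphic along
  complex lines and symmetric in the coordinates of \<open>Z\<close>, and some root tends to the unit circle
  when some coordinate does. The degree \<open>m\<close> is a parameter, rather than the dimension, because
  roots common to the whole family will be split off.
\<close>

definition proper_root_family :: "nat \<Rightarrow> (complex^'n \<Rightarrow> complex poly) \<Rightarrow> bool" where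
  "proper_root_family m p \<longleftrightarrow>
     (\<forall>Z\<in>polydisc. degree (p Z) = m \<and> lead_coeff (p Z) = 1 \<and> (\<forall>x. poly (p Z) x = 0 \<longrightarrow> norm x < 1)) \<and>
     (\<forall>Z V k. (\<lambda>t. coeff (p (Z + t *s V)) k) holomorphic_on line_slice Z V) \<and>
     (\<forall>Z\<in>polydisc. \<forall>\<sigma>. \<sigma> permutes UNIV \<longrightarrow> p (\<chi> l. Z $ \<sigma> l) = p Z) \<and>
     (\<forall>r<1. \<exists>s<1. \<forall>Z\<in>polydisc. (\<exists>i. s < norm (Z $ i)) \<longrightarrow> (\<exists>x. poly (p Z) x = 0 \<and> r < norm x))"

lemma proper_root_familyD:
  assumes "proper_root_family m p"
  shows "Z \<in> polydisc \<Longrightarrow> degree (p Z) = m"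
    "Z \<in> polydisc \<Longrightarrow> lead_coeff (p Z) = 1"
    "Z \<in> polydisc \<Longrightarrow> poly (p Z) x = 0 \<Longrightarrow> norm x < 1"
    "(\<lambda>t. coeff (p (Z + t *s V)) k) holomorphic_on line_slice Z V"
    "Z \<in> polydisc \<Longrightarrow> \<sigma> permutes UNIV \<Longrightarrow> p (\<chi> l. Z $ \<sigma> l) = p Z"
    "r < 1 \<Longrightarrow> \<exists>s<1. \<forall>Z\<in>polydisc. (\<exists>i. s < norm (Z $ i)) \<longrightarrow> (\<exists>x. poly (p Z) x = 0 \<and> r < norm x)"
  using assms unfolding proper_root_family_def by blast+

lemma proper_root_family_nonzero:
  "proper_root_family m p \<Longrightarrow> Z \<in> polydisc \<Longrightarrow> p Z \<noteq> 0"
  using proper_root_familyD(2) by fastforce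

lemma holomorphic_on_poly_family:
  assumes "proper_root_family m p"
  shows "(\<lambda>t. poly (p (Z + t *s V)) x) holomorphic_on line_slice Z V"
proof (rule holomorphic_transform)
  show "(\<lambda>t. \<Sum>k\<le>m. coeff (p (Z + t *s V)) k * x ^ k) holomorphic_on line_slice Z V"
    by (intro holomorphic_intros proper_root_familyD(4)[OF assms])
  fix t assume "t \<in> line_slice Z V"
  then have "degree (p (Z + t *s V)) = m"
    using proper_root_familyD(1)[OF assms] by (simp add: line_slice_def)
  then show "(\<Sum>k\<le>m. coeff (p (Z + t *s V)) k * x ^ k) = poly (p (Z + t *s V)) x"
    by (simp add: poly_altdef)
qed

definition upd_coord :: "complex^'n \<Rightarrow> 'n \<Rightarrow> complex \<Rightarrow> complex^'n" where
  "upd_coord Z i a = (\<chi> j. if j = i then a else Z $ j)"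

lemma upd_coord_nth [simp]: "upd_coord Z i a $ j = (if j = i then a else Z $ j)"
  by (simp add: upd_coord_def)

lemma upd_coord_triv [simp]: "upd_coord Z i (Z $ i) = Z"
  by (simp add: vec_eq_iff)

lemma upd_coord_in_polydisc: "Z \<in> polydisc \<Longrightarrow> norm a < 1 \<Longrightarrow> upd_coord Z i a \<in> polydisc"
  by (simp add: polydisc_iff)

lemma upd_coord_line: "upd_coord Z i 0 + a *s axis i 1 = upd_coord Z i a"
  by (simp add: vec_eq_iff axis_def)

lemma line_slice_upd_coord:
  assumes "Z \<in> polydisc"
  shows "line_slice (upd_coord Z i 0) (axis i 1) = ball 0 1"
  using assms by (auto simp: line_slice_def upd_coord_line polydisc_iff)

lemma holomorphic_on_coeff_upd_coord:
  assumes "proper_root_family m p" "Z \<in> polydisc"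
  shows "(\<lambda>a. coeff (p (upd_coord Z i a)) k) holomorphic_on ball 0 1"
    "(\<lambda>a. poly (p (upd_coord Z i a)) x) holomorphic_on ball 0 1"
  using proper_root_familyD(4)[OF assms(1), of "upd_coord Z i 0" "axis i 1" k]
    holomorphic_on_poly_family[OF assms(1), of "upd_coord Z i 0" "axis i 1" x]
  unfolding line_slice_upd_coord[OF assms(2)] upd_coord_line .

text \<open>
  By Montel's theorem a subsequence converges locally uniformly. Its limit vanishes at \<open>a\<close>, so
  by Hurwitz's theorem it vanishes identically.
\<close>

lemma nonvanishing_sequence_limit:
  fixes q :: "nat \<Rightarrow> complex \<Rightarrow> complex"
  assumes L: "open L" "connected L" "a \<in> L" "b \<in> L"
    and hol: "\<And>n. q n holomorphic_on L" and nz: "\<And>n z. z \<in> L \<Longrightarrow> q n z \<noteq> 0"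
    and bound: "\<And>n z. z \<in> L \<Longrightarrow> norm (q n z) \<le> B"
    and lim: "(\<lambda>n. q n a) \<longlonglongrightarrow> 0"
  obtains r where "strict_mono (r :: nat \<Rightarrow> nat)" "(\<lambda>n. q (r n) b) \<longlonglongrightarrow> 0"
proof -
  obtain g r where g: "g holomorphic_on L" and r: "strict_mono (r :: nat \<Rightarrow> nat)"
    and pt: "\<And>x. x \<in> L \<Longrightarrow> (\<lambda>n. q (r n) x) \<longlonglongrightarrow> g x"
    and ul: "\<And>K. compact K \<Longrightarrow> K \<subseteq> L \<Longrightarrow> uniform_limit K (q \<circ> r) g sequentially"
  proof (rule Montel[OF L(1), of "range q" q])
    show "h holomorphic_on L" if "h \<in> range q" for h using that hol by auto
    show "\<exists>B. \<forall>h\<in>range q. \<forall>z\<in>K. norm (h z) \<le> B" if "compact K" "K \<subseteq> L" for K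
      using that bound by blast
  qed auto
  have "(\<lambda>n. q (r n) a) \<longlonglongrightarrow> 0"
    using LIMSEQ_subseq_LIMSEQ[OF lim r] by (simp add: o_def)
  then have "g a = 0" using pt[OF L(3)] LIMSEQ_unique by blast
  have "g constant_on L"
  proof (rule ccontr)
    assume nc: "\<not> g constant_on L"
    have "g a \<noteq> 0"
      by (rule Hurwitz_no_zeros[OF L(1,2) _ g _ nc, of "q \<circ> r"]) (use ul hol nz L in \<open>auto simp: o_def\<close>)
    with \<open>g a = 0\<close> show False by simp
  qed
  with \<open>g a = 0\<close> L have "g b = 0" by (auto simp: constant_on_def)
  with pt[OF L(4)] r show ?thesis using that by simp
qed

lemma norm_prod_mset_diff_le:
  fixes x y :: complex
  assumes "norm x \<le> 1" "norm y \<le> 1" "\<And>a. a \<in># A \<Longrightarrow> norm a \<le> 1"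
  shows "norm (\<Prod>a\<in>#A. x - a) \<le> 2 ^ size A"
    "norm ((\<Prod>a\<in>#A. x - a) - (\<Prod>a\<in>#A. y - a)) \<le> real (size A) * 2 ^ size A * norm (x - y)"
proof -
  have *: "norm (\<Prod>a\<in>#A. x - a) \<le> 2 ^ size A"
    if "norm x \<le> 1" "\<And>a. a \<in># A \<Longrightarrow> norm a \<le> 1" for x and A :: "complex multiset"
    using that(2)
  proof (induction A)
    case (add a A)
    have "norm (x - a) \<le> 2"
      using that(1) add.prems[of a] norm_triangle_ineq4[of x a] by simp
    moreover have "norm (\<Prod>a\<in>#A. x - a) \<le> 2 ^ size A" using add by simp
    ultimately have "norm (x - a) * norm (\<Prod>a\<in>#A. x - a) \<le> 2 * 2 ^ size A"
      by (intro mult_mono) auto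
    then show ?case by (simp add: norm_mult)
  qed simp
  show "norm (\<Prod>a\<in>#A. x - a) \<le> 2 ^ size A" by (rule *) (use assms in auto)
  show "norm ((\<Prod>a\<in>#A. x - a) - (\<Prod>a\<in>#A. y - a)) \<le> real (size A) * 2 ^ size A * norm (x - y)"
    using assms(3)
  proof (induction A)
    case (add a A)
    let ?P = "\<Prod>a\<in>#A. x - a" and ?Q = "\<Prod>a\<in>#A. y - a"
    have "norm (x - a) \<le> 2"
      using assms(1) add.prems[of a] norm_triangle_ineq4[of x a] by simp
    moreover have "norm (?P - ?Q) \<le> real (size A) * 2 ^ size A * norm (x - y)"
      using add by simp
    ultimately have 1: "norm (x - a) * norm (?P - ?Q) \<le> 2 * (real (size A) * 2 ^ size A * norm (x - y))"
      by (intro mult_mono) auto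
    have "norm ?Q \<le> 2 ^ size A"
      by (rule *) (use assms add in auto)
    then have 2: "norm (x - y) * norm ?Q \<le> norm (x - y) * 2 ^ size A"
      by (intro mult_left_mono) auto
    have "(x - a) * ?P - (y - a) * ?Q = (x - a) * (?P - ?Q) + (x - y) * ?Q"
      by (simp add: algebra_simps)
    then have "norm ((x - a) * ?P - (y - a) * ?Q) \<le> norm (x - a) * norm (?P - ?Q) + norm (x - y) * norm ?Q"
      by (metis norm_mult norm_triangle_ineq)
    also have "\<dots> \<le> 2 * (real (size A) * 2 ^ size A * norm (x - y)) + norm (x - y) * 2 ^ size A"
      using 1 2 by (rule add_mono)
    also have "\<dots> \<le> (real (size A) + 1) * 2 ^ (size A + 1) * norm (x - y)"
      by (simp add: algebra_simps)
    finally show ?case by (simp add: algebra_simps)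
  qed simp
qed

text \<open>
  Bounds that are uniform in the family, because all roots lie in the disc.
\<close>

lemma norm_poly_family:
  assumes "proper_root_family m p" "Z \<in> polydisc" "norm x \<le> 1" "norm y \<le> 1"
  shows "norm (poly (p Z) x) \<le> 2 ^ m"
    "norm (poly (p Z) x - poly (p Z) y) \<le> real m * 2 ^ m * norm (x - y)"
proof -
  have size: "size (proots (p Z)) = m"
    using proper_root_familyD(1)[OF assms(1,2)] by (simp add: size_proots_complex)
  have roots: "norm a \<le> 1" if "a \<in># proots (p Z)" for a
    using proper_root_familyD(3)[OF assms(1,2), of a] that proper_root_family_nonzero[OF assms(1,2)] by simp
  have e: "poly (p Z) x = (\<Prod>a\<in>#proots (p Z). x - a)" for x
    by (rule poly_eq_prod_roots[OF proper_root_familyD(2)[OF assms(1,2)]])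
  show "norm (poly (p Z) x) \<le> 2 ^ m"
    using norm_prod_mset_diff_le(1)[OF assms(3,4), of "proots (p Z)"] roots by (simp add: e size)
  show "norm (poly (p Z) x - poly (p Z) y) \<le> real m * 2 ^ m * norm (x - y)"
    using norm_prod_mset_diff_le(2)[OF assms(3,4), of "proots (p Z)"] roots by (simp add: e size)
qed

lemma holomorphic_resultant:
  assumes fam: "proper_root_family m p" and ZZ': "Z \<in> polydisc" "Z' \<in> polydisc"
  shows "(\<lambda>a. \<Prod>x\<in>#proots (p (upd_coord Z i a)). poly (p (upd_coord Z' i a)) x) holomorphic_on ball 0 1"
proof -
  obtain S :: "(nat \<Rightarrow> nat) set" and l :: "nat \<Rightarrow> complex poly" and R :: "(nat \<Rightarrow> nat) \<Rightarrow> complex poly"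
    where R: "finite S" "\<And>p q. lead_coeff p = 1 \<Longrightarrow> degree p = m \<Longrightarrow> degree q \<le> m \<Longrightarrow>
    (\<Prod>x\<in>#proots p. poly q x) =
    (\<Sum>s\<in>S. (\<Prod>k\<le>m. poly (l (s k)) (coeff q k)) *
       (lead_coeff (R s) ^ m * (\<Prod>y\<in>#proots (R s). (- 1) ^ m * poly p y)))"
    by (fact resultant_expansion)
  have hol_prod: "(\<lambda>a. \<Prod>y\<in>#A. (- 1) ^ m * poly (p (upd_coord Z i a)) y) holomorphic_on ball 0 1" for A
    by (induction A) (auto intro!: holomorphic_intros holomorphic_on_coeff_upd_coord[OF fam ZZ'(1)])
  have hol_poly: "(\<lambda>a. poly f (coeff (p (upd_coord Z' i a)) k)) holomorphic_on ball 0 1" for f k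
  proof -
    have "poly f holomorphic_on UNIV" by (auto simp: holomorphic_on_open intro: poly_DERIV)
    from holomorphic_on_compose_gen[OF holomorphic_on_coeff_upd_coord(1)[OF fam ZZ'(2)] this, of i k]
    show ?thesis by (simp add: o_def)
  qed
  show ?thesis
  proof (rule holomorphic_transform)
    show "(\<lambda>a. \<Sum>s\<in>S. (\<Prod>k\<le>m. poly (l (s k)) (coeff (p (upd_coord Z' i a)) k)) *
       (lead_coeff (R s) ^ m * (\<Prod>y\<in>#proots (R s). (- 1) ^ m * poly (p (upd_coord Z i a)) y)))
       holomorphic_on ball 0 1"
      by (intro holomorphic_intros hol_prod hol_poly)
    fix a :: complex assume "a \<in> ball 0 1"
    then have "upd_coord Z i a \<in> polydisc" "upd_coord Z' i a \<in> polydisc"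
      using ZZ' by (auto intro: upd_coord_in_polydisc)
    then show "(\<Sum>s\<in>S. (\<Prod>k\<le>m. poly (l (s k)) (coeff (p (upd_coord Z' i a)) k)) *
       (lead_coeff (R s) ^ m * (\<Prod>y\<in>#proots (R s). (- 1) ^ m * poly (p (upd_coord Z i a)) y))) =
       (\<Prod>x\<in>#proots (p (upd_coord Z i a)). poly (p (upd_coord Z' i a)) x)"
      using proper_root_familyD(1,2)[OF fam] by (intro R(2)[symmetric]) auto
  qed
qed

text \<open>
  Let the common coordinate \<open>a\<close> tend to the unit circle. Some root \<open>x\<close> of the first polynomial
  tends to the unit circle; let \<open>\<mu>\<close> be the point of the circle next to \<open>x\<close>. Along the
  segment from the first point to the second, the polynomials do not vanish at \<open>\<mu>\<close>, and
  their values at \<open>\<mu>\<close> tend to \<open>0\<close> at one end. By \<open>nonvanishing_sequence_limit\<close> they tend to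
  \<open>0\<close> at the other end, too. So the second polynomial is small at \<open>\<mu>\<close> and hence at \<open>x\<close>,
  which makes the resultant small.
\<close>

lemma resultant_tendsto_0_at_boundary:
  fixes Z Z' :: "complex^'n"
  assumes fam: "proper_root_family m p" and ZZ': "Z \<in> polydisc" "Z' \<in> polydisc" "Z $ i = Z' $ i"
    and "\<epsilon> > 0"
  shows "\<exists>s<1. \<forall>a. s < norm a \<longrightarrow> norm a < 1 \<longrightarrow>
    norm (\<Prod>x\<in>#proots (p (upd_coord Z i a)). poly (p (upd_coord Z' i a)) x) \<le> \<epsilon>"
proof (rule ccontr)
  define Y where "Y a = upd_coord Z i a" for a
  define Y' where "Y' a = upd_coord Z' i a" for a
  define \<rho> where "\<rho> a = norm (\<Prod>x\<in>#proots (p (Y a)). poly (p (Y' a)) x)" for a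
  assume "\<not> ?thesis"
  then have neg: "\<exists>a. s < norm a \<and> norm a < 1 \<and> \<rho> a > \<epsilon>" if "s < 1" for s
    using that unfolding \<rho>_def Y_def Y'_def by (meson not_le)
  have Y: "Y a \<in> polydisc" "Y' a \<in> polydisc" if "norm a < 1" for a
    using ZZ' that by (auto simp: Y_def Y'_def intro: upd_coord_in_polydisc)
  \<comment> \<open>A sequence of values of \<open>a\<close> that violate the claim, with roots \<open>x\<close> that tend to the circle.\<close>
  have "\<exists>a x. norm a < 1 \<and> \<rho> a > \<epsilon> \<and> poly (p (Y a)) x = 0 \<and> 1 - 1 / real (Suc n) < norm x" for n
  proof -
    have "1 - 1 / real (Suc n) < 1" by simp
    from proper_root_familyD(6)[OF fam this] obtain s where s: "s < 1"
      "\<And>Z i. Z \<in> polydisc \<Longrightarrow> s < norm (Z $ i) \<Longrightarrow> \<exists>x. poly (p Z) x = 0 \<and> 1 - 1 / real (Suc n) < norm x"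
      by blast
    from neg[OF s(1)] obtain a where a: "s < norm a" "norm a < 1" "\<rho> a > \<epsilon>" by blast
    then show ?thesis using s(2)[of "Y a" i] Y[of a] by (auto simp: Y_def)
  qed
  then obtain a x where a: "\<And>n. norm (a n) < 1" "\<And>n. \<rho> (a n) > \<epsilon>"
    and x: "\<And>n. poly (p (Y (a n))) (x n) = 0" "\<And>n. 1 - 1 / real (Suc n) < norm (x n)"
    by metis
  have x1: "norm (x n) < 1" for n
    using proper_root_familyD(3)[OF fam Y(1)[OF a(1)] x(1)] .
  have x0: "norm (x n) > 0" for n
  proof -
    have "1 / real (Suc n) \<le> 1" by simp
    with x(2)[of n] show ?thesis by linarith
  qed
  define \<mu> where "\<mu> n = x n / norm (x n)" for n
  have \<mu>: "norm (\<mu> n) = 1" for n using x0[of n] by (simp add: \<mu>_def norm_divide)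
  have dist: "norm (\<mu> n - x n) \<le> 1 / real (Suc n)" for n
  proof -
    have "\<mu> n - x n = \<mu> n * of_real (1 - norm (x n))"
      using x0[of n] by (simp add: \<mu>_def right_diff_distrib)
    then have "norm (\<mu> n - x n) = 1 - norm (x n)"
      using \<mu>[of n] x1[of n] by (simp add: norm_mult del: of_real_diff)
    with x(2)[of n] show ?thesis by simp
  qed
  have dist0: "(\<lambda>n. norm (\<mu> n - x n)) \<longlonglongrightarrow> 0"
    by (rule tendsto_sandwich[OF _ _ tendsto_const LIMSEQ_inverse_real_of_nat])
       (use dist in \<open>auto simp: inverse_eq_divide\<close>)
  \<comment> \<open>Both points agree in the coordinate \<open>i\<close>, so the slice \<open>L\<close> between them does not depend on \<open>a n\<close>.\<close>
  define V where "V = Z' - Z"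
  define L where "L = line_slice Z V"
  have L: "Y (a n) + t *s V \<in> polydisc" if "t \<in> L" for t n
  proof -
    have "V $ i = 0" using ZZ'(3) by (simp add: V_def)
    with that a(1)[of n] show ?thesis
      by (auto simp: L_def line_slice_def polydisc_iff Y_def)
  qed
  have YV: "Y b + 0 *s V = Y b" "Y b + V = Y' b" for b
    using ZZ'(3) by (auto simp: Y_def Y'_def V_def vec_eq_iff)
  have L01: "0 \<in> L" "1 \<in> L"
    using ZZ' by (auto simp: L_def line_slice_def V_def)
  define q where "q n t = poly (p (Y (a n) + t *s V)) (\<mu> n)" for n t
  obtain r where r: "strict_mono (r :: nat \<Rightarrow> nat)" "(\<lambda>n. q (r n) 1) \<longlonglongrightarrow> 0"
  proof (rule nonvanishing_sequence_limit[of L 0 1 q "2 ^ m"])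
    show "open L" "connected L"
      unfolding L_def by (rule open_line_slice, rule connected_line_slice)
    show "q n holomorphic_on L" for n
      unfolding q_def
      by (rule holomorphic_on_subset[OF holomorphic_on_poly_family[OF fam]])
         (use L in \<open>auto simp: line_slice_def\<close>)
    show "q n t \<noteq> 0" if "t \<in> L" for n t
      using proper_root_familyD(3)[OF fam L[OF that], of n "\<mu> n"] \<mu>[of n] by (auto simp: q_def)
    show "norm (q n t) \<le> 2 ^ m" if "t \<in> L" for n t
      unfolding q_def by (rule norm_poly_family[OF fam L[OF that], where y=0]) (use \<mu> in auto)
    have "norm (q n 0) \<le> norm (\<mu> n - x n) * (real m * 2 ^ m)" for n
      using norm_poly_family(2)[OF fam Y(1)[OF a(1)], of "\<mu> n" "x n" n] x(1)[of n] x1[of n] \<mu>[of n]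
      by (simp add: q_def YV mult.commute)
    then show "(\<lambda>n. q n 0) \<longlonglongrightarrow> 0"
      by (intro Lim_null_comparison[OF _ tendsto_mult_left_zero[OF dist0]] always_eventually allI)
  qed (use L01 in auto)
  have m: "poly (p (Y' (a n))) (x n) = q n 1 - (poly (p (Y' (a n))) (\<mu> n) - poly (p (Y' (a n))) (x n))" for n
    by (simp add: q_def YV)
  have "(\<lambda>n. norm (poly (p (Y' (a (r n)))) (x (r n)))) \<longlonglongrightarrow> 0"
  proof (rule tendsto_norm_zero, subst m, rule tendsto_diff[OF r(2), where b=0, simplified])
    have "norm (poly (p (Y' (a n))) (\<mu> n) - poly (p (Y' (a n))) (x n)) \<le> norm (\<mu> n - x n) * (real m * 2 ^ m)" for n
      using norm_poly_family(2)[OF fam Y(2)[OF a(1)], of "\<mu> n" "x n" n] x1[of n] \<mu>[of n]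
      by (simp add: mult.commute)
    then have "(\<lambda>n. poly (p (Y' (a n))) (\<mu> n) - poly (p (Y' (a n))) (x n)) \<longlonglongrightarrow> 0"
      by (intro Lim_null_comparison[OF _ tendsto_mult_left_zero[OF dist0]] always_eventually allI)
    from LIMSEQ_subseq_LIMSEQ[OF this r(1)]
    show "(\<lambda>n. poly (p (Y' (a (r n)))) (\<mu> (r n)) - poly (p (Y' (a (r n)))) (x (r n))) \<longlonglongrightarrow> 0"
      by (simp add: o_def)
  qed
  then have lim: "(\<lambda>n. norm (poly (p (Y' (a (r n)))) (x (r n))) * (2 ^ m) ^ m) \<longlonglongrightarrow> 0"
    by (rule tendsto_mult_left_zero)
  have le: "\<rho> (a n) \<le> norm (poly (p (Y' (a n))) (x n)) * (2 ^ m) ^ m" for n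
  proof -
    have nz: "p (Y (a n)) \<noteq> 0" by (rule proper_root_family_nonzero[OF fam Y(1)[OF a(1)]])
    then have "x n \<in># proots (p (Y (a n)))" using x(1)[of n] by simp
    then obtain A where A: "proots (p (Y (a n))) = add_mset (x n) A" by (metis insert_DiffM)
    have size: "size A \<le> m"
      using arg_cong[OF A, of size] proper_root_familyD(1)[OF fam Y(1)[OF a(1)], of n]
      by (simp add: size_proots_complex)
    have "norm (\<Prod>x\<in>#A. poly (p (Y' (a n))) x) \<le> (2 ^ m) ^ size A"
    proof -
      have "norm b \<le> 1" if "b \<in># A" for b
      proof -
        have "b \<in># proots (p (Y (a n)))" using that A by simp
        then show ?thesis
          using nz proper_root_familyD(3)[OF fam Y(1)[OF a(1)], of n b] by simp
      qed
      then have "norm (poly (p (Y' (a n))) b) \<le> 2 ^ m" if "b \<in># A" for b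
        using that norm_poly_family(1)[OF fam Y(2)[OF a(1)], of b 0 n] by simp
      then show ?thesis
        by (induction A) (auto simp: norm_mult intro!: mult_mono)
    qed
    also have "\<dots> \<le> (2 ^ m) ^ m" using size by (intro power_increasing) auto
    finally show ?thesis
      unfolding \<rho>_def A by (simp add: norm_mult mult_left_mono)
  qed
  have "\<epsilon> \<le> 0"
    by (rule LIMSEQ_le_const[OF lim]) (use order.trans[OF less_imp_le[OF a(2)] le] in blast)
  with \<open>\<epsilon> > 0\<close> show False by simp
qed

text \<open>
  The maximum principle for the resultant as a function of the common coordinate.
\<close>

lemma proper_root_family_share_root:
  fixes Z Z' :: "complex^'n"
  assumes fam: "proper_root_family m p" and ZZ': "Z \<in> polydisc" "Z' \<in> polydisc" "Z $ i = Z' $ i"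
  shows "\<exists>x. poly (p Z) x = 0 \<and> poly (p Z') x = 0"
proof -
  have "norm (\<Prod>x\<in>#proots (p (upd_coord Z i (Z $ i))). poly (p (upd_coord Z' i (Z $ i))) x) \<le> 0"
    by (rule norm_le_if_limsup_boundary_le[OF holomorphic_resultant[OF fam ZZ'(1,2)]])
       (use resultant_tendsto_0_at_boundary[OF fam ZZ'] ZZ' in \<open>auto simp: polydisc_iff\<close>)
  moreover have "upd_coord Z' i (Z $ i) = Z'" by (simp add: ZZ'(3))
  ultimately have "(\<Prod>x\<in>#proots (p Z). poly (p Z') x) = 0"
    by (simp only: upd_coord_triv norm_le_zero_iff)
  then obtain x where "x \<in># proots (p Z)" "poly (p Z') x = 0"
    by (auto simp: prod_mset_zero_iff)
  then show ?thesis
    using proper_root_family_nonzero[OF fam ZZ'(1)] by auto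
qed

section \<open>Roots that depend on one coordinate\<close>

lemma ex_both_nonzero:
  assumes "open L" "connected L" "f holomorphic_on L" "g holomorphic_on L"
    "a \<in> L" "f a \<noteq> 0" "b \<in> L" "g b \<noteq> 0"
  obtains t where "t \<in> L" "f t \<noteq> (0::complex)" "g t \<noteq> 0"
proof (rule ccontr)
  assume neg: "\<not> thesis"
  have "open (L \<inter> f -` (- {0}))"
    using holomorphic_on_imp_continuous_on[OF assms(3)] assms(1) continuous_on_open_vimage
    by (metis Int_commute open_Compl closed_singleton)
  have "g b = 0"
  proof (rule analytic_continuation_open[of "L \<inter> f -` (- {0})" L g "\<lambda>_. 0"])
    show "g z = 0" if "z \<in> L \<inter> f -` (- {0})" for z
      using that neg \<open>\<And>t. \<lbrakk>t \<in> L; f t \<noteq> 0; g t \<noteq> 0\<rbrakk> \<Longrightarrow> thesis\<close> by blast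
  qed (use assms \<open>open (L \<inter> f -` (- {0}))\<close> in auto)
  with assms show False by simp
qed

text \<open>
  Each condition excludes the zeros of a holomorphic function that does not vanish identically
  on the convex set of points with coordinate \<open>c\<close>.
\<close>

lemma ex_common_nonroot_on_slice:
  assumes fam: "proper_root_family m p" and "finite A" "norm c < 1"
    and nz: "\<And>x. x \<in> A \<Longrightarrow> \<exists>Y\<in>polydisc. Y $ i = c \<and> poly (p Y) x \<noteq> 0"
  shows "\<exists>Y\<in>polydisc. Y $ i = c \<and> (\<forall>x\<in>A. poly (p Y) x \<noteq> 0)"
  using \<open>finite A\<close> nz
proof (induction A)
  case empty
  show ?case
    by (rule bexI[of _ "\<chi> _. c"]) (use \<open>norm c < 1\<close> in \<open>auto simp: polydisc_iff\<close>)
next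
  case (insert x A)
  obtain Y where Y: "Y \<in> polydisc" "Y $ i = c" "\<And>x. x \<in> A \<Longrightarrow> poly (p Y) x \<noteq> 0"
    using insert by auto
  obtain Y' where Y': "Y' \<in> polydisc" "Y' $ i = c" "poly (p Y') x \<noteq> 0"
    using insert by auto
  let ?V = "Y' - Y"
  have V1: "Y + 1 *s ?V = Y'" by (simp add: vec_eq_iff)
  obtain t where t: "t \<in> line_slice Y ?V" "(\<Prod>x\<in>A. poly (p (Y + t *s ?V)) x) \<noteq> 0" "poly (p (Y + t *s ?V)) x \<noteq> 0"
  proof (rule ex_both_nonzero[where L="line_slice Y ?V" and a=0 and b=1])
    show "(\<lambda>t. \<Prod>x\<in>A. poly (p (Y + t *s ?V)) x) holomorphic_on line_slice Y ?V"
      by (intro holomorphic_intros holomorphic_on_poly_family[OF fam])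
    show "(\<lambda>t. poly (p (Y + t *s ?V)) x) holomorphic_on line_slice Y ?V"
      by (intro holomorphic_on_poly_family[OF fam])
    show "open (line_slice Y ?V)" "connected (line_slice Y ?V)"
      by (rule open_line_slice, rule connected_line_slice)
  qed (use Y Y' V1 insert.hyps in \<open>auto simp: line_slice_def\<close>)
  show ?case
  proof (rule bexI[of _ "Y + t *s ?V"])
    show "Y + t *s ?V \<in> polydisc" using t(1) by (simp add: line_slice_def)
    show "(Y + t *s ?V) $ i = c \<and> (\<forall>y\<in>insert x A. poly (p (Y + t *s ?V)) y \<noteq> 0)"
      using t(2,3) Y(2) Y'(2) insert.hyps by auto
  qed
qed

text \<open>
  The roots that occur for every point one of whose coordinates is \<open>x\<close>.
\<close>

definition common_roots :: "(complex^'n \<Rightarrow> complex poly) \<Rightarrow> complex \<Rightarrow> complex set" where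
  "common_roots p x = {\<mu>. \<forall>Z\<in>polydisc. (\<exists>i. Z $ i = x) \<longrightarrow> poly (p Z) \<mu> = 0}"

text \<open>
  Otherwise some \<open>Y\<close> with coordinate \<open>c\<close> avoids all roots belonging to one point \<open>Z\<close> with this
  coordinate, but \<open>Y\<close> and \<open>Z\<close> share a root. By symmetry the coordinate \<open>c\<close> may be moved to any
  position \<open>i\<close>.
\<close>

lemma common_roots_nonempty:
  fixes p :: "complex^'n \<Rightarrow> complex poly"
  assumes fam: "proper_root_family m p" and c: "norm c < 1"
  shows "common_roots p c \<noteq> {}"
proof
  assume empty: "common_roots p c = {}"
  fix i :: 'n
  define Z :: "complex^'n" where "Z = (\<chi> _. c)"
  have Z: "Z \<in> polydisc" "Z $ i = c" using c by (auto simp: Z_def polydisc_iff)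
  have "\<exists>Y\<in>polydisc. Y $ i = c \<and> poly (p Y) \<mu> \<noteq> 0" for \<mu>
  proof -
    have "\<mu> \<notin> common_roots p c" using empty by simp
    then obtain Y j where Y: "Y \<in> polydisc" "Y $ j = c" "poly (p Y) \<mu> \<noteq> 0"
      by (auto simp: common_roots_def)
    define \<sigma> where "\<sigma> = Transposition.transpose i j"
    have \<sigma>: "\<sigma> permutes UNIV" unfolding \<sigma>_def by (simp add: permutes_swap_id)
    have "p (\<chi> l. Y $ \<sigma> l) = p Y" by (rule proper_root_familyD(5)[OF fam Y(1) \<sigma>])
    with Y show ?thesis
      by (intro bexI[of _ "\<chi> l. Y $ \<sigma> l"]) (auto simp: \<sigma>_def polydisc_iff)
  qed
  then obtain Y where Y: "Y \<in> polydisc" "Y $ i = c" "\<forall>x\<in>{x. poly (p Z) x = 0}. poly (p Y) x \<noteq> 0"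
    using ex_common_nonroot_on_slice[OF fam poly_roots_finite[OF proper_root_family_nonzero[OF fam Z(1)]] c, of i]
    by blast
  then show False
    using proper_root_family_share_root[OF fam Z(1) Y(1), of i] Z(2) by auto
qed

lemma common_roots_subset:
  "Z \<in> polydisc \<Longrightarrow> common_roots p (Z $ i) \<subseteq> {x. poly (p Z) x = 0}"
  by (auto simp: common_roots_def)

lemma finite_common_roots:
  fixes p :: "complex^'n \<Rightarrow> complex poly"
  assumes fam: "proper_root_family m p" and c: "norm c < 1"
  shows "finite (common_roots p c)"
proof -
  let ?Z = "\<chi> _. c :: complex^'n"
  have Z: "?Z \<in> polydisc" using c by (auto simp: polydisc_iff)
  have "common_roots p c \<subseteq> {x. poly (p ?Z) x = 0}"
    using common_roots_subset[OF Z, of p undefined] by simp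
  then show ?thesis
    using poly_roots_finite[OF proper_root_family_nonzero[OF fam Z]] by (rule finite_subset)
qed

text \<open>
  The set is contained in the zero set of a holomorphic function of one variable.
\<close>

lemma countable_common_root_locus:
  assumes fam: "proper_root_family m p" and "Z \<in> polydisc" "poly (p Z) \<mu> \<noteq> 0"
  shows "countable {x. norm x < 1 \<and> \<mu> \<in> common_roots p x}"
proof -
  fix i
  have "countable {x. norm x < 1 \<and> poly (p (upd_coord Z i x)) \<mu> = 0}"
    by (rule countable_holomorphic_zeros_disc[OF holomorphic_on_coeff_upd_coord(2)[OF fam assms(2)], where a="Z $ i"])
       (use assms in \<open>auto simp: polydisc_iff\<close>)
  moreover have "{x. norm x < 1 \<and> \<mu> \<in> common_roots p x} \<subseteq> {x. norm x < 1 \<and> poly (p (upd_coord Z i x)) \<mu> = 0}"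
  proof
    fix x assume "x \<in> {x. norm x < 1 \<and> \<mu> \<in> common_roots p x}"
    then have x: "norm x < 1" "\<mu> \<in> common_roots p x" by auto
    have "upd_coord Z i x $ i = x" by simp
    with x(2) upd_coord_in_polydisc[OF assms(2) x(1), of i] have "poly (p (upd_coord Z i x)) \<mu> = 0"
      unfolding common_roots_def by blast
    with x(1) show "x \<in> {x. norm x < 1 \<and> poly (p (upd_coord Z i x)) \<mu> = 0}" by simp
  qed
  ultimately show ?thesis by (rule countable_subset[rotated])
qed

lemma open_not_common_root:
  assumes fam: "proper_root_family m p"
  shows "open {x. norm x < 1 \<and> \<mu> \<notin> common_roots p x}"
proof -
  have "\<exists>T. open T \<and> x \<in> T \<and> T \<subseteq> {x. norm x < 1 \<and> \<mu> \<notin> common_roots p x}"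
    if x: "norm x < 1" "\<mu> \<notin> common_roots p x" for x
  proof -
    from x obtain Z i where Z: "Z \<in> polydisc" "Z $ i = x" "poly (p Z) \<mu> \<noteq> 0"
      by (auto simp: common_roots_def)
    let ?f = "\<lambda>x. poly (p (upd_coord Z i x)) \<mu>"
    have "open (ball 0 1 \<inter> ?f -` (- {0}))"
      using holomorphic_on_imp_continuous_on[OF holomorphic_on_coeff_upd_coord(2)[OF fam Z(1)]]
      by (intro continuous_open_preimage) auto
    moreover have "x \<in> ball 0 1 \<inter> ?f -` (- {0})" using x Z by auto
    moreover have "ball 0 1 \<inter> ?f -` (- {0}) \<subseteq> {x. norm x < 1 \<and> \<mu> \<notin> common_roots p x}"
      using upd_coord_in_polydisc[OF Z(1), of _ i] by (force simp: common_roots_def)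
    ultimately show ?thesis by blast
  qed
  then show ?thesis by (subst open_subopen) blast
qed

text \<open>
  The coordinates are chosen one by one. The choices that share a common root with an earlier
  coordinate form a countable set.
\<close>

lemma ex_disjoint_common_roots:
  fixes p :: "complex^'n \<Rightarrow> complex poly"
  assumes fam: "proper_root_family m p" and nc: "\<And>\<mu>. \<exists>Z\<in>polydisc. poly (p Z) \<mu> \<noteq> 0"
    and c: "norm c < 1"
  obtains Z :: "complex^'n" where "Z \<in> polydisc" "Z $ i0 = c" "\<And>i j. i \<noteq> j \<Longrightarrow> common_roots p (Z $ i) \<inter> common_roots p (Z $ j) = {}"
proof -
  have "\<exists>z. z i0 = c \<and> (\<forall>i. norm (z i) < 1) \<and>
    (\<forall>i\<in>insert i0 I. \<forall>j\<in>insert i0 I. i \<noteq> j \<longrightarrow> common_roots p (z i) \<inter> common_roots p (z j) = {})" if "finite I" for I :: "'n set"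
    using that
  proof (induction I)
    case empty
    show ?case using c by (intro exI[of _ "\<lambda>_. c"]) auto
  next
    case (insert a I)
    then obtain z where z: "z i0 = c" "\<And>i. norm (z i) < 1"
      "\<And>i j. i \<in> insert i0 I \<Longrightarrow> j \<in> insert i0 I \<Longrightarrow> i \<noteq> j \<Longrightarrow> common_roots p (z i) \<inter> common_roots p (z j) = {}"
      by blast
    show ?case
    proof (cases "a = i0")
      case True
      then show ?thesis using z by (intro exI[of _ z]) auto
    next
      case False
      define bad where "bad = (\<Union>i\<in>insert i0 I. \<Union>\<mu>\<in>common_roots p (z i). {x. norm x < 1 \<and> \<mu> \<in> common_roots p x})"
      have "countable bad"
        unfolding bad_def
        using insert.hyps finite_common_roots[OF fam z(2)] nc countable_common_root_locus[OF fam]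
        by (intro countable_UN) (auto intro: countable_finite)
      moreover have "uncountable (ball (0::complex) 1)" by (rule uncountable_ball) simp
      ultimately have "ball 0 1 - bad \<noteq> {}"
        by (metis countable_empty uncountable_minus_countable)
      then obtain x where "x \<in> ball 0 1 - bad" by blast
      then have x: "norm x < 1" "x \<notin> bad" by auto
      then have dis: "common_roots p x \<inter> common_roots p (z i) = {}" if "i \<in> insert i0 I" for i
        using that unfolding bad_def by blast
      show ?thesis
      proof (rule exI[of _ "z(a := x)"], intro conjI)
        show "\<forall>i\<in>insert i0 (insert a I). \<forall>j\<in>insert i0 (insert a I). i \<noteq> j \<longrightarrow>
          common_roots p ((z(a := x)) i) \<inter> common_roots p ((z(a := x)) j) = {}"
          using dis z(3) insert.hyps False by (auto simp: Int_commute)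
      qed (use z x False in auto)
    qed
  qed
  from this[of UNIV] obtain z where "z i0 = c" "\<forall>i. norm (z i) < 1"
    "\<forall>i j. i \<noteq> j \<longrightarrow> common_roots p (z i) \<inter> common_roots p (z j) = {}"
    by auto
  then show ?thesis by (intro that[of "\<chi> i. z i"]) (auto simp: polydisc_iff)
qed

text \<open>
  Distinct coordinates contribute distinct roots.
\<close>

lemma card_disjoint_common_roots:
  fixes p :: "complex^'n \<Rightarrow> complex poly" and Z :: "complex^'n"
  assumes fam: "proper_root_family m p" and Z: "Z \<in> polydisc"
    and dis: "\<And>i j. i \<noteq> j \<Longrightarrow> common_roots p (Z $ i) \<inter> common_roots p (Z $ j) = {}"
  shows "(\<Sum>i\<in>UNIV. card (common_roots p (Z $ i))) \<le> m" "CARD('n) \<le> m"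
proof -
  have fin: "finite (common_roots p (Z $ i))" "common_roots p (Z $ i) \<noteq> {}" for i
    using Z finite_common_roots[OF fam] common_roots_nonempty[OF fam] by (auto simp: polydisc_iff)
  have nz: "p Z \<noteq> 0" by (rule proper_root_family_nonzero[OF fam Z])
  have "(\<Sum>i\<in>UNIV. card (common_roots p (Z $ i))) = card (\<Union>i\<in>UNIV. common_roots p (Z $ i))"
    using fin dis by (subst card_UN_disjoint) auto
  also have "\<dots> \<le> card {x. poly (p Z) x = 0}"
    using common_roots_subset[OF Z] by (intro card_mono poly_roots_finite nz) blast
  also have "\<dots> \<le> degree (p Z)" by (rule card_poly_roots_bound[OF nz])
  also have "\<dots> = m" by (rule proper_root_familyD(1)[OF fam Z])
  finally show le: "(\<Sum>i\<in>UNIV. card (common_roots p (Z $ i))) \<le> m" .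
  have "CARD('n) = (\<Sum>i\<in>(UNIV::'n set). 1)" by simp
  also have "\<dots> \<le> (\<Sum>i\<in>UNIV. card (common_roots p (Z $ i)))"
    using fin by (intro sum_mono) (simp add: Suc_le_eq card_gt_0_iff)
  finally show "CARD('n) \<le> m" using le by simp
qed

text \<open>
  A root common to the whole family can be split off. Holomorphy of the coefficients of the
  quotient follows from the recursion of the division by a linear factor, starting from the top
  coefficient.
\<close>

lemma proper_root_family_divide:
  fixes p :: "complex^'n \<Rightarrow> complex poly"
  assumes fam: "proper_root_family m p" and \<mu>: "\<And>Z. Z \<in> polydisc \<Longrightarrow> poly (p Z) \<mu> = 0"
  shows "proper_root_family (m - 1) (\<lambda>Z. p Z div [:- \<mu>, 1:])" "0 < m"
proof -
  define q where "q Z = p Z div [:- \<mu>, 1:]" for Z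
  have pq: "p Z = [:- \<mu>, 1:] * q Z" if "Z \<in> polydisc" for Z
    using \<mu>[OF that] by (simp add: q_def poly_eq_0_iff_dvd del: mult_pCons_left)
  have q0: "q Z \<noteq> 0" if "Z \<in> polydisc" for Z
    using pq[OF that] proper_root_family_nonzero[OF fam that] by auto
  have deg: "m = Suc (degree (q Z))" if "Z \<in> polydisc" for Z
  proof -
    have "degree ([:- \<mu>, 1:] * q Z) = degree [:- \<mu>, 1:] + degree (q Z)"
      by (rule degree_mult_eq) (use q0[OF that] in auto)
    then show ?thesis
      using proper_root_familyD(1)[OF fam that] unfolding pq[OF that, symmetric] by simp
  qed
  have "(0 :: complex^'n) \<in> polydisc" by (simp add: polydisc_iff)
  from deg[OF this] show "0 < m" by simp
  have root: "poly (p Z) x = 0 \<longleftrightarrow> x = \<mu> \<or> poly (q Z) x = 0" if "Z \<in> polydisc" for Z x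
    by (subst pq[OF that], subst poly_mult) auto
  have \<mu>1: "norm \<mu> < 1"
    using proper_root_familyD(3)[OF fam \<open>0 \<in> polydisc\<close> \<mu>] \<open>0 \<in> polydisc\<close> by blast
  have lead: "lead_coeff (q Z) = 1" if "Z \<in> polydisc" for Z
    using proper_root_familyD(2)[OF fam that] unfolding pq[OF that] lead_coeff_mult by simp
  \<comment> \<open>Induction on \<open>k\<close> runs downwards through the coefficients; the index is truncated at \<open>0\<close>.\<close>
  have hol: "(\<lambda>t. coeff (q (Z + t *s V)) (m - k)) holomorphic_on line_slice Z V" for Z V k
  proof (induction k)
    case 0
    show ?case
      by (rule holomorphic_transform[of "\<lambda>_. 0"])
         (use deg in \<open>auto simp: line_slice_def coeff_eq_0\<close>)
  next
    case (Suc k)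
    show ?case
    proof (cases "k < m")
      case True
      show ?thesis
      proof (rule holomorphic_transform)
        show "(\<lambda>t. coeff (p (Z + t *s V)) (m - k) + \<mu> * coeff (q (Z + t *s V)) (m - k)) holomorphic_on line_slice Z V"
          by (intro holomorphic_intros Suc.IH proper_root_familyD(4)[OF fam])
        fix t assume "t \<in> line_slice Z V"
        then have "Z + t *s V \<in> polydisc" by (simp add: line_slice_def)
        from pq[OF this] have "coeff (p (Z + t *s V)) (Suc (m - Suc k)) =
            coeff ([:- \<mu>, 1:] * q (Z + t *s V)) (Suc (m - Suc k))" by simp
        also have "\<dots> = coeff (q (Z + t *s V)) (m - Suc k) - \<mu> * coeff (q (Z + t *s V)) (Suc (m - Suc k))"
          by simp
        finally show "coeff (p (Z + t *s V)) (m - k) + \<mu> * coeff (q (Z + t *s V)) (m - k) =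
            coeff (q (Z + t *s V)) (m - Suc k)"
          using True by (simp add: Suc_diff_Suc)
      qed
    next
      case False
      then have "m - Suc k = m - k" by simp
      with Suc.IH show ?thesis by simp
    qed
  qed
  have "(\<lambda>t. coeff (q (Z + t *s V)) k) holomorphic_on line_slice Z V" for Z V k
  proof (cases "k \<le> m")
    case True
    then show ?thesis using hol[of Z V "m - k"] by simp
  next
    case False
    have "0 = coeff (q (Z + t *s V)) k" if "t \<in> line_slice Z V" for t
    proof -
      have "Z + t *s V \<in> polydisc" using that by (simp add: line_slice_def)
      from deg[OF this] False have "degree (q (Z + t *s V)) < k" by linarith
      then show ?thesis by (rule coeff_eq_0[symmetric])
    qed
    then show ?thesis
      by (rule holomorphic_transform[OF holomorphic_on_const])
  qed
  moreover have "\<exists>s<1. \<forall>Z\<in>polydisc. (\<exists>i. s < norm (Z $ i)) \<longrightarrow> (\<exists>x. poly (q Z) x = 0 \<and> r < norm x)" if "r < 1" for r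
  proof -
    have "max r (norm \<mu>) < 1" using that \<mu>1 by simp
    from proper_root_familyD(6)[OF fam this] obtain s where s: "s < 1"
      "\<And>Z i. Z \<in> polydisc \<Longrightarrow> s < norm (Z $ i) \<Longrightarrow> \<exists>x. poly (p Z) x = 0 \<and> max r (norm \<mu>) < norm x"
      by blast
    then show ?thesis
      using root by (intro exI[of _ s]) fastforce
  qed
  moreover have "q (\<chi> l. Z $ \<sigma> l) = q Z" if "Z \<in> polydisc" "\<sigma> permutes UNIV" for Z \<sigma>
    unfolding q_def using proper_root_familyD(5)[OF fam that] by simp
  moreover have "degree (q Z) = m - 1" if "Z \<in> polydisc" for Z
    using deg[OF that] by simp
  moreover have "norm x < 1" if "Z \<in> polydisc" "poly (q Z) x = 0" for Z x
    using root[OF that(1)] that(2) proper_root_familyD(3)[OF fam that(1)] by blast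
  ultimately have "proper_root_family (m - 1) q"
    using lead unfolding proper_root_family_def by blast
  then show "proper_root_family (m - 1) (\<lambda>Z. p Z div [:- \<mu>, 1:])"
    unfolding q_def[abs_def] .
qed

text \<open>
  Constant roots are split off until there are none; then \<open>ex_disjoint_common_roots\<close> supplies a
  point whose coordinates contribute distinct roots.
\<close>

lemma card_le_degree_proper_root_family:
  fixes p :: "complex^'n \<Rightarrow> complex poly"
  assumes "proper_root_family m p"
  shows "CARD('n) \<le> m"
  using assms
proof (induction m arbitrary: p rule: less_induct)
  case (less m)
  show ?case
  proof (cases "\<exists>\<mu>. \<forall>Z\<in>polydisc. poly (p Z) \<mu> = 0")
    case True
    then obtain \<mu> where "\<And>Z. Z \<in> polydisc \<Longrightarrow> poly (p Z) \<mu> = 0" by blast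
    from proper_root_family_divide[OF less.prems this] less.IH[of "m - 1"] show ?thesis
      by fastforce
  next
    case False
    then have nc: "\<exists>Z\<in>polydisc. poly (p Z) \<mu> \<noteq> 0" for \<mu> by blast
    obtain Z :: "complex^'n" where "Z \<in> polydisc"
      "\<And>i j. i \<noteq> j \<Longrightarrow> common_roots p (Z $ i) \<inter> common_roots p (Z $ j) = {}"
      by (rule ex_disjoint_common_roots[OF less.prems nc, of 0 undefined]) auto
    with card_disjoint_common_roots(2)[OF less.prems] show ?thesis by blast
  qed
qed

lemma proper_root_family_no_constant_root:
  fixes p :: "complex^'n \<Rightarrow> complex poly"
  assumes "proper_root_family CARD('n) p"
  shows "\<exists>Z\<in>polydisc. poly (p Z) \<mu> \<noteq> 0"
proof (rule ccontr)
  assume "\<not> ?thesis"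
  then have "\<And>Z. Z \<in> polydisc \<Longrightarrow> poly (p Z) \<mu> = 0" by blast
  from card_le_degree_proper_root_family[OF proper_root_family_divide(1)[OF assms this]]
    proper_root_family_divide(2)[OF assms this]
  show False by linarith
qed

text \<open>
  If the degree equals the dimension, each coordinate \<open>x\<close> contributes exactly one common root \<open>B
  x\<close>, and for a point with distinct values \<open>B (Z $ i)\<close> there is no room for other roots. Its
  value \<open>p Z (1)\<close> is the product of the \<open>1 - B (Z $ i)\<close>; this determines \<open>B\<close> locally, as a
  holomorphic function. The identity theorem extends the formula to all points. Finally, let one
  coordinate tend to the unit circle while the others are fixed: the root that tends to the
  circle can only be the one of the moving coordinate.
\<close>

lemma proper_root_family_structure:
  fixes p :: "complex^'n \<Rightarrow> complex poly"
  assumes fam: "proper_root_family CARD('n) p"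
  obtains B where "B holomorphic_on ball 0 1" "\<And>z. norm z < 1 \<Longrightarrow> norm (B z) < 1" "boundary_modulus_1 B"
    "\<And>Z x. Z \<in> polydisc \<Longrightarrow> poly (p Z) x = (\<Prod>i\<in>UNIV. x - B (Z $ i))"
proof -
  note nc = proper_root_family_no_constant_root[OF fam]
  define B where "B x = the_elem (common_roots p x)" for x
  have single: "common_roots p x = {B x}" if x: "norm x < 1" for x
  proof -
    define i :: 'n where "i = undefined"
    obtain Z :: "complex^'n" where Z: "Z \<in> polydisc" "Z $ i = x"
      "\<And>i j. i \<noteq> j \<Longrightarrow> common_roots p (Z $ i) \<inter> common_roots p (Z $ j) = {}"
      by (rule ex_disjoint_common_roots[OF fam nc x, of i]) auto
    have ge: "card (common_roots p (Z $ j)) \<ge> 1" for j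
      using Z(1) finite_common_roots[OF fam] common_roots_nonempty[OF fam]
      by (auto simp: polydisc_iff Suc_le_eq card_gt_0_iff)
    have "card (common_roots p (Z $ i)) = 1"
    proof (rule ccontr)
      assume "card (common_roots p (Z $ i)) \<noteq> 1"
      with ge[of i] have "1 < card (common_roots p (Z $ i))" by linarith
      then have "(\<Sum>j\<in>(UNIV::'n set). 1) < (\<Sum>j\<in>UNIV. card (common_roots p (Z $ j)))"
        using ge by (intro sum_strict_mono_ex1) auto
      with card_disjoint_common_roots(1)[OF fam Z(1,3)] show False by simp
    qed
    then obtain y where "common_roots p x = {y}"
      unfolding Z(2) by (rule card_1_singletonE)
    then show ?thesis by (simp only: B_def the_elem_eq)
  qed
  have root: "poly (p Z) (B (Z $ i)) = 0" if "Z \<in> polydisc" for Z i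
    using common_roots_subset[OF that, of p i] single[of "Z $ i"] that by (auto simp: polydisc_iff)
  have B1: "norm (B x) < 1" if "norm x < 1" for x
  proof -
    have "(\<chi> _. x) \<in> (polydisc :: (complex^'n) set)" using that by (simp add: polydisc_iff)
    from proper_root_familyD(3)[OF fam this root[OF this, of undefined]] show ?thesis by simp
  qed
  have generic: "poly (p Z) x = (\<Prod>i\<in>UNIV. x - B (Z $ i))"
    if Z: "Z \<in> polydisc" "inj (\<lambda>i. B (Z $ i))" for Z x
  proof -
    have "p Z = (\<Prod>i\<in>UNIV. [:- B (Z $ i), 1:])"
    proof (rule poly_eqI_degree_lead_coeff[where n="CARD('n)" and A="range (\<lambda>i. B (Z $ i))"])
      have deg: "degree (\<Prod>i\<in>(UNIV::'n set). [:- B (Z $ i), 1:]) = CARD('n)"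
        by (subst degree_prod_eq_sum_degree) auto
      then show "degree (\<Prod>i\<in>(UNIV::'n set). [:- B (Z $ i), 1:]) \<le> CARD('n)" by simp
      show "degree (p Z) \<le> CARD('n)" using proper_root_familyD(1)[OF fam Z(1)] by simp
      have "lead_coeff (\<Prod>i\<in>(UNIV::'n set). [:- B (Z $ i), 1:]) = 1"
        by (simp add: lead_coeff_prod)
      then show "coeff (p Z) CARD('n) = coeff (\<Prod>i\<in>UNIV. [:- B (Z $ i), 1:]) CARD('n)"
        using proper_root_familyD(1,2)[OF fam Z(1)] deg by simp
      show "CARD('n) \<le> card (range (\<lambda>i. B (Z $ i)))"
        using Z(2) by (simp add: card_image)
      show "poly (p Z) z = poly (\<Prod>i\<in>UNIV. [:- B (Z $ i), 1:]) z" if "z \<in> range (\<lambda>i. B (Z $ i))" for z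
        using that root[OF Z(1)] by (auto simp: poly_prod prod_zero_iff)
    qed
    then show ?thesis by (simp add: poly_prod)
  qed
  have ex_generic: "\<exists>Z\<in>polydisc. Z $ i = c \<and> inj (\<lambda>i. B (Z $ i))" if c: "norm c < 1" for c and i :: 'n
  proof -
    obtain Z :: "complex^'n" where Z: "Z \<in> polydisc" "Z $ i = c"
      "\<And>i j. i \<noteq> j \<Longrightarrow> common_roots p (Z $ i) \<inter> common_roots p (Z $ j) = {}"
      by (rule ex_disjoint_common_roots[OF fam nc c, of i]) auto
    have "inj (\<lambda>i. B (Z $ i))"
    proof (rule injI, rule ccontr)
      fix k l assume "B (Z $ k) = B (Z $ l)" "k \<noteq> l"
      with Z(3)[OF \<open>k \<noteq> l\<close>] single[of "Z $ k"] single[of "Z $ l"] Z(1) show False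
        by (auto simp: polydisc_iff)
    qed
    with Z show ?thesis by blast
  qed
  define i0 :: 'n where "i0 = undefined"
  have hol: "B holomorphic_on ball 0 1"
    unfolding holomorphic_on_open[OF open_ball]
  proof
    fix x0 :: complex assume "x0 \<in> ball 0 1"
    then have "norm x0 < 1" by simp
    with ex_generic obtain Z where Z: "Z \<in> polydisc" "Z $ i0 = x0" "inj (\<lambda>i. B (Z $ i))" by blast
    \<comment> \<open>Evaluation at \<open>1\<close> is convenient because \<open>1\<close> is never a root.\<close>
    define c where "c = (\<Prod>j\<in>UNIV - {i0}. 1 - B (Z $ j))"
    have "1 - B (Z $ j) \<noteq> 0" for j
    proof
      assume "1 - B (Z $ j) = 0"
      then have "B (Z $ j) = 1" by simp
      with B1[of "Z $ j"] Z(1) show False by (simp add: polydisc_iff)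
    qed
    then have "c \<noteq> 0" by (simp add: c_def)
    define T where "T = ball 0 1 \<inter> (\<Inter>j\<in>UNIV - {i0}. {x. norm x < 1 \<and> B (Z $ j) \<notin> common_roots p x})"
    have "open T"
      unfolding T_def by (intro open_Int open_INT open_not_common_root[OF fam] ballI) auto
    moreover have "x0 \<in> T"
      using Z single[OF \<open>norm x0 < 1\<close>] \<open>norm x0 < 1\<close> by (auto simp: T_def inj_def)
    moreover have B_eq: "1 - poly (p (upd_coord Z i0 x)) 1 / c = B x" if "x \<in> T" for x
    proof -
      have x: "norm x < 1" using that by (simp add: T_def)
      have neq: "B x \<noteq> B (Z $ j)" if "j \<noteq> i0" for j
        using \<open>x \<in> T\<close> that single[OF x] by (auto simp: T_def)
      then have "inj (\<lambda>i. B (upd_coord Z i0 x $ i))"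
        using Z(3) unfolding inj_def by (auto split: if_splits) metis
      from generic[OF upd_coord_in_polydisc[OF Z(1) x] this, of 1]
      have "poly (p (upd_coord Z i0 x)) 1 = (\<Prod>i\<in>UNIV. 1 - B (if i = i0 then x else Z $ i))" by (simp only: upd_coord_nth)
      also have "\<dots> = (1 - B x) * (\<Prod>i\<in>UNIV - {i0}. 1 - B (if i = i0 then x else Z $ i))"
        by (subst prod.remove[of _ i0]) auto
      also have "(\<Prod>i\<in>UNIV - {i0}. 1 - B (if i = i0 then x else Z $ i)) = c"
        unfolding c_def by (rule prod.cong) auto
      finally show ?thesis using \<open>c \<noteq> 0\<close> by simp
    qed
    moreover have holT: "(\<lambda>x. 1 - poly (p (upd_coord Z i0 x)) 1 / c) holomorphic_on T"
      using \<open>c \<noteq> 0\<close> by (intro holomorphic_intros holomorphic_on_subset[OF holomorphic_on_coeff_upd_coord(2)[OF fam Z(1)]])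
        (auto simp: T_def)
    moreover have "B holomorphic_on T"
      by (rule holomorphic_transform[OF holT B_eq])
    ultimately show "\<exists>f'. (B has_field_derivative f') (at x0)"
      by (auto simp: holomorphic_on_open)
  qed
  have all: "poly (p Z) x = (\<Prod>i\<in>UNIV. x - B (Z $ i))" if Z: "Z \<in> polydisc" for Z x
  proof -
    obtain Y :: "complex^'n" where Y: "Y \<in> polydisc" "inj (\<lambda>i. B (Y $ i))"
      using ex_generic[of 0 undefined] by auto
    define V where "V = Y - Z"
    define L where "L = line_slice Z V"
    have holB: "(\<lambda>t. B (Z $ i + t * V $ i)) holomorphic_on L" for i
    proof -
      have "(\<lambda>t. Z $ i + t * V $ i) holomorphic_on L" by (intro holomorphic_intros)
      moreover have "(\<lambda>t. Z $ i + t * V $ i) ` L \<subseteq> ball 0 1"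
        by (auto simp: L_def line_slice_def polydisc_iff)
      ultimately show ?thesis
        using holomorphic_on_compose_gen[OF _ hol] by (simp add: o_def)
    qed
    define T where "T = (\<Inter>i. \<Inter>j\<in>UNIV - {i}. L \<inter> (\<lambda>t. B (Z $ i + t * V $ i) - B (Z $ j + t * V $ j)) -` (- {0}))"
    have "open L" unfolding L_def by (rule open_line_slice)
    have "poly (p (Z + 0 *s V)) x = (\<Prod>i\<in>UNIV. x - B (Z $ i + 0 * V $ i))"
    proof (rule analytic_continuation_open[where s="L \<inter> T" and s'=L and
          f="\<lambda>t. poly (p (Z + t *s V)) x" and g="\<lambda>t. \<Prod>i\<in>UNIV. x - B (Z $ i + t * V $ i)" and z=0])
      have "open T"
        unfolding T_def
        by (intro open_INT ballI continuous_open_preimage continuous_intros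
            holomorphic_on_imp_continuous_on[OF holB] \<open>open L\<close>) auto
      with \<open>open L\<close> show "open (L \<inter> T)" by (rule open_Int)
      show "connected L" unfolding L_def by (rule connected_line_slice)
      have "1 \<in> L" using Y(1) by (simp add: L_def line_slice_def V_def)
      moreover have "1 \<in> T" using \<open>1 \<in> L\<close> Y(2) by (auto simp: T_def V_def inj_def)
      ultimately show "L \<inter> T \<noteq> {}" by blast
      show "0 \<in> L" using Z by (simp add: L_def line_slice_def)
      show "(\<lambda>t. poly (p (Z + t *s V)) x) holomorphic_on L"
        unfolding L_def by (rule holomorphic_on_poly_family[OF fam])
      show "(\<lambda>t. \<Prod>i\<in>UNIV. x - B (Z $ i + t * V $ i)) holomorphic_on L"
        by (intro holomorphic_intros holB)
      fix t assume t: "t \<in> L \<inter> T"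
      then have "Z + t *s V \<in> polydisc" by (simp add: L_def line_slice_def)
      moreover have "inj (\<lambda>i. B ((Z + t *s V) $ i))"
      proof (rule injI, rule ccontr)
        fix k l assume kl: "B ((Z + t *s V) $ k) = B ((Z + t *s V) $ l)" "k \<noteq> l"
        have "t \<in> L \<inter> (\<lambda>t. B (Z $ k + t * V $ k) - B (Z $ l + t * V $ l)) -` (- {0})"
          using t kl(2) unfolding T_def by blast
        with kl(1) show False by simp
      qed
      ultimately show "poly (p (Z + t *s V)) x = (\<Prod>i\<in>UNIV. x - B (Z $ i + t * V $ i))"
        using generic[of "Z + t *s V" x] by simp
    qed (use \<open>open L\<close> in auto)
    then show ?thesis by simp
  qed
  have "boundary_modulus_1 B"
    unfolding boundary_modulus_1_def
  proof (intro allI impI)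
    fix \<epsilon> :: real assume "\<epsilon> > 0"
    obtain Z :: "complex^'n" where Z: "Z \<in> polydisc" using ex_generic[of 0 i0] by auto
    \<comment> \<open>A root of modulus greater than \<open>r\<close> does not belong to a fixed coordinate.\<close>
    define r where "r = Max (insert (1 - \<epsilon>) (range (\<lambda>j. norm (B (Z $ j)))))"
    have "r < 1"
      unfolding r_def using \<open>\<epsilon> > 0\<close> B1 Z by (auto simp: polydisc_iff)
    have r: "1 - \<epsilon> \<le> r" "norm (B (Z $ j)) \<le> r" for j
      unfolding r_def by (rule Max_ge; simp)+
    from proper_root_familyD(6)[OF fam \<open>r < 1\<close>] obtain s where s: "s < 1"
      "\<And>Z i. Z \<in> polydisc \<Longrightarrow> s < norm (Z $ i) \<Longrightarrow> \<exists>x. poly (p Z) x = 0 \<and> r < norm x"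
      by blast
    have "\<bar>norm (B x) - 1\<bar> < \<epsilon>" if x: "s < norm x" "norm x < 1" for x
    proof -
      have Y: "upd_coord Z i0 x \<in> polydisc" by (rule upd_coord_in_polydisc[OF Z x(2)])
      from s(2)[OF this, of i0] x(1) obtain y where y: "poly (p (upd_coord Z i0 x)) y = 0" "r < norm y"
        by auto
      then obtain i where "y = B (upd_coord Z i0 x $ i)"
        using all[OF Y, of y] by (auto simp del: upd_coord_nth)
      then have "y = B x" using y(2) r(2)[of i] by (auto split: if_splits)
      then show ?thesis using y(2) r(1) B1[OF x(2)] by auto
    qed
    then show "\<exists>s<1. \<forall>z. s < norm z \<longrightarrow> norm z < 1 \<longrightarrow> \<bar>norm (B z) - 1\<bar> < \<epsilon>"
      using s(1) by blast
  qed
  with hol B1 all show ?thesis using that by blast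
qed

section \<open>Wirtinger calculus\<close>

lemma has_derivative_vecI:
  fixes f :: "'a::real_normed_vector \<Rightarrow> complex^'n"
  assumes "\<And>i. ((\<lambda>x. f x $ i) has_derivative (\<lambda>h. f' h $ i)) F"
  shows "(f has_derivative f') F"
proof -
  have ax: "bounded_linear (axis i :: complex \<Rightarrow> complex^'n)" for i
    by (simp add: linear_conv_bounded_linear[symmetric] linear_iff vec_eq_iff axis_def)
  have "((\<lambda>x. \<Sum>i\<in>UNIV. axis i (f x $ i)) has_derivative (\<lambda>h. \<Sum>i\<in>UNIV. axis i (f' h $ i))) F"
    by (intro has_derivative_sum bounded_linear.has_derivative[OF ax] assms)
  moreover have "(\<Sum>i\<in>UNIV. axis i (v $ i)) = v" for v :: "complex^'n"
    by (simp add: vec_eq_iff axis_def)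
  ultimately show ?thesis by simp
qed

text \<open>
  The real derivative of \<open>f\<close> at \<open>u\<close>, split into its complex linear part \<open>a\<close> and its conjugate
  linear part \<open>b\<close>. These are the gradients of \<open>f\<close> with respect to \<open>u\<^sub>i\<close> and \<open>cnj
  u\<^sub>i\<close>; \<open>f\<close> is holomorphic at \<open>u\<close> if \<open>b = 0\<close>.
\<close>

definition has_wirtinger ::
  "(complex^'n \<Rightarrow> complex) \<Rightarrow> complex^'n \<Rightarrow> complex^'n \<Rightarrow> complex^'n \<Rightarrow> bool" where
  "has_wirtinger f a b u \<longleftrightarrow> (f has_derivative (\<lambda>h. \<Sum>i\<in>UNIV. a $ i * h $ i + b $ i * cnj (h $ i))) (at u)"

lemma has_wirtinger_const: "has_wirtinger (\<lambda>_. c) 0 0 u"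
  by (simp add: has_wirtinger_def)

lemma has_wirtinger_nth:
  fixes u :: "complex^'n"
  shows "has_wirtinger (\<lambda>u. u $ i) (axis i 1) 0 u"
proof -
  have "((\<lambda>u::complex^'n. u $ i) has_derivative (\<lambda>h. h $ i)) (at u)"
    by (rule bounded_linear.has_derivative[OF bounded_linear_vec_nth has_derivative_ident])
  moreover have "(\<Sum>j\<in>UNIV. axis i 1 $ j * h $ j + 0 $ j * cnj (h $ j)) = h $ i" for h :: "complex^'n"
    by (simp add: axis_def if_distrib[of "\<lambda>x. x * _"] cong: if_cong)
  ultimately show ?thesis by (simp only: has_wirtinger_def)
qed

lemma has_wirtinger_add:
  assumes "has_wirtinger f a b u" "has_wirtinger g c d u"
  shows "has_wirtinger (\<lambda>u. f u + g u) (a + c) (b + d) u"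
  unfolding has_wirtinger_def
  by (rule has_derivative_eq_rhs[OF has_derivative_add[OF assms[unfolded has_wirtinger_def]]])
     (simp add: sum.distrib[symmetric] algebra_simps)

lemma has_wirtinger_mult:
  assumes "has_wirtinger f a b u" "has_wirtinger g c d u"
  shows "has_wirtinger (\<lambda>u. f u * g u) (f u *s c + g u *s a) (f u *s d + g u *s b) u"
  unfolding has_wirtinger_def
  by (rule has_derivative_eq_rhs[OF has_derivative_mult[OF assms[unfolded has_wirtinger_def]]])
     (simp add: sum.distrib[symmetric] sum_distrib_left algebra_simps)

lemma has_wirtinger_sum:
  assumes "\<And>s. s \<in> S \<Longrightarrow> has_wirtinger (f s) (a s) (b s) u"
  shows "has_wirtinger (\<lambda>u. \<Sum>s\<in>S. f s u) (\<Sum>s\<in>S. a s) (\<Sum>s\<in>S. b s) u"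
  using assms
proof (induction S rule: infinite_finite_induct)
  case (insert s S)
  then show ?case using has_wirtinger_add[of "f s" "a s" "b s" u "\<lambda>u. \<Sum>s\<in>S. f s u"] by simp
qed (auto intro: has_wirtinger_const)

definition cnj_vec :: "complex^'n \<Rightarrow> complex^'n" where
  "cnj_vec v = (\<chi> i. cnj (v $ i))"

lemma cnj_vec_nth [simp]: "cnj_vec v $ i = cnj (v $ i)"
  by (simp add: cnj_vec_def)

lemma cnj_vec_0 [simp]: "cnj_vec 0 = 0"
  by (simp add: vec_eq_iff)

lemma has_wirtinger_cnj:
  assumes "has_wirtinger f a b u"
  shows "has_wirtinger (\<lambda>u. cnj (f u)) (cnj_vec b) (cnj_vec a) u"
  unfolding has_wirtinger_def
  by (rule has_derivative_eq_rhs[OF bounded_linear.has_derivative[OF bounded_linear_cnj assms[unfolded has_wirtinger_def]]])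
     (simp add: fun_eq_iff add.commute)

lemma has_wirtinger_compose_field:
  assumes "has_wirtinger f a b u" "(g has_field_derivative d) (at (f u))"
  shows "has_wirtinger (\<lambda>u. g (f u)) (d *s a) (d *s b) u"
  unfolding has_wirtinger_def
  by (rule has_derivative_eq_rhs[OF has_derivative_compose[OF assms(1)[unfolded has_wirtinger_def] assms(2)[unfolded has_field_derivative_def]]])
     (simp add: fun_eq_iff sum_distrib_left algebra_simps)

lemma has_wirtinger_compose_map:
  fixes \<Phi> :: "complex^'m \<Rightarrow> complex^'n" and J :: "complex^'m^'n"
  assumes "has_wirtinger f a b (\<Phi> Z)" "(\<Phi> has_derivative (\<lambda>h. J *v h)) (at Z)"
  shows "has_wirtinger (\<lambda>Z. f (\<Phi> Z)) (\<chi> j. \<Sum>i\<in>UNIV. a $ i * J $ i $ j) (\<chi> j. \<Sum>i\<in>UNIV. b $ i * cnj (J $ i $ j)) Z"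
  unfolding has_wirtinger_def
proof (rule has_derivative_eq_rhs[OF has_derivative_compose[OF assms(2) assms(1)[unfolded has_wirtinger_def]]], rule ext)
  fix h :: "complex^'m"
  have "(\<Sum>i\<in>UNIV. a $ i * (J *v h) $ i + b $ i * cnj ((J *v h) $ i)) =
    (\<Sum>i\<in>UNIV. \<Sum>j\<in>UNIV. a $ i * J $ i $ j * h $ j + b $ i * cnj (J $ i $ j) * cnj (h $ j))"
    by (simp add: matrix_vector_mult_def sum_distrib_left sum.distrib mult.assoc)
  also have "\<dots> = (\<Sum>j\<in>UNIV. \<Sum>i\<in>UNIV. a $ i * J $ i $ j * h $ j + b $ i * cnj (J $ i $ j) * cnj (h $ j))"
    by (rule sum.swap)
  finally show "(\<Sum>i\<in>UNIV. a $ i * (J *v h) $ i + b $ i * cnj ((J *v h) $ i)) =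
     (\<Sum>j\<in>UNIV. (\<chi> j. \<Sum>i\<in>UNIV. a $ i * J $ i $ j) $ j * h $ j +
       (\<chi> j. \<Sum>i\<in>UNIV. b $ i * cnj (J $ i $ j)) $ j * cnj (h $ j))"
    by (simp add: sum_distrib_right sum.distrib)
qed

lemma has_wirtinger_transform:
  assumes "has_wirtinger f a b u" "open S" "u \<in> S" "\<And>w. w \<in> S \<Longrightarrow> f w = g w"
  shows "has_wirtinger g a b u"
  using has_derivative_transform_within_open[OF assms(1)[unfolded has_wirtinger_def] assms(2-4)]
  by (simp add: has_wirtinger_def)

lemma has_wirtinger_imp_wirtinger:
  assumes "has_wirtinger f a b u"
  shows "wirtinger i f u = a $ i" "wirtinger_cnj i f u = b $ i"
proof -
  have dd: "dir_deriv f v u = (\<Sum>i\<in>UNIV. a $ i * v $ i + b $ i * cnj (v $ i))" for v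
  proof -
    let ?L = "\<lambda>h. \<Sum>i\<in>UNIV. a $ i * h $ i + b $ i * cnj (h $ i)"
    have "((\<lambda>t::real. u + t *\<^sub>R v) has_derivative (\<lambda>t. t *\<^sub>R v)) (at 0)"
      by (auto intro!: derivative_eq_intros)
    moreover have "(f has_derivative ?L) (at (u + 0 *\<^sub>R v))"
      using assms by (simp add: has_wirtinger_def)
    ultimately have "((\<lambda>t. f (u + t *\<^sub>R v)) has_derivative (\<lambda>t. ?L (t *\<^sub>R v))) (at 0)"
      using has_derivative_compose[of "\<lambda>t. u + t *\<^sub>R v" "\<lambda>t. t *\<^sub>R v" 0 UNIV f ?L] by simp
    moreover have "?L (t *\<^sub>R v) = t *\<^sub>R ?L v" for t
      by (simp add: scaleR_sum_right scaleR_add_right)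
    ultimately have "((\<lambda>t. f (u + t *\<^sub>R v)) has_vector_derivative ?L v) (at 0)"
      by (simp add: has_vector_derivative_def)
    then show ?thesis
      unfolding dir_deriv_def by (rule vector_derivative_at)
  qed
  have d: "dir_deriv f (axis i c) u = a $ i * c + b $ i * cnj c" for c
  proof -
    have "(\<Sum>j\<in>UNIV. a $ j * axis i c $ j + b $ j * cnj (axis i c $ j)) =
       (\<Sum>j\<in>UNIV. if j = i then a $ i * c + b $ i * cnj c else 0)"
      by (rule sum.cong) (auto simp: axis_def)
    then show ?thesis unfolding dd by simp
  qed
  show "wirtinger i f u = a $ i" "wirtinger_cnj i f u = b $ i"
    by (simp_all add: wirtinger_def wirtinger_cnj_def d algebra_simps)
qed

lemma has_wirtinger_unique:
  assumes "has_wirtinger f a b u" "has_wirtinger f c d u"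
  shows "a = c" "b = d"
  using has_wirtinger_imp_wirtinger[OF assms(1)] has_wirtinger_imp_wirtinger[OF assms(2)]
  by (auto simp: vec_eq_iff)

section \<open>Polynomials in several variables\<close>

text \<open>
  Polynomial functions of several variables: a class of holomorphic functions that is closed
  under partial derivatives.
\<close>

inductive cpoly :: "(complex^'n \<Rightarrow> complex) \<Rightarrow> bool" where
  cpoly_const: "cpoly (\<lambda>_. c)"
| cpoly_nth: "cpoly (\<lambda>u. u $ i)"
| cpoly_add: "cpoly f \<Longrightarrow> cpoly g \<Longrightarrow> cpoly (\<lambda>u. f u + g u)"
| cpoly_mult: "cpoly f \<Longrightarrow> cpoly g \<Longrightarrow> cpoly (\<lambda>u. f u * g u)"

lemma cpoly_sum: "(\<And>s. s \<in> S \<Longrightarrow> cpoly (f s)) \<Longrightarrow> cpoly (\<lambda>u. \<Sum>s\<in>S. f s u)"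
  by (induction S rule: infinite_finite_induct) (auto intro: cpoly_const cpoly_add)

lemma cpoly_prod: "(\<And>s. s \<in> S \<Longrightarrow> cpoly (f s)) \<Longrightarrow> cpoly (\<lambda>u. \<Prod>s\<in>S. f s u)"
  by (induction S rule: infinite_finite_induct) (auto intro: cpoly_const cpoly_mult)

lemma cpoly_prod_mset: "(\<And>y. cpoly (f y)) \<Longrightarrow> cpoly (\<lambda>u. \<Prod>y\<in>#A. f y u)"
  by (induction A) (auto intro: cpoly_const cpoly_mult)

lemma cpoly_poly: "cpoly f \<Longrightarrow> cpoly (\<lambda>u. poly q (f u))"
  by (induction q) (auto intro: cpoly_const cpoly_add cpoly_mult)

lemma continuous_on_cpoly: "cpoly f \<Longrightarrow> continuous_on S f"
  by (induction rule: cpoly.induct) (auto intro!: continuous_intros)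

text \<open>
  Conjugation of the coefficients.
\<close>

lemma cpoly_cnj: "cpoly f \<Longrightarrow> \<exists>g. cpoly g \<and> (\<forall>u. f (cnj_vec u) = cnj (g u))"
proof (induction rule: cpoly.induct)
  case (cpoly_const c)
  show ?case by (intro exI[of _ "\<lambda>_. cnj c"]) (auto intro: cpoly.intros)
next
  case (cpoly_nth i)
  show ?case by (intro exI[of _ "\<lambda>u. u $ i"]) (auto intro: cpoly.intros)
next
  case (cpoly_add f g)
  then obtain f' g' where "cpoly f'" "cpoly g'" "\<forall>u. f (cnj_vec u) = cnj (f' u)" "\<forall>u. g (cnj_vec u) = cnj (g' u)"
    by blast
  then show ?case by (intro exI[of _ "\<lambda>u. f' u + g' u"]) (auto intro: cpoly.intros)
next
  case (cpoly_mult f g)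
  then obtain f' g' where "cpoly f'" "cpoly g'" "\<forall>u. f (cnj_vec u) = cnj (f' u)" "\<forall>u. g (cnj_vec u) = cnj (g' u)"
    by blast
  then show ?case by (intro exI[of _ "\<lambda>u. f' u * g' u"]) (auto intro: cpoly.intros)
qed

lemma cpoly_gradient:
  fixes f :: "complex^'n \<Rightarrow> complex"
  assumes "cpoly f"
  obtains g where "\<And>i. cpoly (\<lambda>u. g u $ i)" "\<And>u. has_wirtinger f (g u) 0 u"
proof -
  from assms have "\<exists>g. (\<forall>i. cpoly (\<lambda>u. g u $ i)) \<and> (\<forall>u. has_wirtinger f (g u) 0 u)"
  proof (induction rule: cpoly.induct)
    case (cpoly_const c)
    show ?case by (intro exI[of _ "\<lambda>_. 0"]) (auto intro: cpoly.intros has_wirtinger_const)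
  next
    case (cpoly_nth i)
    show ?case by (intro exI[of _ "\<lambda>_. axis i 1"]) (auto intro: cpoly.intros has_wirtinger_nth)
  next
    case (cpoly_add f g)
    then obtain f' g' where *: "\<And>i. cpoly (\<lambda>u. f' u $ i)" "\<And>i. cpoly (\<lambda>u. g' u $ i)"
      "\<And>u. has_wirtinger f (f' u) 0 u" "\<And>u. has_wirtinger g (g' u) 0 u"
      by blast
    have "has_wirtinger (\<lambda>u. f u + g u) (f' u + g' u) 0 u" for u
      using has_wirtinger_add[OF *(3,4)] by simp
    then show ?case
      using * by (intro exI[of _ "\<lambda>u. f' u + g' u"]) (auto intro: cpoly.intros)
  next
    case (cpoly_mult f g)
    then obtain f' g' where *: "\<And>i. cpoly (\<lambda>u. f' u $ i)" "\<And>i. cpoly (\<lambda>u. g' u $ i)"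
      "\<And>u. has_wirtinger f (f' u) 0 u" "\<And>u. has_wirtinger g (g' u) 0 u"
      by blast
    have "has_wirtinger (\<lambda>u. f u * g u) (f u *s g' u + g u *s f' u) 0 u" for u
      using has_wirtinger_mult[OF *(3,4)] by simp
    moreover have "cpoly (\<lambda>u. f u * g' u $ i + g u * f' u $ i)" for i
      by (rule cpoly.intros(3); rule cpoly.intros(4)) (use * cpoly_mult.hyps in simp_all)
    ultimately show ?case
      by (intro exI[of _ "\<lambda>u. f u *s g' u + g u *s f' u"]) simp
  qed
  then show ?thesis using that by blast
qed

lemma has_derivative_imp_complex_jacobian:
  fixes A :: "complex^'n^'m"
  assumes "(F has_derivative (\<lambda>h. A *v h)) (at u)"
  shows "complex_jacobian F u = A"
proof -
  have "deriv (\<lambda>t. F (u + axis j t) $ i) 0 = A $ i $ j" for i j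
  proof (rule DERIV_imp_deriv)
    have ax: "bounded_linear (axis j :: complex \<Rightarrow> complex^'n)"
      by (simp add: linear_conv_bounded_linear[symmetric] linear_iff vec_eq_iff axis_def)
    have "((\<lambda>t. u + axis j t) has_derivative (\<lambda>t. axis j t)) (at 0)"
      by (auto intro!: derivative_eq_intros bounded_linear.has_derivative[OF ax])
    moreover have "axis j (0::complex) = (0 :: complex^'n)" by (simp add: vec_eq_iff axis_def)
    then have "(F has_derivative (\<lambda>h. A *v h)) (at (u + axis j 0))"
      using assms by (simp only: add_0_right)
    ultimately have "((\<lambda>t. F (u + axis j t)) has_derivative (\<lambda>t. A *v axis j t)) (at 0)"
      by (rule has_derivative_compose)
    from bounded_linear.has_derivative[OF bounded_linear_vec_nth this, of i]
    show "((\<lambda>t. F (u + axis j t) $ i) has_field_derivative A $ i $ j) (at 0)"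
      unfolding has_field_derivative_def
      by (rule has_derivative_eq_rhs)
         (auto simp: matrix_vector_mult_def axis_def fun_eq_iff if_distrib[of "\<lambda>x. _ * x"] cong: if_cong)
  qed
  then show ?thesis by (simp add: complex_jacobian_def vec_eq_iff)
qed

lemma has_wirtinger_holomorphic_compose:
  fixes \<Phi> :: "complex^'m \<Rightarrow> complex^'n" and J :: "complex^'m^'n"
  assumes "has_wirtinger f a 0 (\<Phi> Z)" "(\<Phi> has_derivative (\<lambda>h. J *v h)) (at Z)"
  shows "has_wirtinger (\<lambda>Z. f (\<Phi> Z)) (\<chi> j. \<Sum>i\<in>UNIV. a $ i * J $ i $ j) 0 Z"
  using has_wirtinger_compose_map[OF assms] by (simp add: zero_vec_def)

lemma has_derivative_map_of_has_wirtinger: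
  fixes F :: "complex^'n \<Rightarrow> complex^'m"
  assumes "\<And>i. has_wirtinger (\<lambda>u. F u $ i) (g i) 0 u"
  shows "(F has_derivative (\<lambda>h. (\<chi> i j. g i $ j) *v h)) (at u)"
  by (rule has_derivative_vecI)
     (use assms in \<open>simp add: has_wirtinger_def matrix_vector_mult_def\<close>)

lemma has_wirtinger_line:
  assumes "has_wirtinger f a 0 (Z + t *s V)"
  shows "((\<lambda>t. f (Z + t *s V)) has_field_derivative (\<Sum>i\<in>UNIV. a $ i * V $ i)) (at t)"
proof -
  have bl: "bounded_linear (\<lambda>h::complex. h *s V)"
    by (simp add: linear_conv_bounded_linear[symmetric] linear_iff vec_eq_iff algebra_simps)
  have "((\<lambda>t. Z + t *s V) has_derivative (\<lambda>h. h *s V)) (at t)"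
    by (auto intro!: derivative_eq_intros bounded_linear.has_derivative[OF bl])
  from has_derivative_compose[OF this assms[unfolded has_wirtinger_def]]
  show ?thesis
    unfolding has_field_derivative_def
    by (rule has_derivative_eq_rhs) (simp add: fun_eq_iff sum_distrib_left sum_distrib_right mult_ac)
qed

section \<open>The derivative of the symmetrization map\<close>

lemma cpoly_esymm: "cpoly (esymm k)"
  unfolding esymm_def[abs_def] by (intro cpoly_sum cpoly_prod cpoly_nth)

lemma cpoly_symmetrization: "cpoly (\<lambda>Z. symmetrization Z $ i)"
  using cpoly_esymm by (simp add: symmetrization_def)

abbreviation sym_jacobian :: "complex^('n::{finite,linorder}) \<Rightarrow> complex^('n::{finite,linorder})^('n::{finite,linorder})" where
  "sym_jacobian \<equiv> complex_jacobian symmetrization"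

lemma has_derivative_symmetrization:
  "(symmetrization has_derivative (\<lambda>h. sym_jacobian Z *v h)) (at Z)"
proof -
  have "\<exists>g. has_wirtinger (\<lambda>Z. symmetrization Z $ i) g 0 Z" for i
    using cpoly_gradient[OF cpoly_symmetrization, of i] by blast
  then obtain g where "\<And>i. has_wirtinger (\<lambda>Z. symmetrization Z $ i) (g i) 0 Z" by metis
  from has_derivative_map_of_has_wirtinger[OF this]
  show ?thesis
    using has_derivative_imp_complex_jacobian by metis
qed

text \<open>
  The linear part of \<open>u \<mapsto> poly (root_poly u) x\<close>. Since a polynomial is determined by its
  values, vectors \<open>w\<close> are determined by these linear forms (\<open>root_poly_variation_eq_0\<close>).
\<close>

definition root_poly_variation :: "complex \<Rightarrow> complex^('n::{finite,linorder}) \<Rightarrow> complex" where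
  "root_poly_variation x w = (\<Sum>i\<in>UNIV. (- 1) ^ coord_number i * w $ i * x ^ (CARD('n) - coord_number i))"

lemma root_poly_variation_eq_0:
  fixes w :: "complex^('n::{finite,linorder})"
  assumes "\<And>x. root_poly_variation x w = 0"
  shows "w = 0"
proof -
  have "root_poly w = root_poly (0 :: (complex,'n) vec)"
    by (rule poly_ext) (use assms in \<open>simp add: poly_root_poly root_poly_variation_def\<close>)
  then show ?thesis by (simp add: root_poly_inject)
qed

text \<open>
  Both sides are the derivative of \<open>Z \<mapsto> \<Prod> (x - Z $ i)\<close> in the direction \<open>h\<close>.
\<close>

lemma root_poly_variation_sym_jacobian:
  fixes Z h :: "complex^('n::{finite,linorder})"
  shows "root_poly_variation x (sym_jacobian Z *v h) = - (\<Sum>i\<in>UNIV. h $ i * (\<Prod>j\<in>UNIV - {i}. x - Z $ j))"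
proof -
  have bl: "bounded_linear (root_poly_variation x :: (complex,'n) vec \<Rightarrow> complex)"
    unfolding root_poly_variation_def[abs_def]
    by (intro bounded_linear_sum bounded_linear_mult_left[THEN bounded_linear_compose]
        bounded_linear_mult_right[THEN bounded_linear_compose] bounded_linear_vec_nth)
  have "((\<lambda>Z. x ^ CARD('n) + root_poly_variation x (symmetrization Z)) has_derivative
     (\<lambda>h. root_poly_variation x (sym_jacobian Z *v h))) (at Z)"
    by (rule has_derivative_eq_rhs[OF has_derivative_add[OF has_derivative_const
            bounded_linear.has_derivative[OF bl has_derivative_symmetrization]]]) simp
  moreover have "x ^ CARD('n) + root_poly_variation x (symmetrization Z) = (\<Prod>i\<in>UNIV. x - Z $ i)" for Z :: "(complex,'n) vec"
    unfolding poly_root_poly_symmetrization[symmetric] by (simp add: poly_root_poly root_poly_variation_def)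
  ultimately have "((\<lambda>Z. \<Prod>i\<in>UNIV. x - Z $ i) has_derivative
     (\<lambda>h. root_poly_variation x (sym_jacobian Z *v h))) (at Z)" by simp
  moreover have "((\<lambda>Z. \<Prod>i\<in>UNIV. x - Z $ i) has_derivative
     (\<lambda>h. \<Sum>i\<in>UNIV. (- h $ i) * (\<Prod>j\<in>UNIV - {i}. x - Z $ j))) (at Z)"
  proof (rule has_derivative_prod)
    fix i :: 'n
    have "((\<lambda>Z. Z $ i) has_derivative (\<lambda>h. h $ i)) (at Z)"
      by (rule bounded_linear.has_derivative[OF bounded_linear_vec_nth has_derivative_ident])
    from has_derivative_diff[OF has_derivative_const this]
    show "((\<lambda>Z. x - Z $ i) has_derivative (\<lambda>h. - h $ i)) (at Z)" by simp
  qed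
  ultimately have "(\<lambda>h. root_poly_variation x (sym_jacobian Z *v h)) =
     (\<lambda>h. \<Sum>i\<in>UNIV. (- h $ i) * (\<Prod>j\<in>UNIV - {i}. x - Z $ j))"
    by (rule has_derivative_unique)
  then show ?thesis by (simp add: fun_eq_iff sum_negf)
qed

text \<open>
  At \<open>x = Z $ i\<close> only one of the products in \<open>root_poly_variation_sym_jacobian\<close> is nonzero.
\<close>

lemma sym_jacobian_injective:
  fixes Z h :: "complex^('n::{finite,linorder})"
  assumes inj: "inj (\<lambda>i. Z $ i)" and "sym_jacobian Z *v h = 0"
  shows "h = 0"
proof -
  have "h $ i = 0" for i
  proof -
    have "0 = (\<Sum>k\<in>UNIV. h $ k * (\<Prod>j\<in>UNIV - {k}. Z $ i - Z $ j))"
      using root_poly_variation_sym_jacobian[of "Z $ i" Z h] assms(2) by (simp add: root_poly_variation_def)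
    also have "\<dots> = (\<Sum>k\<in>UNIV. if k = i then h $ i * (\<Prod>j\<in>UNIV - {i}. Z $ i - Z $ j) else 0)"
      by (rule sum.cong) auto
    finally have "h $ i * (\<Prod>j\<in>UNIV - {i}. Z $ i - Z $ j) = 0" by simp
    moreover have "(\<Prod>j\<in>UNIV - {i}. Z $ i - Z $ j) \<noteq> 0"
      using inj by (auto simp: inj_def)
    ultimately show ?thesis by simp
  qed
  then show ?thesis by (simp add: vec_eq_iff)
qed

lemma ex_non_root:
  assumes "finite A" "P \<noteq> (0 :: complex poly)"
  shows "\<exists>x. x \<notin> A \<and> poly P x \<noteq> 0"
proof (rule ccontr)
  assume "\<not> ?thesis"
  then have "UNIV \<subseteq> A \<union> {x. poly P x = 0}" by blast
  then have "finite (UNIV :: complex set)"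
    using assms poly_roots_finite finite_subset by blast
  then show False using infinite_UNIV_char_0 by blast
qed

text \<open>
  This and the following two lemmas describe the derivative also where coordinates coincide, as
  needed to recognise the regular values of induced maps.
\<close>

lemma sym_jacobian_axis_nonzero:
  fixes Z :: "complex^('n::{finite,linorder})"
  shows "sym_jacobian Z *v axis i 1 \<noteq> 0"
proof
  assume eq: "sym_jacobian Z *v axis i 1 = 0"
  obtain x where x: "x \<notin> range (\<lambda>j. Z $ j)" using ex_non_root[of "range (\<lambda>j. Z $ j)" 1] by auto
  have "0 = (\<Sum>k\<in>UNIV. axis i 1 $ k * (\<Prod>j\<in>UNIV - {k}. x - Z $ j))"
    using root_poly_variation_sym_jacobian[of x Z "axis i 1"] eq by (simp add: root_poly_variation_def)
  also have "\<dots> = (\<Sum>k\<in>UNIV. if k = i then (\<Prod>j\<in>UNIV - {i}. x - Z $ j) else 0)"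
    by (rule sum.cong) (auto simp: axis_def)
  finally show False using x by auto
qed

lemma sym_jacobian_two_axes_nonzero:
  fixes Z :: "complex^('n::{finite,linorder})"
  assumes ij: "Z $ i \<noteq> Z $ j" and ab: "a \<noteq> 0 \<or> b \<noteq> 0"
  shows "sym_jacobian Z *v (axis i a + axis j b) \<noteq> 0"
proof
  assume eq: "sym_jacobian Z *v (axis i a + axis j b) = 0"
  have "i \<noteq> j" using ij by auto
  define P where "P = smult a [:- Z $ j, 1:] + smult b [:- Z $ i, 1:]"
  have "P \<noteq> 0"
  proof
    assume "P = 0"
    then have "poly P (Z $ i) = 0" "poly P (Z $ j) = 0" by simp_all
    then have "a * (Z $ i - Z $ j) = 0" "b * (Z $ j - Z $ i) = 0"
      by (simp_all add: P_def algebra_simps)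
    with ij ab show False by auto
  qed
  then obtain x where x: "x \<notin> range (\<lambda>j. Z $ j)" "poly P x \<noteq> 0"
    using ex_non_root[of "range (\<lambda>j. Z $ j)" P] by auto
  define Q where "Q = (\<Prod>k\<in>UNIV - {i, j}. x - Z $ k)"
  have "UNIV - {i} = insert j (UNIV - {i, j})" "UNIV - {j} = insert i (UNIV - {i, j})"
    using \<open>i \<noteq> j\<close> by auto
  then have Q: "(\<Prod>k\<in>UNIV - {i}. x - Z $ k) = (x - Z $ j) * Q" "(\<Prod>k\<in>UNIV - {j}. x - Z $ k) = (x - Z $ i) * Q"
    unfolding Q_def by simp_all
  have "0 = (\<Sum>k\<in>UNIV. (axis i a + axis j b) $ k * (\<Prod>l\<in>UNIV - {k}. x - Z $ l))"
    using root_poly_variation_sym_jacobian[of x Z "axis i a + axis j b"] eq by (simp add: root_poly_variation_def)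
  also have "\<dots> = (\<Sum>k\<in>UNIV. (if k = i then a * ((x - Z $ j) * Q) else 0) + (if k = j then b * ((x - Z $ i) * Q) else 0))"
    using \<open>i \<noteq> j\<close> by (intro sum.cong) (auto simp: axis_def Q)
  also have "\<dots> = poly P x * Q"
    by (simp add: sum.distrib P_def algebra_simps)
  finally have "Q = 0" using x(2) by simp
  then show False using x(1) by (auto simp: Q_def)
qed

text \<open>
  The two variations of the polynomial move the same root.
\<close>

lemma sym_jacobian_axis_eq:
  fixes Z :: "complex^('n::{finite,linorder})"
  assumes "Z $ i = Z $ j"
  shows "sym_jacobian Z *v axis i c = sym_jacobian Z *v axis j c"
proof (cases "i = j")
  case False
  have "sym_jacobian Z *v (axis i c + axis j (- c)) = 0"
  proof (rule root_poly_variation_eq_0)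
    fix x
    define Q where "Q = (\<Prod>k\<in>UNIV - {i, j}. x - Z $ k)"
    have "UNIV - {i} = insert j (UNIV - {i, j})" "UNIV - {j} = insert i (UNIV - {i, j})"
      using \<open>i \<noteq> j\<close> by auto
    then have Q: "(\<Prod>k\<in>UNIV - {i}. x - Z $ k) = (x - Z $ j) * Q" "(\<Prod>k\<in>UNIV - {j}. x - Z $ k) = (x - Z $ i) * Q"
      unfolding Q_def by simp_all
    have "(\<Sum>k\<in>UNIV. (axis i c + axis j (- c)) $ k * (\<Prod>l\<in>UNIV - {k}. x - Z $ l)) =
      (\<Sum>k\<in>UNIV. (if k = i then c * ((x - Z $ j) * Q) else 0) + (if k = j then - c * ((x - Z $ i) * Q) else 0))"
      using \<open>i \<noteq> j\<close> by (intro sum.cong) (auto simp: axis_def Q)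
    also have "\<dots> = 0" using assms by (simp add: sum.distrib)
    finally show "root_poly_variation x (sym_jacobian Z *v (axis i c + axis j (- c))) = 0"
      by (simp add: root_poly_variation_sym_jacobian)
  qed
  moreover have "axis i c + axis j (- c) = axis i c - axis j c" by (simp add: vec_eq_iff axis_def)
  ultimately show ?thesis by (simp add: matrix_vector_mult_diff_distrib)
qed simp

section \<open>Proper maps are induced by Blaschke products\<close>

definition induced_by :: "(complex^('n::{finite,linorder}) \<Rightarrow> complex^('n::{finite,linorder})) \<Rightarrow> (complex \<Rightarrow> complex) \<Rightarrow> bool" where
  "induced_by F B \<longleftrightarrow> (\<forall>Z\<in>polydisc. F (symmetrization Z) = symmetrization (\<chi> i. B (Z $ i)))"

lemma holomorphic_map_on_sym_polydisc:
  assumes "F holomorphic_map_on sym_polydisc" "u \<in> sym_polydisc"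
  shows "(F has_derivative (\<lambda>h. complex_jacobian F u *v h)) (at u)"
  using assms has_derivative_imp_complex_jacobian open_sym_polydisc
  unfolding holomorphic_map_on_def by (metis at_within_open)

lemma cpoly_coeff_root_poly: "cpoly (\<lambda>u. coeff (root_poly u) k)"
proof -
  have "coeff (root_poly u) k = coeff (monom 1 CARD('a)) k +
    (\<Sum>i\<in>UNIV. (if CARD('a) - coord_number i = k then (- 1) ^ coord_number i else 0) * u $ i)" for u :: "(complex,'a) vec"
    by (simp add: root_poly_def coeff_sum if_distrib[of "\<lambda>x. x * _"] cong: if_cong)
  then show ?thesis
    by (simp only:) (intro cpoly_add cpoly_const cpoly_sum cpoly_mult cpoly_nth)
qed

text \<open>
  The last condition on the family is the properness of \<open>F\<close>, applied to the compact set of those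
  \<open>u\<close> with all roots of modulus at most \<open>r\<close>.
\<close>

lemma proper_root_family_proper_self_map:
  fixes F :: "complex^('n::{finite,linorder}) \<Rightarrow> complex^('n::{finite,linorder})"
  assumes F: "proper_holomorphic_self_map F"
  shows "proper_root_family CARD('n) (\<lambda>Z. root_poly (F (symmetrization Z)))"
proof -
  have img: "F u \<in> sym_polydisc" if "u \<in> sym_polydisc" for u
    using F that by (auto simp: proper_holomorphic_self_map_def)
  have W: "\<exists>W\<in>polydisc. F (symmetrization Z) = symmetrization W" if "Z \<in> polydisc" for Z
    using img[of "symmetrization Z"] that by (auto simp: sym_polydisc_def)
  have "norm x < 1" if "Z \<in> polydisc" "poly (root_poly (F (symmetrization Z))) x = 0" for Z x
    using W[OF that(1)] that(2) by (auto simp: poly_root_poly_symmetrization polydisc_iff)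
  moreover have "(\<lambda>t. coeff (root_poly (F (symmetrization (Z + t *s V)))) k) holomorphic_on line_slice Z V" for Z V k
    unfolding holomorphic_on_open[OF open_line_slice]
  proof
    fix t assume "t \<in> line_slice Z V"
    then have "symmetrization (Z + t *s V) \<in> sym_polydisc" by (simp add: line_slice_def)
    then have DF: "(F has_derivative (\<lambda>h. complex_jacobian F (symmetrization (Z + t *s V)) *v h)) (at (symmetrization (Z + t *s V)))"
      by (rule holomorphic_map_on_sym_polydisc[rotated]) (use F in \<open>simp add: proper_holomorphic_self_map_def\<close>)
    obtain g where "\<And>i. cpoly (\<lambda>u. g u $ i)"
      and g: "\<And>u :: (complex,'n) vec. has_wirtinger (\<lambda>u. coeff (root_poly u) k) (g u) 0 u"
      by (fact cpoly_gradient[OF cpoly_coeff_root_poly[of k]])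
    note has_wirtinger_line[OF has_wirtinger_holomorphic_compose[OF
        has_wirtinger_holomorphic_compose[OF g DF] has_derivative_symmetrization]]
    then show "\<exists>f'. ((\<lambda>t. coeff (root_poly (F (symmetrization (Z + t *s V)))) k) has_field_derivative f') (at t)"
      by blast
  qed
  moreover have "\<exists>s<1. \<forall>Z\<in>polydisc. (\<exists>i. s < norm (Z $ i)) \<longrightarrow>
      (\<exists>x. poly (root_poly (F (symmetrization Z))) x = 0 \<and> r < norm x)" if "r < 1" for r
  proof -
    define K where "K = symmetrization ` (closed_polydisc r :: (complex,'n) vec set)"
    have "compact K" "K \<subseteq> sym_polydisc"
      unfolding K_def
      by (rule compact_symmetrization_closed_polydisc, rule symmetrization_closed_polydisc_subset[OF \<open>r < 1\<close>])
    then have "compact {u \<in> sym_polydisc. F u \<in> K}"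
      using F by (simp add: proper_holomorphic_self_map_def)
    then obtain s where s: "s < 1" "symmetrization -` {u \<in> sym_polydisc. F u \<in> K} \<subseteq> closed_polydisc s"
      by (rule compact_subset_sym_polydisc) auto
    have "\<exists>x. poly (root_poly (F (symmetrization Z))) x = 0 \<and> r < norm x"
      if Z: "Z \<in> polydisc" "s < norm (Z $ i)" for Z i
    proof -
      have "Z \<notin> closed_polydisc s" using Z(2) by (auto simp: closed_polydisc_def not_le)
      with s(2) Z(1) have "F (symmetrization Z) \<notin> K" by auto
      moreover obtain W where W: "W \<in> polydisc" "F (symmetrization Z) = symmetrization W" using W[OF Z(1)] by blast
      ultimately have "W \<notin> closed_polydisc r" by (auto simp: K_def)
      then obtain j where "r < norm (W $ j)" by (auto simp: closed_polydisc_def not_le)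
      then show ?thesis
        by (intro exI[of _ "W $ j"]) (auto simp: W poly_root_poly_symmetrization)
    qed
    with s(1) show ?thesis by blast
  qed
  ultimately show ?thesis
    unfolding proper_root_family_def
    by (auto simp: degree_root_poly lead_coeff_root_poly symmetrization_permute)
qed

theorem proper_self_map_induced_by_blaschke:
  fixes F :: "complex^('n::{finite,linorder}) \<Rightarrow> complex^('n::{finite,linorder})"
  assumes F: "proper_holomorphic_self_map F"
  obtains c as where "norm c = 1" "\<forall>a\<in>set as. norm a < 1" "as \<noteq> []" "induced_by F (blaschke c as)"
proof -
  obtain B where B: "B holomorphic_on ball 0 1" "\<And>z. norm z < 1 \<Longrightarrow> norm (B z) < 1" "boundary_modulus_1 B"
    "\<And>Z x. Z \<in> polydisc \<Longrightarrow> poly (root_poly (F (symmetrization Z))) x = (\<Prod>i\<in>UNIV. x - B (Z $ i))"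
    by (rule proper_root_family_structure[OF proper_root_family_proper_self_map[OF F]]) blast
  obtain c as where c: "norm c = 1" "\<forall>a\<in>set as. norm a < 1" "\<And>z. norm z < 1 \<Longrightarrow> B z = blaschke c as z"
    using proper_disc_map_is_blaschke[OF B(1,3)] by blast
  have "as \<noteq> []"
    using c(3)[of 0] B(2)[of 0] c(1) by auto
  moreover have "induced_by F (blaschke c as)"
    unfolding induced_by_def
  proof
    fix Z :: "(complex,'n) vec" assume Z: "Z \<in> polydisc"
    have "root_poly (F (symmetrization Z)) = root_poly (symmetrization (\<chi> i. blaschke c as (Z $ i)))"
      by (rule poly_ext) (use Z c(3) in \<open>auto simp: B(4)[OF Z] poly_root_poly_symmetrization polydisc_iff\<close>)
    then show "F (symmetrization Z) = symmetrization (\<chi> i. blaschke c as (Z $ i))"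
      by (simp add: root_poly_inject)
  qed
  ultimately show ?thesis using c that by blast
qed

section \<open>The Szego metric in the coordinates of the polydisc\<close>

lemma degree_rev_root_poly:
  "degree (rev_root_poly (u :: complex^('n::{finite,linorder}))) \<le> CARD('n)"
  unfolding rev_root_poly_def
  by (intro degree_add_le degree_sum_le order_trans[OF degree_monom_le] coord_number_bounds) auto

lemma cpoly_coeff_rev_root_poly: "cpoly (\<lambda>u. coeff (rev_root_poly u) k)"
proof -
  have "coeff (rev_root_poly u) k = coeff 1 k +
    (\<Sum>i\<in>UNIV. (if coord_number i = k then (- 1) ^ coord_number i else 0) * u $ i)" for u :: "(complex,'a) vec"
    by (simp add: rev_root_poly_def coeff_sum if_distrib[of "\<lambda>x. x * _"] cong: if_cong)
  then show ?thesis
    by (simp only:) (intro cpoly_add cpoly_const cpoly_sum cpoly_mult cpoly_nth)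
qed

lemma cpoly_poly_root_poly: "cpoly (\<lambda>u. poly (root_poly u) x)"
  unfolding poly_root_poly by (intro cpoly_add cpoly_const cpoly_sum cpoly_mult cpoly_nth)

lemma symmetrization_cnj_vec: "symmetrization (cnj_vec Z) = cnj_vec (symmetrization Z)"
  by (simp add: vec_eq_iff symmetrization_def esymm_def)

text \<open>
  The reciprocal of the diagonal Szego kernel is the resultant of the monic polynomial with
  roots \<open>cnj (Z $ j)\<close> and the polynomial \<open>\<Prod> (1 - Z $ i * x)\<close>, hence a polynomial in \<open>u\<close>
  and \<open>cnj u\<close>. This gives access to the derivatives with respect to \<open>u\<close> also where the
  symmetrization has no local inverse.
\<close>

lemma szego_denominator:
  obtains l m :: "(nat \<Rightarrow> nat) \<Rightarrow> complex^('n::{finite,linorder}) \<Rightarrow> complex" and S :: "(nat \<Rightarrow> nat) set"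
  where "\<And>s. cpoly (l s)" "\<And>s. cpoly (m s)"
    "\<And>Z. (\<Sum>s\<in>S. l s (symmetrization Z) * cnj (m s (symmetrization Z))) =
        (\<Prod>i\<in>UNIV. \<Prod>j\<in>UNIV. 1 - Z $ i * cnj (Z $ j))"
proof -
  let ?n = "CARD('n)"
  obtain S :: "(nat \<Rightarrow> nat) set" and cf :: "nat \<Rightarrow> complex poly" and R :: "(nat \<Rightarrow> nat) \<Rightarrow> complex poly"
    where "finite S" and res: "\<And>p q. lead_coeff p = 1 \<Longrightarrow> degree p = ?n \<Longrightarrow> degree q \<le> ?n \<Longrightarrow>
    (\<Prod>x\<in>#proots p. poly q x) =
    (\<Sum>s\<in>S. (\<Prod>k\<le>?n. poly (cf (s k)) (coeff q k)) *
       (lead_coeff (R s) ^ ?n * (\<Prod>y\<in>#proots (R s). (- 1) ^ ?n * poly p y)))"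
    by (fact resultant_expansion)
  define l where "l s u = (\<Prod>k\<le>?n. poly (cf (s k)) (coeff (rev_root_poly u) k))" for s and u :: "(complex,'n) vec"
  define m' where "m' s v = lead_coeff (R s) ^ ?n * (\<Prod>y\<in>#proots (R s). (- 1) ^ ?n * poly (root_poly v) y)"
    for s and v :: "(complex,'n) vec"
  have l: "cpoly (l s)" for s
    unfolding l_def by (intro cpoly_prod cpoly_poly cpoly_coeff_rev_root_poly)
  have m': "cpoly (m' s)" for s
    unfolding m'_def by (intro cpoly_mult cpoly_const cpoly_prod_mset cpoly_poly_root_poly)
  obtain m where m: "\<And>s. cpoly (m s)" "\<And>s v. m' s (cnj_vec v) = cnj (m s v)"
    using cpoly_cnj[OF m'] by metis
  have "(\<Sum>s\<in>S. l s (symmetrization Z) * cnj (m s (symmetrization Z))) =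
        (\<Prod>i\<in>UNIV. \<Prod>j\<in>UNIV. 1 - Z $ i * cnj (Z $ j))" for Z
  proof -
    have "(\<Sum>s\<in>S. l s (symmetrization Z) * cnj (m s (symmetrization Z))) =
      (\<Sum>s\<in>S. l s (symmetrization Z) * m' s (symmetrization (cnj_vec Z)))"
      by (simp add: symmetrization_cnj_vec m(2))
    also have "\<dots> = (\<Prod>x\<in>#proots (root_poly (symmetrization (cnj_vec Z))). poly (rev_root_poly (symmetrization Z)) x)"
      unfolding l_def m'_def
      by (rule res[symmetric]) (simp_all add: degree_root_poly lead_coeff_root_poly degree_rev_root_poly)
    also have "\<dots> = (\<Prod>j\<in>UNIV. \<Prod>i\<in>UNIV. 1 - Z $ i * cnj (Z $ j))"
      by (simp add: proots_root_poly_symmetrization image_mset.compositionality o_def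
          poly_rev_root_poly_symmetrization prod_unfold_prod_mset)
    also have "\<dots> = (\<Prod>i\<in>UNIV. \<Prod>j\<in>UNIV. 1 - Z $ i * cnj (Z $ j))"
      by (rule prod.swap)
    finally show ?thesis .
  qed
  with l m(1) show ?thesis using that by blast
qed

text \<open>
  The negative logarithm of the diagonal Szego kernel in the coordinates of the polydisc. All
  arguments of \<open>Ln\<close> have positive real part, so the principal branch is holomorphic there.
\<close>

definition log_kernel :: "complex^'n \<Rightarrow> complex" where
  "log_kernel Z = (\<Sum>i\<in>UNIV. \<Sum>j\<in>UNIV. Ln (1 - Z $ i * cnj (Z $ j)))"

lemma Re_one_minus_pos:
  assumes "norm z < 1" "norm w < 1"
  shows "0 < Re (1 - z * cnj w)"
proof -
  have "Re (z * cnj w) \<le> norm (z * cnj w)" by (rule complex_Re_le_cmod)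
  also have "\<dots> = norm z * norm w" by (simp add: norm_mult)
  also have "\<dots> < 1 * 1" using assms by (intro mult_strict_mono) auto
  finally show ?thesis by simp
qed

lemma not_nonpos_Reals_if_Re_pos: "0 < Re z \<Longrightarrow> z \<notin> \<real>\<^sub>\<le>\<^sub>0"
  by (auto simp: complex_nonpos_Reals_iff)

lemma exp_log_kernel:
  fixes Z :: "complex^'n"
  assumes "Z \<in> polydisc"
  shows "exp (log_kernel Z) = (\<Prod>i\<in>UNIV. \<Prod>j\<in>UNIV. 1 - Z $ i * cnj (Z $ j))"
proof -
  have "1 - Z $ i * cnj (Z $ j) \<noteq> 0" for i j
    using one_minus_mult_cnj_nonzero[of "Z $ i" "Z $ j"] assms by (auto simp: polydisc_iff)
  then show ?thesis by (simp add: log_kernel_def exp_sum)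
qed

lemma Im_log_kernel:
  fixes Z :: "complex^'n"
  assumes "Z \<in> polydisc"
  shows "Im (log_kernel Z) = 0"
proof -
  have "cnj (Ln (1 - Z $ i * cnj (Z $ j))) = Ln (1 - Z $ j * cnj (Z $ i))" for i j
  proof -
    have "1 - Z $ i * cnj (Z $ j) \<notin> \<real>\<^sub>\<le>\<^sub>0"
      using Re_one_minus_pos assms by (intro not_nonpos_Reals_if_Re_pos) (auto simp: polydisc_iff)
    then have "cnj (Ln (1 - Z $ i * cnj (Z $ j))) = Ln (cnj (1 - Z $ i * cnj (Z $ j)))" by (rule cnj_Ln)
    then show ?thesis by (simp add: mult.commute)
  qed
  then have "cnj (log_kernel Z) = (\<Sum>i\<in>UNIV. \<Sum>j\<in>UNIV. Ln (1 - Z $ j * cnj (Z $ i)))"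
    by (simp add: log_kernel_def)
  also have "\<dots> = log_kernel Z" unfolding log_kernel_def by (rule sum.swap)
  finally show ?thesis by (simp add: complex_eq_iff)
qed

lemma log_szego_symmetrization:
  fixes Z :: "complex^('n::{finite,linorder})"
  assumes "Z \<in> polydisc"
  shows "Ln (szego (symmetrization Z) (symmetrization Z)) = - log_kernel Z"
proof -
  have "szego (symmetrization Z) (symmetrization Z) = szego_prod Z Z"
    by (rule szego_symmetrization[OF assms assms])
  also have "\<dots> = exp (- log_kernel Z)"
    by (simp add: exp_minus exp_log_kernel[OF assms] szego_prod_def inverse_eq_divide prod_dividef)
  finally show ?thesis
    using Im_log_kernel[OF assms] by simp
qed

lemma has_wirtinger_log_kernel:
  fixes Z :: "complex^'n"
  assumes "Z \<in> polydisc"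
  shows "\<exists>a. has_wirtinger (\<lambda>Z. - log_kernel Z) a (\<chi> k. \<Sum>i\<in>UNIV. Z $ i / (1 - Z $ i * cnj (Z $ k))) Z"
proof -
  define D where "D i j = 1 - Z $ i * cnj (Z $ j)" for i j
  have L: "\<exists>a. has_wirtinger (\<lambda>Z. - Ln (1 - Z $ i * cnj (Z $ j))) a (axis j (Z $ i / D i j)) Z" for i j
  proof -
    have "has_wirtinger (\<lambda>Z. Z $ i * cnj (Z $ j)) (Z $ i *s cnj_vec 0 + cnj (Z $ j) *s axis i 1)
        (Z $ i *s cnj_vec (axis j 1) + cnj (Z $ j) *s 0) Z"
      by (rule has_wirtinger_mult[OF has_wirtinger_nth has_wirtinger_cnj[OF has_wirtinger_nth]])
    then have 1: "has_wirtinger (\<lambda>Z. Z $ i * cnj (Z $ j)) (cnj (Z $ j) *s axis i 1) (axis j (Z $ i)) Z"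
    proof -
      have "Z $ i *s cnj_vec (axis j 1) = axis j (Z $ i)" by (simp add: vec_eq_iff axis_def)
      then show ?thesis using \<open>has_wirtinger _ _ _ _\<close> by simp
    qed
    have "D i j \<notin> \<real>\<^sub>\<le>\<^sub>0"
      using Re_one_minus_pos[of "Z $ i" "Z $ j"] assms
      by (intro not_nonpos_Reals_if_Re_pos) (auto simp: polydisc_iff D_def)
    then have "((\<lambda>w. - Ln (1 - w)) has_field_derivative 1 / D i j) (at (Z $ i * cnj (Z $ j)))"
      unfolding D_def by (auto intro!: derivative_eq_intros simp: inverse_eq_divide)
    from has_wirtinger_compose_field[OF 1 this] show ?thesis
    proof -
      have "(1 / D i j) *s axis j (Z $ i) = axis j (Z $ i / D i j)" by (simp add: vec_eq_iff axis_def)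
      with \<open>has_wirtinger _ _ ((1 / D i j) *s axis j (Z $ i)) Z\<close> show ?thesis by metis
    qed
  qed
  then obtain a where a: "\<And>i j. has_wirtinger (\<lambda>Z. - Ln (1 - Z $ i * cnj (Z $ j))) (a i j) (axis j (Z $ i / D i j)) Z"
    by metis
  have "has_wirtinger (\<lambda>Z. \<Sum>i\<in>UNIV. \<Sum>j\<in>UNIV. - Ln (1 - Z $ i * cnj (Z $ j)))
    (\<Sum>i\<in>UNIV. \<Sum>j\<in>UNIV. a i j) (\<Sum>i\<in>UNIV. \<Sum>j\<in>UNIV. axis j (Z $ i / D i j)) Z"
    by (intro has_wirtinger_sum a)
  moreover have "(\<Sum>i\<in>UNIV. \<Sum>j\<in>UNIV. axis j (Z $ i / D i j)) = (\<chi> k. \<Sum>i\<in>UNIV. Z $ i / (1 - Z $ i * cnj (Z $ k)))"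
    by (simp add: vec_eq_iff axis_def D_def)
  ultimately show ?thesis
    by (auto simp: log_kernel_def[abs_def] sum_negf)
qed

lemma has_wirtinger_bergman:
  fixes Z :: "complex^'n"
  assumes "Z \<in> polydisc"
  shows "\<exists>b. has_wirtinger (\<lambda>Z. \<Sum>i\<in>UNIV. Z $ i / (1 - Z $ i * cnj (Z $ k))) (\<chi> j. 1 / (1 - Z $ j * cnj (Z $ k))\<^sup>2) b Z"
proof -
  define D where "D i = 1 - Z $ i * cnj (Z $ k)" for i
  have D: "D i \<noteq> 0" for i
    using one_minus_mult_cnj_nonzero[of "Z $ i" "Z $ k"] assms by (auto simp: polydisc_iff D_def)
  have "\<exists>b. has_wirtinger (\<lambda>Z. Z $ i / (1 - Z $ i * cnj (Z $ k))) (axis i (1 / (D i)\<^sup>2)) b Z" for i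
  proof -
    have 1: "has_wirtinger (\<lambda>Z. Z $ i * cnj (Z $ k)) (Z $ i *s cnj_vec 0 + cnj (Z $ k) *s axis i 1)
        (Z $ i *s cnj_vec (axis k 1) + cnj (Z $ k) *s 0) Z"
      by (rule has_wirtinger_mult[OF has_wirtinger_nth has_wirtinger_cnj[OF has_wirtinger_nth]])
    have "((\<lambda>w. 1 / (1 - w)) has_field_derivative 1 / (D i)\<^sup>2) (at (Z $ i * cnj (Z $ k)))"
      using D[of i] unfolding D_def by (auto intro!: derivative_eq_intros simp: power2_eq_square)
    from has_wirtinger_mult[OF has_wirtinger_nth[of i] has_wirtinger_compose_field[OF 1 this]]
    obtain b where "has_wirtinger (\<lambda>Z. Z $ i * (1 / (1 - Z $ i * cnj (Z $ k))))
      (Z $ i *s (1 / (D i)\<^sup>2 *s (Z $ i *s cnj_vec 0 + cnj (Z $ k) *s axis i 1)) + (1 / D i) *s axis i 1) b Z"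
      unfolding D_def by blast
    moreover have "Z $ i *s (1 / (D i)\<^sup>2 *s (Z $ i *s cnj_vec 0 + cnj (Z $ k) *s axis i 1)) + (1 / D i) *s axis i 1 =
      axis i (1 / (D i)\<^sup>2)"
    proof -
      have "Z $ i * (1 / (D i)\<^sup>2 * cnj (Z $ k)) + 1 / D i = 1 / (D i)\<^sup>2"
      proof -
        have "Z $ i * cnj (Z $ k) = 1 - D i" by (simp add: D_def)
        then have "Z $ i * (1 / (D i)\<^sup>2 * cnj (Z $ k)) = (1 - D i) / (D i)\<^sup>2" by (simp add: mult_ac)
        then show ?thesis using D[of i] by (simp add: divide_simps power2_eq_square)
      qed
      then show ?thesis by (auto simp: vec_eq_iff axis_def)
    qed
    ultimately show ?thesis by (auto simp: D_def)
  qed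
  then obtain b where "\<And>i. has_wirtinger (\<lambda>Z. Z $ i / (1 - Z $ i * cnj (Z $ k))) (axis i (1 / (D i)\<^sup>2)) (b i) Z"
    by metis
  then have "has_wirtinger (\<lambda>Z. \<Sum>i\<in>UNIV. Z $ i / (1 - Z $ i * cnj (Z $ k))) (\<Sum>i\<in>UNIV. axis i (1 / (D i)\<^sup>2)) (\<Sum>i\<in>UNIV. b i) Z"
    by (intro has_wirtinger_sum)
  moreover have "(\<Sum>i\<in>UNIV. axis i (1 / (D i)\<^sup>2)) = (\<chi> j. 1 / (1 - Z $ j * cnj (Z $ k))\<^sup>2)"
    by (simp add: vec_eq_iff axis_def D_def)
  ultimately show ?thesis by auto
qed

lemma cpoly_gradient_family:
  fixes f :: "'s \<Rightarrow> complex^'n \<Rightarrow> complex"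
  assumes "\<And>s. cpoly (f s)"
  obtains g where "\<And>s i. cpoly (\<lambda>u. g s u $ i)" "\<And>s u. has_wirtinger (f s) (g s u) 0 u"
proof -
  have "\<exists>g. (\<forall>i. cpoly (\<lambda>u. g u $ i)) \<and> (\<forall>u. has_wirtinger (f s) (g u) 0 u)" for s
    by (rule cpoly_gradient[OF assms[of s]]) (intro exI conjI allI)
  then have "\<forall>s. \<exists>g. (\<forall>i. cpoly (\<lambda>u. g u $ i)) \<and> (\<forall>u. has_wirtinger (f s) (g u) 0 u)" ..
  from choice[OF this] obtain g where
    "\<forall>s. (\<forall>i. cpoly (\<lambda>u. g s u $ i)) \<and> (\<forall>u. has_wirtinger (f s) (g s u) 0 u)" ..
  then show ?thesis by (intro that[of g]) simp_all
qed

lemma cpoly_sym_jacobian: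
  fixes i k :: "'n::{finite,linorder}"
  shows "cpoly (\<lambda>Z. sym_jacobian Z $ i $ k)"
proof -
  obtain g where g: "\<And>k. cpoly (\<lambda>Z. g Z $ k)" "\<And>Z. has_wirtinger (\<lambda>Z. symmetrization Z $ i) (g Z) 0 Z"
    by (fact cpoly_gradient[OF cpoly_symmetrization[of i]])
  have "sym_jacobian Z $ i $ k = g Z $ k" for Z
  proof -
    have "has_wirtinger (\<lambda>Z. symmetrization Z $ i) (\<chi> j. \<Sum>l\<in>UNIV. axis i 1 $ l * sym_jacobian Z $ l $ j) 0 Z"
      by (rule has_wirtinger_holomorphic_compose[OF has_wirtinger_nth has_derivative_symmetrization])
    from has_wirtinger_unique(1)[OF g(2) this] show ?thesis
      by (simp add: axis_def if_distrib[of "\<lambda>x. x * _"] cong: if_cong)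
  qed
  with g(1)[of k] show ?thesis by simp
qed

text \<open>
  Written as \<open>- Ln N\<close> with the polynomial \<open>N\<close> of \<open>szego_denominator\<close>, the logarithm of the
  kernel has explicit first and second derivatives, which are continuous. The fields \<open>E\<close> and \<open>g\<close>
  are its conjugate gradient and the holomorphic derivative of the latter.
\<close>

lemma szego_log_derivatives:
  obtains a E :: "complex^('n::{finite,linorder}) \<Rightarrow> complex^('n::{finite,linorder})"
    and g :: "complex^('n::{finite,linorder}) \<Rightarrow> complex^('n::{finite,linorder})^('n::{finite,linorder})" and b
  where "\<And>u. u \<in> sym_polydisc \<Longrightarrow> has_wirtinger (\<lambda>w. Ln (szego w w)) (a u) (E u) u"
    "\<And>u k. u \<in> sym_polydisc \<Longrightarrow> has_wirtinger (\<lambda>w. E w $ k) (g u $ k) (b u k) u"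
    "continuous_on sym_polydisc g"
proof -
  obtain l m :: "(nat \<Rightarrow> nat) \<Rightarrow> (complex,'n) vec \<Rightarrow> complex" and S :: "(nat \<Rightarrow> nat) set"
    where lm: "\<And>s. cpoly (l s)" "\<And>s. cpoly (m s)"
    and N': "\<And>Z. (\<Sum>s\<in>S. l s (symmetrization Z) * cnj (m s (symmetrization Z))) =
        (\<Prod>i\<in>UNIV. \<Prod>j\<in>UNIV. 1 - Z $ i * cnj (Z $ j))"
    by (fact szego_denominator)
  define N where "N u = (\<Sum>s\<in>S. l s u * cnj (m s u))" for u
  obtain gl where gl: "\<And>s i. cpoly (\<lambda>u. gl s u $ i)" "\<And>s u. has_wirtinger (l s) (gl s u) 0 u"
    by (fact cpoly_gradient_family[OF lm(1)])
  obtain gm where gm: "\<And>s i. cpoly (\<lambda>u. gm s u $ i)" "\<And>s u. has_wirtinger (m s) (gm s u) 0 u"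
    by (fact cpoly_gradient_family[OF lm(2)])
  have N: "has_wirtinger N (\<Sum>s\<in>S. cnj (m s u) *s gl s u) (\<Sum>s\<in>S. l s u *s cnj_vec (gm s u)) u" for u
  proof -
    have "has_wirtinger (\<lambda>u. l s u * cnj (m s u)) (cnj (m s u) *s gl s u) (l s u *s cnj_vec (gm s u)) u" for s
      using has_wirtinger_mult[OF gl(2)[of s u] has_wirtinger_cnj[OF gm(2)[of s u]]] by simp
    then show ?thesis unfolding N_def[abs_def] by (intro has_wirtinger_sum)
  qed
  have Npos: "N u \<notin> \<real>\<^sub>\<le>\<^sub>0" "Ln (szego u u) = - Ln (N u)" if u: "u \<in> sym_polydisc" for u
  proof -
    obtain Z where Z: "Z \<in> polydisc" "u = symmetrization Z" using u by (auto simp: sym_polydisc_def)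
    have N: "N u = exp (log_kernel Z)" unfolding N_def Z(2) N' exp_log_kernel[OF Z(1)] ..
    have "log_kernel Z = of_real (Re (log_kernel Z))"
      using Im_log_kernel[OF Z(1)] by (simp add: complex_eq_iff)
    then have "N u = of_real (exp (Re (log_kernel Z)))" using N by (metis exp_of_real)
    then show "N u \<notin> \<real>\<^sub>\<le>\<^sub>0" by (simp add: complex_nonpos_Reals_iff not_le)
    show "Ln (szego u u) = - Ln (N u)"
      unfolding N using log_szego_symmetrization[OF Z(1)] Im_log_kernel[OF Z(1)] by (simp add: Z(2))
  qed
  have N0: "N u \<noteq> 0" if "u \<in> sym_polydisc" for u
    using Npos(1)[OF that] by auto
  define E where "E u = - 1 / N u *s (\<Sum>s\<in>S. l s u *s cnj_vec (gm s u))" for u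
  define a where "a u = - 1 / N u *s (\<Sum>s\<in>S. cnj (m s u) *s gl s u)" for u
  have LE: "has_wirtinger (\<lambda>w. Ln (szego w w)) (a u) (E u) u" if u: "u \<in> sym_polydisc" for u
  proof -
    have "((\<lambda>x. - Ln x) has_field_derivative - 1 / N u) (at (N u))"
      using Npos(1)[OF u] by (auto intro!: derivative_eq_intros simp: inverse_eq_divide)
    from has_wirtinger_compose_field[OF N this]
    have "has_wirtinger (\<lambda>u. - Ln (N u)) (a u) (E u) u" by (simp only: a_def E_def)
    then show ?thesis
      by (rule has_wirtinger_transform[OF _ open_sym_polydisc u]) (simp add: Npos(2))
  qed
  define h where "h k u = (\<Sum>s\<in>S. l s u * cnj (gm s u $ k))" for k u
  define g where "g u = (\<chi> k. - 1 / N u *s (\<Sum>s\<in>S. cnj (gm s u $ k) *s gl s u) +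
      (h k u / (N u)\<^sup>2) *s (\<Sum>s\<in>S. cnj (m s u) *s gl s u))" for u
  have E_eq: "E u $ k = - 1 / N u * h k u" for u k
    by (simp add: E_def h_def)
  have Eg: "\<exists>b. has_wirtinger (\<lambda>w. E w $ k) (g u $ k) b u" if u: "u \<in> sym_polydisc" for u k
  proof -
    have "\<exists>b. has_wirtinger (\<lambda>u. l s u * cnj (gm s u $ k)) (cnj (gm s u $ k) *s gl s u) b u" for s
    proof -
      obtain d where "\<And>i. cpoly (\<lambda>u. d u $ i)" and d: "\<And>u. has_wirtinger (\<lambda>u. gm s u $ k) (d u) 0 u"
        by (fact cpoly_gradient[OF gm(1)])
      from has_wirtinger_mult[OF gl(2)[of s u] has_wirtinger_cnj[OF d]] show ?thesis by auto
    qed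
    then obtain b where "\<And>s. has_wirtinger (\<lambda>u. l s u * cnj (gm s u $ k)) (cnj (gm s u $ k) *s gl s u) (b s) u"
      by metis
    then have h: "has_wirtinger (h k) (\<Sum>s\<in>S. cnj (gm s u $ k) *s gl s u) (\<Sum>s\<in>S. b s) u"
      unfolding h_def by (intro has_wirtinger_sum)
    have "((\<lambda>x. - 1 / x) has_field_derivative 1 / (N u)\<^sup>2) (at (N u))"
      using N0[OF u] by (auto intro!: derivative_eq_intros simp: power2_eq_square)
    from has_wirtinger_mult[OF has_wirtinger_compose_field[OF N this] h]
    obtain b' where "has_wirtinger (\<lambda>u. - 1 / N u * h k u)
      (- 1 / N u *s (\<Sum>s\<in>S. cnj (gm s u $ k) *s gl s u) + h k u *s (1 / (N u)\<^sup>2 *s (\<Sum>s\<in>S. cnj (m s u) *s gl s u))) b' u"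
      by blast
    moreover have "- 1 / N u *s (\<Sum>s\<in>S. cnj (gm s u $ k) *s gl s u) + h k u *s (1 / (N u)\<^sup>2 *s (\<Sum>s\<in>S. cnj (m s u) *s gl s u)) = g u $ k"
      by (simp add: g_def vec_eq_iff)
    ultimately show ?thesis by (auto simp: E_eq)
  qed
  then obtain b where b: "\<And>u k. u \<in> sym_polydisc \<Longrightarrow> has_wirtinger (\<lambda>w. E w $ k) (g u $ k) (b u k) u"
    by metis
  have "continuous_on sym_polydisc (\<lambda>u. g u $ i $ j)" for i j
  proof -
    have c: "continuous_on sym_polydisc (l s)" "continuous_on sym_polydisc (m s)"
      "continuous_on sym_polydisc (\<lambda>u. gl s u $ k)" "continuous_on sym_polydisc (\<lambda>u. gm s u $ k)" for s k
      by (rule continuous_on_cpoly, fact)+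
    have eq: "g u $ i $ j = - 1 / N u * (\<Sum>s\<in>S. cnj (gm s u $ i) * gl s u $ j) +
        h i u / (N u)\<^sup>2 * (\<Sum>s\<in>S. cnj (m s u) * gl s u $ j)" for u
      by (simp add: g_def)
    have "continuous_on sym_polydisc (\<lambda>u. \<Sum>s\<in>S. cnj (gm s u $ i) * gl s u $ j)"
      "continuous_on sym_polydisc (\<lambda>u. \<Sum>s\<in>S. cnj (m s u) * gl s u $ j)"
      "continuous_on sym_polydisc (h i)" "continuous_on sym_polydisc N"
      unfolding h_def[abs_def] N_def[abs_def]
      by (intro continuous_on_sum continuous_on_mult continuous_on_cnj c)+
    then show ?thesis
      unfolding eq
      by (intro continuous_on_add continuous_on_mult continuous_on_divide continuous_on_power continuous_on_const)
         (use N0 in auto)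
  qed
  then have "continuous_on sym_polydisc (\<lambda>u. \<chi> i j. g u $ i $ j)"
    by (intro continuous_on_vec_lambda)
  then have "continuous_on sym_polydisc g" by simp
  with LE b show ?thesis using that by blast
qed

lemma szego_metric_eq:
  fixes g :: "complex^('n::{finite,linorder}) \<Rightarrow> complex^('n::{finite,linorder})^('n::{finite,linorder})"
  assumes "\<And>u. u \<in> sym_polydisc \<Longrightarrow> has_wirtinger (\<lambda>w. Ln (szego w w)) (a u) (E u) u"
    "\<And>u k. u \<in> sym_polydisc \<Longrightarrow> has_wirtinger (\<lambda>w. E w $ k) (g u $ k) (b u k) u"
    "u \<in> sym_polydisc"
  shows "szego_metric u = g u"
proof -
  have "wirtinger \<beta> (wirtinger_cnj \<alpha> (\<lambda>w. Ln (szego w w))) u = g u $ \<alpha> $ \<beta>" for \<alpha> \<beta>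
  proof (rule has_wirtinger_imp_wirtinger(1))
    show "has_wirtinger (wirtinger_cnj \<alpha> (\<lambda>w. Ln (szego w w))) (g u $ \<alpha>) (b u \<alpha>) u"
      by (rule has_wirtinger_transform[OF assms(2)[OF assms(3)] open_sym_polydisc assms(3)])
         (simp add: has_wirtinger_imp_wirtinger(2)[OF assms(1)])
  qed
  then show ?thesis by (simp add: szego_metric_def vec_eq_iff)
qed

lemma continuous_on_szego_metric: "continuous_on sym_polydisc szego_metric"
proof (rule szego_log_derivatives)
  fix a E :: "(complex,'a) vec \<Rightarrow> (complex,'a) vec" and g b
  assume *: "\<And>u. u \<in> sym_polydisc \<Longrightarrow> has_wirtinger (\<lambda>w. Ln (szego w w)) (a u) (E u) u"
    "\<And>u k. u \<in> sym_polydisc \<Longrightarrow> has_wirtinger (\<lambda>w. E w $ k) (g u $ k) (b u k) u"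
    "continuous_on sym_polydisc g"
  show ?thesis
    using *(3) by (rule continuous_on_eq) (rule szego_metric_eq[OF *(1,2), symmetric])
qed

text \<open>
  The mixed second derivatives of \<open>log S\<close>, computed by the chain rule along the holomorphic
  symmetrization, agree with those of \<open>- log_kernel\<close>.
\<close>

lemma szego_metric_pullback_entry:
  fixes Z :: "complex^('n::{finite,linorder})"
  assumes Z: "Z \<in> polydisc"
  shows "(\<Sum>\<alpha>\<in>UNIV. cnj (sym_jacobian Z $ \<alpha> $ k) *
      (\<Sum>\<beta>\<in>UNIV. szego_metric (symmetrization Z) $ \<alpha> $ \<beta> * sym_jacobian Z $ \<beta> $ j)) = 1 / (1 - Z $ j * cnj (Z $ k))\<^sup>2"
proof (rule szego_log_derivatives)
  fix a E :: "(complex,'n) vec \<Rightarrow> (complex,'n) vec" and g b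
  assume *: "\<And>u. u \<in> sym_polydisc \<Longrightarrow> has_wirtinger (\<lambda>w. Ln (szego w w)) (a u) (E u) u"
    "\<And>u k. u \<in> sym_polydisc \<Longrightarrow> has_wirtinger (\<lambda>w. E w $ k) (g u $ k) (b u k) u"
  define P where "P Y = (\<Sum>\<alpha>\<in>UNIV. E (symmetrization Y) $ \<alpha> * cnj (sym_jacobian Y $ \<alpha> $ k))" for Y
  have P: "(\<Sum>i\<in>UNIV. Y $ i / (1 - Y $ i * cnj (Y $ k))) = P Y" if Y: "Y \<in> polydisc" for Y
  proof -
    have "symmetrization Y \<in> sym_polydisc" using Y by simp
    from has_wirtinger_compose_map[OF *(1)[OF this] has_derivative_symmetrization]
    have 1: "has_wirtinger (\<lambda>Y. Ln (szego (symmetrization Y) (symmetrization Y)))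
      (\<chi> j. \<Sum>i\<in>UNIV. a (symmetrization Y) $ i * sym_jacobian Y $ i $ j)
      (\<chi> j. \<Sum>i\<in>UNIV. E (symmetrization Y) $ i * cnj (sym_jacobian Y $ i $ j)) Y" .
    obtain c where c: "has_wirtinger (\<lambda>Z. - log_kernel Z) c (\<chi> k. \<Sum>i\<in>UNIV. Y $ i / (1 - Y $ i * cnj (Y $ k))) Y"
      using has_wirtinger_log_kernel[OF Y] by blast
    have "has_wirtinger (\<lambda>Y. Ln (szego (symmetrization Y) (symmetrization Y))) c
      (\<chi> k. \<Sum>i\<in>UNIV. Y $ i / (1 - Y $ i * cnj (Y $ k))) Y"
      by (rule has_wirtinger_transform[OF c open_polydisc Y]) (simp add: log_szego_symmetrization)
    from has_wirtinger_unique(2)[OF this 1] show ?thesis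
      by (simp add: vec_eq_iff P_def)
  qed
  obtain b1 where "has_wirtinger (\<lambda>Y. \<Sum>i\<in>UNIV. Y $ i / (1 - Y $ i * cnj (Y $ k))) (\<chi> j. 1 / (1 - Z $ j * cnj (Z $ k))\<^sup>2) b1 Z"
    using has_wirtinger_bergman[OF Z] by blast
  then have 1: "has_wirtinger P (\<chi> j. 1 / (1 - Z $ j * cnj (Z $ k))\<^sup>2) b1 Z"
    by (rule has_wirtinger_transform[OF _ open_polydisc Z]) (simp add: P)
  have "\<exists>b. has_wirtinger (\<lambda>Y. E (symmetrization Y) $ \<alpha> * cnj (sym_jacobian Y $ \<alpha> $ k))
    (cnj (sym_jacobian Z $ \<alpha> $ k) *s (\<chi> j. \<Sum>\<beta>\<in>UNIV. g (symmetrization Z) $ \<alpha> $ \<beta> * sym_jacobian Z $ \<beta> $ j)) b Z" for \<alpha>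
  proof -
    have "symmetrization Z \<in> sym_polydisc" using Z by simp
    from has_wirtinger_compose_map[OF *(2)[OF this] has_derivative_symmetrization]
    have E: "has_wirtinger (\<lambda>Y. E (symmetrization Y) $ \<alpha>)
      (\<chi> j. \<Sum>i\<in>UNIV. g (symmetrization Z) $ \<alpha> $ i * sym_jacobian Z $ i $ j)
      (\<chi> j. \<Sum>i\<in>UNIV. b (symmetrization Z) \<alpha> $ i * cnj (sym_jacobian Z $ i $ j)) Z" .
    obtain d where "\<And>i. cpoly (\<lambda>Y. d Y $ i)" and d: "\<And>Y. has_wirtinger (\<lambda>Y. sym_jacobian Y $ \<alpha> $ k) (d Y) 0 Y"
      by (fact cpoly_gradient[OF cpoly_sym_jacobian[of \<alpha> k]])
    from has_wirtinger_mult[OF E has_wirtinger_cnj[OF d]] show ?thesis by auto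
  qed
  then have "\<forall>\<alpha>. \<exists>b. has_wirtinger (\<lambda>Y. E (symmetrization Y) $ \<alpha> * cnj (sym_jacobian Y $ \<alpha> $ k))
    (cnj (sym_jacobian Z $ \<alpha> $ k) *s (\<chi> j. \<Sum>\<beta>\<in>UNIV. g (symmetrization Z) $ \<alpha> $ \<beta> * sym_jacobian Z $ \<beta> $ j)) b Z" ..
  from choice[OF this] obtain b2 where "\<forall>\<alpha>. has_wirtinger (\<lambda>Y. E (symmetrization Y) $ \<alpha> * cnj (sym_jacobian Y $ \<alpha> $ k))
    (cnj (sym_jacobian Z $ \<alpha> $ k) *s (\<chi> j. \<Sum>\<beta>\<in>UNIV. g (symmetrization Z) $ \<alpha> $ \<beta> * sym_jacobian Z $ \<beta> $ j)) (b2 \<alpha>) Z" ..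
  then have "has_wirtinger P (\<Sum>\<alpha>\<in>UNIV. cnj (sym_jacobian Z $ \<alpha> $ k) *s
     (\<chi> j. \<Sum>\<beta>\<in>UNIV. g (symmetrization Z) $ \<alpha> $ \<beta> * sym_jacobian Z $ \<beta> $ j)) (\<Sum>\<alpha>\<in>UNIV. b2 \<alpha>) Z"
    unfolding P_def[abs_def] by (intro has_wirtinger_sum) simp
  from has_wirtinger_unique(1)[OF this 1]
  have "(\<Sum>\<alpha>\<in>UNIV. cnj (sym_jacobian Z $ \<alpha> $ k) *
      (\<Sum>\<beta>\<in>UNIV. g (symmetrization Z) $ \<alpha> $ \<beta> * sym_jacobian Z $ \<beta> $ j)) = 1 / (1 - Z $ j * cnj (Z $ k))\<^sup>2"
    by (simp add: vec_eq_iff)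
  moreover have "szego_metric (symmetrization Z) = g (symmetrization Z)"
  proof -
    have u: "symmetrization Z \<in> sym_polydisc" using Z by simp
    show ?thesis by (rule szego_metric_eq[OF * u])
  qed
  ultimately show ?thesis by simp
qed

definition sesq :: "complex^'n^'n \<Rightarrow> complex^'n \<Rightarrow> complex^'n \<Rightarrow> complex" where
  "sesq A x y = (\<Sum>i\<in>UNIV. cnj (x $ i) * (A *v y) $ i)"

text \<open>
  Pulled back to the polydisc, the metric is the Gram matrix of the Bergman kernel.
\<close>

lemma sesq_szego_metric:
  fixes Z :: "complex^('n::{finite,linorder})"
  assumes Z: "Z \<in> polydisc"
  shows "sesq (szego_metric (symmetrization Z)) (sym_jacobian Z *v x) (sym_jacobian Z *v y) =
    (\<Sum>j\<in>UNIV. \<Sum>k\<in>UNIV. y $ j * cnj (x $ k) / (1 - Z $ j * cnj (Z $ k))\<^sup>2)"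
proof -
  let ?J = "sym_jacobian Z" and ?g = "szego_metric (symmetrization Z)"
  have "sesq ?g (?J *v x) (?J *v y) =
    (\<Sum>\<alpha>\<in>UNIV. (\<Sum>k\<in>UNIV. cnj (?J $ \<alpha> $ k) * cnj (x $ k)) * (\<Sum>\<beta>\<in>UNIV. ?g $ \<alpha> $ \<beta> * (\<Sum>j\<in>UNIV. ?J $ \<beta> $ j * y $ j)))"
    by (simp add: sesq_def matrix_vector_mult_def)
  also have "\<dots> = (\<Sum>\<alpha>\<in>UNIV. \<Sum>k\<in>UNIV. \<Sum>\<beta>\<in>UNIV. \<Sum>j\<in>UNIV.
      y $ j * cnj (x $ k) * (cnj (?J $ \<alpha> $ k) * (?g $ \<alpha> $ \<beta> * ?J $ \<beta> $ j)))"
    unfolding sum_product by (intro sum.cong refl) (simp add: sum_distrib_left mult_ac)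
  also have "\<dots> = (\<Sum>j\<in>UNIV. \<Sum>k\<in>UNIV. \<Sum>\<alpha>\<in>UNIV. \<Sum>\<beta>\<in>UNIV.
      y $ j * cnj (x $ k) * (cnj (?J $ \<alpha> $ k) * (?g $ \<alpha> $ \<beta> * ?J $ \<beta> $ j)))"
  proof -
    define q where "q \<alpha> k \<beta> j = y $ j * cnj (x $ k) * (cnj (?J $ \<alpha> $ k) * (?g $ \<alpha> $ \<beta> * ?J $ \<beta> $ j))" for \<alpha> k \<beta> j
    have "(\<Sum>\<alpha>\<in>UNIV. \<Sum>k\<in>UNIV. \<Sum>\<beta>\<in>UNIV. \<Sum>j\<in>UNIV. q \<alpha> k \<beta> j) = (\<Sum>k\<in>UNIV. \<Sum>\<alpha>\<in>UNIV. \<Sum>\<beta>\<in>UNIV. \<Sum>j\<in>UNIV. q \<alpha> k \<beta> j)"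
      by (rule sum.swap)
    also have "\<dots> = (\<Sum>k\<in>UNIV. \<Sum>\<alpha>\<in>UNIV. \<Sum>j\<in>UNIV. \<Sum>\<beta>\<in>UNIV. q \<alpha> k \<beta> j)"
      by (rule sum.cong[OF refl], rule sum.cong[OF refl], rule sum.swap)
    also have "\<dots> = (\<Sum>k\<in>UNIV. \<Sum>j\<in>UNIV. \<Sum>\<alpha>\<in>UNIV. \<Sum>\<beta>\<in>UNIV. q \<alpha> k \<beta> j)"
      by (rule sum.cong[OF refl], rule sum.swap)
    also have "\<dots> = (\<Sum>j\<in>UNIV. \<Sum>k\<in>UNIV. \<Sum>\<alpha>\<in>UNIV. \<Sum>\<beta>\<in>UNIV. q \<alpha> k \<beta> j)"
      by (rule sum.swap)
    finally show ?thesis unfolding q_def .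
  qed
  also have "\<dots> = (\<Sum>j\<in>UNIV. \<Sum>k\<in>UNIV. y $ j * cnj (x $ k) *
      (\<Sum>\<alpha>\<in>UNIV. cnj (?J $ \<alpha> $ k) * (\<Sum>\<beta>\<in>UNIV. ?g $ \<alpha> $ \<beta> * ?J $ \<beta> $ j)))"
    by (simp add: sum_distrib_left)
  also have "\<dots> = (\<Sum>j\<in>UNIV. \<Sum>k\<in>UNIV. y $ j * cnj (x $ k) / (1 - Z $ j * cnj (Z $ k))\<^sup>2)"
    unfolding szego_metric_pullback_entry[OF Z] by simp
  finally show ?thesis .
qed

section \<open>Maps induced by Blaschke products\<close>

text \<open>
  A product over all roots is symmetric, hence a polynomial in \<open>u\<close>; the symmetry of the
  resultant makes this explicit.
\<close>

lemma cpoly_prod_over_roots: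
  fixes R :: "complex poly"
  shows "cpoly (\<lambda>u :: complex^('n::{finite,linorder}). \<Prod>x\<in>#proots (root_poly u). poly R x)"
proof -
  have "(\<Prod>x\<in>#proots (root_poly u). poly R x) =
    lead_coeff R ^ CARD('n) * (\<Prod>y\<in>#proots R. (- 1) ^ CARD('n) * poly (root_poly u) y)" for u :: "(complex,'n) vec"
    by (rule prod_mset_poly_roots_swap) (simp_all add: degree_root_poly lead_coeff_root_poly)
  then show ?thesis
    by (simp only:) (intro cpoly_mult cpoly_const cpoly_prod_mset cpoly_poly_root_poly)
qed

lemma prod_over_roots_symmetrization:
  fixes Z :: "complex^('n::{finite,linorder})"
  shows "(\<Prod>x\<in>#proots (root_poly (symmetrization Z)). f x) = (\<Prod>i\<in>UNIV. f (Z $ i))"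
  by (simp add: proots_root_poly_symmetrization image_mset.compositionality o_def prod_unfold_prod_mset)

text \<open>
  For \<open>b = p / q\<close>, the products \<open>G t\<close> of the values of \<open>q + t p\<close> at the roots are polynomials in
  \<open>u\<close>, and \<open>G t / G 0\<close> is the generating polynomial in \<open>t\<close> of the elementary symmetric functions
  of the image points. Its coefficients are recovered by interpolation in \<open>t\<close>.
\<close>

lemma induced_map_rational:
  fixes F :: "complex^('n::{finite,linorder}) \<Rightarrow> complex^('n::{finite,linorder})"
  assumes as: "\<forall>a\<in>set as. norm a < 1" and F: "induced_by F (blaschke c as)"
  obtains N Q where "\<And>i. cpoly (N i)" "cpoly Q" "\<And>u. u \<in> sym_polydisc \<Longrightarrow> Q u \<noteq> 0"
    "\<And>u i. u \<in> sym_polydisc \<Longrightarrow> F u $ i = N i u / Q u"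
proof -
  let ?n = "CARD('n)" and ?B = "blaschke c as"
  define p q where "p = smult c (\<Prod>a\<leftarrow>as. [:- a, 1:])" and "q = (\<Prod>a\<leftarrow>as. [:1, - cnj a:])"
  have pq: "?B z = poly p z / poly q z" for z
    by (simp add: p_def q_def blaschke_eq_quotient poly_blaschke_numerator poly_blaschke_denominator)
  have q0: "poly q z \<noteq> 0" if "norm z < 1" for z
    using blaschke_denominator_nonzero[OF as that] by (simp add: q_def poly_blaschke_denominator)
  obtain l :: "nat \<Rightarrow> complex poly" where
    l: "\<And>f. degree f \<le> ?n \<Longrightarrow> f = (\<Sum>j\<le>?n. smult (poly f (of_nat j)) (l j))"
    using lagrange_basis by metis
  define G where "G t u = (\<Prod>x\<in>#proots (root_poly u). poly (q + smult t p) x)" for t and u :: "(complex,'n) vec"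
  define N where "N i u = (\<Sum>j\<le>?n. G (of_nat j) u * coeff (l j) (coord_number i))" for i :: 'n and u
  have G: "cpoly (G t)" for t unfolding G_def by (rule cpoly_prod_over_roots)
  have "cpoly (N i)" for i
    unfolding N_def by (intro cpoly_sum cpoly_mult cpoly_const G)
  moreover have G0: "G 0 (symmetrization Z) = (\<Prod>i\<in>UNIV. poly q (Z $ i))" for Z
    by (simp add: G_def prod_over_roots_symmetrization)
  have "G 0 u \<noteq> 0" if "u \<in> sym_polydisc" for u
    using that q0 by (auto simp: sym_polydisc_def G0 polydisc_iff)
  moreover have "F u $ i = N i u / G 0 u" if u: "u \<in> sym_polydisc" for u i
  proof -
    obtain Z where Z: "Z \<in> polydisc" "u = symmetrization Z" using u by (auto simp: sym_polydisc_def)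
    define W where "W = (\<chi> i. ?B (Z $ i))"
    define f where "f = (\<Sum>k\<le>?n. monom (G 0 u * esymm k W) k)"
    have f: "poly f t = G t u" for t
    proof -
      have "G t u = (\<Prod>i\<in>UNIV. poly q (Z $ i) * (1 - W $ i * (- t)))"
        unfolding G_def Z(2) prod_over_roots_symmetrization
        by (rule prod.cong) (use q0 Z(1) in \<open>auto simp: W_def pq polydisc_iff field_simps\<close>)
      also have "\<dots> = G 0 u * (\<Prod>i\<in>UNIV. 1 - W $ i * (- t))"
        by (simp only: prod.distrib G0 Z(2))
      also have "\<dots> = G 0 u * (\<Sum>k\<le>?n. esymm k W * t ^ k)"
        by (simp only: prod_one_minus_esymm minus_minus)
      finally show ?thesis by (simp add: f_def poly_sum poly_monom sum_distrib_left mult.assoc)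
    qed
    have deg: "degree f \<le> ?n"
      unfolding f_def by (intro degree_sum_le order_trans[OF degree_monom_le]) auto
    have "coeff f (coord_number i) = G 0 u * esymm (coord_number i) W"
      using coord_number_bounds(2)[of i] by (simp add: f_def coeff_sum)
    also have "coeff f (coord_number i) = N i u"
      by (subst l[OF deg]) (simp add: coeff_sum f N_def)
    finally have "N i u = G 0 u * esymm (coord_number i) W" .
    moreover have "F u = symmetrization W" using F Z by (simp add: induced_by_def W_def)
    ultimately show ?thesis
      using \<open>\<And>u. u \<in> sym_polydisc \<Longrightarrow> G 0 u \<noteq> 0\<close>[OF u] by (simp add: symmetrization_def coord_number_def)
  qed
  ultimately show ?thesis using G that[of N "G 0"] by blast
qed

lemma induced_map_derivative:
  fixes F :: "complex^('n::{finite,linorder}) \<Rightarrow> complex^('n::{finite,linorder})"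
  assumes as: "\<forall>a\<in>set as. norm a < 1" and F: "induced_by F (blaschke c as)"
  shows "u \<in> sym_polydisc \<Longrightarrow> (F has_derivative (\<lambda>h. complex_jacobian F u *v h)) (at u)"
    "continuous_on sym_polydisc (complex_jacobian F)"
proof -
  obtain N Q where NQ: "\<And>i. cpoly (N i)" "cpoly Q" and Q0: "\<And>u. u \<in> sym_polydisc \<Longrightarrow> Q u \<noteq> 0"
    and eq: "\<And>u i. u \<in> sym_polydisc \<Longrightarrow> F u $ i = N i u / Q u"
    by (rule induced_map_rational[OF as F]) (rule that)
  obtain gN where gN: "\<And>s i. cpoly (\<lambda>u. gN s u $ i)" "\<And>s u. has_wirtinger (N s) (gN s u) 0 u"
    by (fact cpoly_gradient_family[OF NQ(1)])
  obtain gQ where gQ: "\<And>i. cpoly (\<lambda>u. gQ u $ i)" "\<And>u. has_wirtinger Q (gQ u) 0 u"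
    by (fact cpoly_gradient[OF NQ(2)])
  define A where "A u = (\<chi> i j. N i u * (- 1 / (Q u)\<^sup>2 * gQ u $ j) + 1 / Q u * gN i u $ j)" for u
  have deriv: "(F has_derivative (\<lambda>h. A u *v h)) (at u)" if u: "u \<in> sym_polydisc" for u
  proof -
    have "has_wirtinger (\<lambda>u. F u $ i) (\<chi> j. N i u * (- 1 / (Q u)\<^sup>2 * gQ u $ j) + 1 / Q u * gN i u $ j) 0 u" for i
    proof -
      have "((\<lambda>x. 1 / x) has_field_derivative - 1 / (Q u)\<^sup>2) (at (Q u))"
        using Q0[OF u] by (auto intro!: derivative_eq_intros simp: power2_eq_square)
      from has_wirtinger_mult[OF gN(2)[of i u] has_wirtinger_compose_field[OF gQ(2) this]]
      have "has_wirtinger (\<lambda>u. N i u * (1 / Q u)) (\<chi> j. N i u * (- 1 / (Q u)\<^sup>2 * gQ u $ j) + 1 / Q u * gN i u $ j) 0 u"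
        by (simp add: plus_vec_def vector_scalar_mult_def zero_vec_def)
      then show ?thesis
        by (rule has_wirtinger_transform[OF _ open_sym_polydisc u]) (simp add: eq)
    qed
    from has_derivative_map_of_has_wirtinger[OF this] show ?thesis by (simp add: A_def)
  qed
  have jac: "complex_jacobian F u = A u" if "u \<in> sym_polydisc" for u
    by (rule has_derivative_imp_complex_jacobian[OF deriv[OF that]])
  show "(F has_derivative (\<lambda>h. complex_jacobian F u *v h)) (at u)" if "u \<in> sym_polydisc" for u
    using deriv[OF that] jac[OF that] by simp
  have "continuous_on sym_polydisc (\<lambda>u. A u $ i $ j)" for i j
  proof -
    have "continuous_on sym_polydisc (N i)" "continuous_on sym_polydisc Q"
      "continuous_on sym_polydisc (\<lambda>u. gN i u $ j)" "continuous_on sym_polydisc (\<lambda>u. gQ u $ j)"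
      by (rule continuous_on_cpoly, fact)+
    then have "continuous_on sym_polydisc (\<lambda>u. N i u * (- 1 / (Q u)\<^sup>2 * gQ u $ j) + 1 / Q u * gN i u $ j)"
      by (intro continuous_on_add continuous_on_mult continuous_on_divide continuous_on_power continuous_on_const)
         (use Q0 in auto)
    then show ?thesis by (simp add: A_def)
  qed
  then have "continuous_on sym_polydisc (\<lambda>u. \<chi> i j. A u $ i $ j)"
    by (intro continuous_on_vec_lambda)
  then have "continuous_on sym_polydisc A" by simp
  then show "continuous_on sym_polydisc (complex_jacobian F)"
    by (rule continuous_on_eq) (simp add: jac)
qed

lemma continuous_on_induced_map:
  fixes F :: "complex^('n::{finite,linorder}) \<Rightarrow> complex^('n::{finite,linorder})"
  assumes "\<forall>a\<in>set as. norm a < 1" "induced_by F (blaschke c as)"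
  shows "continuous_on sym_polydisc F"
proof (intro continuous_at_imp_continuous_on ballI)
  fix u :: "(complex,'n) vec" assume "u \<in> sym_polydisc"
  from has_derivative_continuous[OF induced_map_derivative(1)[OF assms this]] show "isCont F u" .
qed

text \<open>
  Both sides differentiate \<open>Z \<mapsto> F (symmetrization Z) = symmetrization (b Z)\<close>.
\<close>

lemma induced_map_chain_rule:
  fixes F :: "complex^('n::{finite,linorder}) \<Rightarrow> complex^('n::{finite,linorder})"
  assumes c: "norm c = 1" and as: "\<forall>a\<in>set as. norm a < 1" and F: "induced_by F (blaschke c as)" and Z: "Z \<in> polydisc"
  shows "complex_jacobian F (symmetrization Z) *v (sym_jacobian Z *v h) =
    sym_jacobian (\<chi> i. blaschke c as (Z $ i)) *v (\<chi> i. deriv (blaschke c as) (Z $ i) * h $ i)"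
proof -
  let ?B = "blaschke c as"
  have "symmetrization Z \<in> sym_polydisc" using Z by simp
  from has_derivative_compose[OF has_derivative_symmetrization induced_map_derivative(1)[OF as F this]]
  have 1: "((\<lambda>Z. F (symmetrization Z)) has_derivative
     (\<lambda>h. complex_jacobian F (symmetrization Z) *v (sym_jacobian Z *v h))) (at Z)" .
  have "((\<lambda>Z. \<chi> i. ?B (Z $ i)) has_derivative (\<lambda>h. \<chi> i. deriv ?B (Z $ i) * h $ i)) (at Z)"
  proof (rule has_derivative_vecI)
    fix i
    have "((\<lambda>Z. Z $ i) has_derivative (\<lambda>h. h $ i)) (at Z)"
      by (rule bounded_linear.has_derivative[OF bounded_linear_vec_nth has_derivative_ident])
    moreover have "(?B has_derivative (\<lambda>x. deriv ?B (Z $ i) * x)) (at (Z $ i))"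
      using has_field_derivative_blaschke[OF c as, of "Z $ i"] Z
      by (simp add: polydisc_iff has_field_derivative_def)
    ultimately show "((\<lambda>Z. (\<chi> i. ?B (Z $ i)) $ i) has_derivative (\<lambda>h. (\<chi> i. deriv ?B (Z $ i) * h $ i) $ i)) (at Z)"
      using has_derivative_compose[of "\<lambda>Z. Z $ i" "\<lambda>h. h $ i" Z UNIV ?B] by simp
  qed
  from has_derivative_compose[OF this has_derivative_symmetrization]
  have "((\<lambda>Z. symmetrization (\<chi> i. ?B (Z $ i))) has_derivative
     (\<lambda>h. sym_jacobian (\<chi> i. ?B (Z $ i)) *v (\<chi> i. deriv ?B (Z $ i) * h $ i))) (at Z)" .
  from has_derivative_transform_within_open[OF this open_polydisc Z, of "\<lambda>Z. F (symmetrization Z)"]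
  have "((\<lambda>Z. F (symmetrization Z)) has_derivative
     (\<lambda>h. sym_jacobian (\<chi> i. ?B (Z $ i)) *v (\<chi> i. deriv ?B (Z $ i) * h $ i))) (at Z)"
    using F by (simp add: induced_by_def)
  from has_derivative_unique[OF 1 this] show ?thesis by metis
qed

lemma blaschke_map_in_polydisc:
  assumes "norm c = 1" "\<forall>a\<in>set as. norm a < 1" "as \<noteq> []" "Z \<in> polydisc"
  shows "(\<chi> i. blaschke c as (Z $ i)) \<in> polydisc"
  using norm_blaschke_less_1[OF assms(1-3)] assms(4) by (simp add: polydisc_iff)

lemma proper_self_map_if_induced:
  fixes F :: "complex^('n::{finite,linorder}) \<Rightarrow> complex^('n::{finite,linorder})"
  assumes c: "norm c = 1" "\<forall>a\<in>set as. norm a < 1" "as \<noteq> []" and F: "induced_by F (blaschke c as)"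
  shows "proper_holomorphic_self_map F"
  unfolding proper_holomorphic_self_map_def
proof (intro conjI allI impI)
  let ?B = "blaschke c as"
  show img: "F ` sym_polydisc \<subseteq> sym_polydisc"
    using F blaschke_map_in_polydisc[OF c] by (auto simp: sym_polydisc_def induced_by_def)
  show "F holomorphic_map_on sym_polydisc"
    unfolding holomorphic_map_on_def
    using induced_map_derivative(1)[OF c(2) F] has_derivative_at_withinI by blast
  fix K assume K: "compact K \<and> K \<subseteq> (sym_polydisc :: (complex,'n) vec set)"
  then obtain r where r: "r < 1" "symmetrization -` K \<subseteq> closed_polydisc r"
    using compact_subset_sym_polydisc[of K] by metis
  obtain s where s: "s < 1" "\<And>z. norm z < 1 \<Longrightarrow> norm (?B z) \<le> r \<Longrightarrow> norm z \<le> s"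
    using blaschke_proper[OF c(1,2) r(1)] by metis
  define C where "C = symmetrization ` (closed_polydisc s :: (complex,'n) vec set)"
  have "compact C" "C \<subseteq> sym_polydisc"
    unfolding C_def
    by (rule compact_symmetrization_closed_polydisc, rule symmetrization_closed_polydisc_subset[OF s(1)])
  have "{u \<in> sym_polydisc. F u \<in> K} = C \<inter> (C \<inter> F -` K)"
  proof (intro equalityI subsetI)
    fix u assume u: "u \<in> {u \<in> sym_polydisc. F u \<in> K}"
    then obtain Z where Z: "Z \<in> polydisc" "u = symmetrization Z" by (auto simp: sym_polydisc_def)
    have "(\<chi> i. ?B (Z $ i)) \<in> closed_polydisc r"
      using u Z F r(2) by (auto simp: induced_by_def)
    then have "Z \<in> closed_polydisc s"
      using Z(1) s(2) by (simp add: closed_polydisc_def polydisc_iff)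
    with u Z show "u \<in> C \<inter> (C \<inter> F -` K)" by (auto simp: C_def)
  qed (use \<open>C \<subseteq> sym_polydisc\<close> in auto)
  moreover have "closed (C \<inter> F -` K)"
  proof (rule continuous_closed_preimage)
    show "continuous_on C F"
      using continuous_on_induced_map[OF c(2) F] \<open>C \<subseteq> sym_polydisc\<close> continuous_on_subset by blast
  qed (use K \<open>compact C\<close> in \<open>auto intro: compact_imp_closed\<close>)
  then have "compact (C \<inter> (C \<inter> F -` K))"
    using \<open>compact C\<close> by (rule compact_Int_closed[rotated])
  ultimately show "compact {u \<in> sym_polydisc. F u \<in> K}"
    by (simp only:)
qed

section \<open>The degree of an induced map\<close>

lemma det_nonzero_iff_injective:
  fixes A :: "complex^'n^'n"
  shows "det A \<noteq> 0 \<longleftrightarrow> (\<forall>x. A *v x = 0 \<longrightarrow> x = 0)"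
  by (simp add: invertible_det_nz[symmetric] invertible_left_inverse matrix_left_invertible_ker)

lemma sym_jacobian_surj:
  fixes Z :: "complex^('n::{finite,linorder})"
  assumes "inj (\<lambda>i. Z $ i)"
  obtains h where "sym_jacobian Z *v h = x"
proof -
  have "\<exists>B. B ** sym_jacobian Z = mat 1"
    unfolding matrix_left_invertible_ker using sym_jacobian_injective[OF assms] by blast
  then have "invertible (sym_jacobian Z)" by (simp add: invertible_left_inverse)
  then obtain B where "sym_jacobian Z ** B = mat 1" unfolding invertible_def by blast
  then have "sym_jacobian Z *v (B *v x) = x"
    by (simp add: matrix_vector_mul_assoc matrix_vector_mul_lid)
  then show ?thesis using that by blast
qed

context
  fixes F :: "complex^('n::{finite,linorder}) \<Rightarrow> complex^('n::{finite,linorder})" and c :: complex and as :: "complex list"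
  assumes c: "norm c = 1" and as: "\<forall>a\<in>set as. norm a < 1" and ne: "as \<noteq> []" and F: "induced_by F (blaschke c as)"
begin

lemma ex_blaschke_preimage: "norm w < 1 \<Longrightarrow> \<exists>z. norm z < 1 \<and> blaschke c as z = w"
  by (rule blaschke_surj[OF c as _ ne]) auto

text \<open>
  A critical point \<open>z\<close> of \<open>b\<close> above \<open>W $ i\<close> can serve as the \<open>i\<close>-th coordinate of a preimage,
  and moving it changes the image only to second order.
\<close>

lemma regular_value_deriv_nonzero:
  fixes W :: "complex^('n::{finite,linorder})"
  assumes reg: "regular_value F (symmetrization W)" and W: "W \<in> polydisc"
    and z: "norm z < 1" "blaschke c as z = W $ i"
  shows "deriv (blaschke c as) z \<noteq> 0"
proof
  assume d0: "deriv (blaschke c as) z = 0"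
  have "\<forall>j. \<exists>z. norm z < 1 \<and> blaschke c as z = W $ j" using W by (auto intro: ex_blaschke_preimage simp: polydisc_iff)
  from choice[OF this] obtain f where f: "\<And>j. norm (f j) < 1" "\<And>j. blaschke c as (f j) = W $ j" by blast
  define Z where "Z = upd_coord (\<chi> j. f j) i z"
  have Z: "Z \<in> polydisc" using f(1) z(1) by (simp add: Z_def polydisc_iff)
  have BZ: "(\<chi> j. blaschke c as (Z $ j)) = W" using f(2) z(2) by (simp add: Z_def vec_eq_iff)
  have "F (symmetrization Z) = symmetrization W" using F Z BZ by (simp add: induced_by_def)
  with reg Z have "det (complex_jacobian F (symmetrization Z)) \<noteq> 0"
    by (simp add: regular_value_def)
  moreover have "complex_jacobian F (symmetrization Z) *v (sym_jacobian Z *v axis i 1) = 0"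
  proof -
    have "(\<chi> j. deriv (blaschke c as) (Z $ j) * axis i 1 $ j) = 0"
      using d0 by (simp add: vec_eq_iff Z_def axis_def)
    then show ?thesis using induced_map_chain_rule[OF c as F Z, of "axis i 1"] by simp
  qed
  ultimately show False
    using sym_jacobian_axis_nonzero[of Z i] by (auto simp: det_nonzero_iff_injective)
qed

lemma card_fibre_regular:
  fixes W :: "complex^('n::{finite,linorder})"
  assumes reg: "regular_value F (symmetrization W)" and W: "W \<in> polydisc"
  shows "card {z. norm z < 1 \<and> blaschke c as z = W $ i} = length as" "finite {z. norm z < 1 \<and> blaschke c as z = W $ i}"
proof -
  have w: "norm (W $ i) < 1" using W by (simp add: polydisc_iff)
  have "deriv (blaschke c as) z \<noteq> 0" if "norm z < 1" "blaschke c as z = W $ i" for z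
    using regular_value_deriv_nonzero[OF reg W that] .
  then show "card {z. norm z < 1 \<and> blaschke c as z = W $ i} = length as" "finite {z. norm z < 1 \<and> blaschke c as z = W $ i}"
    using card_blaschke_fibre[OF c as w] by blast+
qed

text \<open>
  Suppose that the coordinates \<open>i\<close> and \<open>j\<close> of \<open>W\<close> agree, and choose for them two different
  preimages under \<open>b\<close>. Both can be moved such that the two image points separate in opposite
  directions at the same speed. This does not change the symmetrization to first order, so \<open>F\<close>
  is singular at the chosen point.
\<close>

lemma regular_value_inj:
  fixes W :: "complex^('n::{finite,linorder})"
  assumes reg: "regular_value F (symmetrization W)" and W: "W \<in> polydisc"
    and d: "length as \<ge> 2"
  shows "inj (\<lambda>i. W $ i)"
proof (rule injI, rule ccontr)
  fix i j assume ij: "W $ i = W $ j" "i \<noteq> j"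
  have "card {z. norm z < 1 \<and> blaschke c as z = W $ i} \<ge> 2" using card_fibre_regular(1)[OF reg W] d by simp
  then obtain T where "T \<subseteq> {z. norm z < 1 \<and> blaschke c as z = W $ i}" "card T = 2" "finite T"
    by (rule obtain_subset_with_card_n)
  then obtain z1 z2 where z: "z1 \<noteq> z2" "norm z1 < 1" "blaschke c as z1 = W $ i" "norm z2 < 1" "blaschke c as z2 = W $ i"
    by (auto simp: card_2_iff)
  have d: "deriv (blaschke c as) z1 \<noteq> 0" "deriv (blaschke c as) z2 \<noteq> 0"
    using regular_value_deriv_nonzero[OF reg W, of z1 i] regular_value_deriv_nonzero[OF reg W, of z2 i] z by auto
  have "\<forall>j. \<exists>z. norm z < 1 \<and> blaschke c as z = W $ j" using W by (auto intro: ex_blaschke_preimage simp: polydisc_iff)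
  from choice[OF this] obtain f where f: "\<And>j. norm (f j) < 1" "\<And>j. blaschke c as (f j) = W $ j" by blast
  define Z where "Z = upd_coord (upd_coord (\<chi> j. f j) i z1) j z2"
  have Z: "Z \<in> polydisc" using f(1) z by (simp add: Z_def polydisc_iff)
  have Zij: "Z $ i = z1" "Z $ j = z2" using ij by (auto simp: Z_def)
  have BZ: "(\<chi> j. blaschke c as (Z $ j)) = W" using f(2) z ij by (auto simp: Z_def vec_eq_iff)
  have "F (symmetrization Z) = symmetrization W" using F Z BZ by (simp add: induced_by_def)
  with reg Z have det: "det (complex_jacobian F (symmetrization Z)) \<noteq> 0"
    by (simp add: regular_value_def)
  define h where "h = axis i (deriv (blaschke c as) z2) + axis j (- deriv (blaschke c as) z1)"
  define e where "e = deriv (blaschke c as) z1 * deriv (blaschke c as) z2"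
  have "(\<chi> k. deriv (blaschke c as) (Z $ k) * h $ k) = axis i e - axis j e"
    using ij(2) Zij by (auto simp: vec_eq_iff h_def axis_def e_def)
  then have "complex_jacobian F (symmetrization Z) *v (sym_jacobian Z *v h) = 0"
    using induced_map_chain_rule[OF c as F Z, of h] BZ sym_jacobian_axis_eq[OF ij(1), of e]
    by (simp add: matrix_vector_mult_diff_distrib)
  moreover have "sym_jacobian Z *v h \<noteq> 0"
    unfolding h_def by (rule sym_jacobian_two_axes_nonzero) (use Zij z(1) d in auto)
  ultimately show False using det by (auto simp: det_nonzero_iff_injective)
qed

text \<open>
  The points of the fibre correspond to the choices of a preimage under \<open>b\<close> for each coordinate
  of \<open>W\<close>. Different choices have different symmetrizations: for degree at least \<open>2\<close> because the
  coordinates of \<open>W\<close> are distinct, for degree \<open>1\<close> because there is only one choice.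
\<close>

lemma card_regular_fibre:
  assumes reg: "regular_value F w"
  shows "card {u \<in> sym_polydisc. F u = w} = length as ^ CARD('n)"
proof -
  obtain W where W: "W \<in> polydisc" "w = symmetrization W"
    using reg by (auto simp: regular_value_def sym_polydisc_def)
  note reg = reg[unfolded W(2)]
  define S where "S i = {z. norm z < 1 \<and> blaschke c as z = W $ i}" for i
  define X where "X = {Z :: (complex,'n) vec. \<forall>i. Z $ i \<in> S i}"
  have S: "card (S i) = length as" "finite (S i)" for i
    unfolding S_def by (rule card_fibre_regular[OF reg W(1)])+
  have "{u \<in> sym_polydisc. F u = w} = symmetrization ` X"
  proof (intro equalityI subsetI)
    fix u assume "u \<in> {u \<in> sym_polydisc. F u = w}"
    then obtain Z where Z: "Z \<in> polydisc" "u = symmetrization Z" "symmetrization (\<chi> i. blaschke c as (Z $ i)) = symmetrization W"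
      using F by (auto simp: sym_polydisc_def induced_by_def W(2))
    then obtain \<sigma> where \<sigma>: "\<sigma> permutes UNIV" "W = (\<chi> i. (\<chi> i. blaschke c as (Z $ i)) $ \<sigma> i)"
      by (auto simp: symmetrization_eq_iff)
    have "(\<chi> i. Z $ \<sigma> i) \<in> X" using Z(1) by (auto simp: X_def S_def \<sigma>(2) polydisc_iff)
    then show "u \<in> symmetrization ` X"
      using symmetrization_permute[OF \<sigma>(1), of Z] Z(2) by (metis image_eqI)
  next
    fix u assume "u \<in> symmetrization ` X"
    then obtain Z where Z: "u = symmetrization Z" "\<And>i. norm (Z $ i) < 1" "\<And>i. blaschke c as (Z $ i) = W $ i"
      by (auto simp: X_def S_def)
    then have "Z \<in> polydisc" "(\<chi> i. blaschke c as (Z $ i)) = W" by (auto simp: polydisc_iff vec_eq_iff)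
    then show "u \<in> {u \<in> sym_polydisc. F u = w}" using F Z(1) by (simp add: induced_by_def W(2))
  qed
  moreover have "inj_on symmetrization X"
  proof (rule inj_onI)
    fix Z Y assume ZY: "Z \<in> X" "Y \<in> X" "symmetrization Z = symmetrization Y"
    show "Z = Y"
    proof (cases "length as \<ge> 2")
      case True
      obtain \<sigma> where \<sigma>: "\<sigma> permutes UNIV" "Y = (\<chi> i. Z $ \<sigma> i)" using ZY(3) by (auto simp: symmetrization_eq_iff)
      have "W $ i = W $ \<sigma> i" for i
        using ZY(1,2) by (auto simp: X_def S_def \<sigma>(2))
      then have "\<sigma> i = i" for i
        using regular_value_inj[OF reg W(1) True] by (metis injD)
      then show ?thesis by (simp add: \<sigma>(2) vec_eq_iff)
    next
      case False
      moreover have "length as > 0" using ne by simp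
      ultimately have "length as = 1" by linarith
      then have "card (S i) = 1" for i using S(1) by simp
      then have "\<exists>x. S i = {x}" for i by (simp add: card_1_singleton_iff)
      then show ?thesis using ZY(1,2) by (auto simp: X_def vec_eq_iff) (metis singletonD)
    qed
  qed
  moreover have "card X = length as ^ CARD('n)"
  proof -
    have "bij_betw (\<lambda>f. \<chi> i. f i) (Pi\<^sub>E UNIV S) X"
    proof (rule bij_betwI[where g="\<lambda>Z i. Z $ i"])
      show "(\<lambda>f. \<chi> i. f i) \<in> Pi\<^sub>E UNIV S \<rightarrow> X" by (auto simp: X_def)
      show "(\<lambda>Z i. Z $ i) \<in> X \<rightarrow> Pi\<^sub>E UNIV S" by (auto simp: X_def)
    qed auto
    then have "card X = card (Pi\<^sub>E UNIV S)" by (simp add: bij_betw_same_card)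
    also have "\<dots> = length as ^ CARD('n)" by (simp add: card_PiE S)
    finally show ?thesis .
  qed
  ultimately show ?thesis by (simp add: card_image)
qed

text \<open>
  Distinct coordinates outside the countable set of critical values of \<open>b\<close> will do.
\<close>

lemma ex_regular_value: "\<exists>w. regular_value F w"
proof -
  define crit where "crit = {z. norm z < 1 \<and> deriv (blaschke c as) z = 0}"
  have "countable (blaschke c as ` crit)"
    unfolding crit_def by (intro countable_image countable_blaschke_critical_points[OF c as ne])
  moreover have "uncountable (ball (0::complex) 1)" by (rule uncountable_ball) simp
  ultimately have "uncountable (ball 0 1 - blaschke c as ` crit)" by (rule uncountable_minus_countable[rotated])
  then have "infinite (ball 0 1 - blaschke c as ` crit)" using countable_finite by blast
  then obtain T where T: "finite T" "card T = CARD('n)" "T \<subseteq> ball 0 1 - blaschke c as ` crit"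
    using infinite_arbitrarily_large by metis
  then obtain f where f: "bij_betw f (UNIV :: 'n set) T"
    using finite_same_card_bij[of "UNIV :: 'n set" T] by auto
  define W where "W = (\<chi> i. f i)"
  have fT: "f i \<in> ball 0 1 - blaschke c as ` crit" for i
  proof -
    have "f i \<in> T" using f by (auto simp: bij_betw_def)
    with T(3) show ?thesis by (rule subsetD)
  qed
  have injf: "f i = f j \<Longrightarrow> i = j" for i j
    using f by (auto simp: bij_betw_def inj_def)
  have "norm (f i) < 1" for i using fT[of i] by simp
  then have W: "W \<in> polydisc" by (simp add: W_def polydisc_iff)
  have "regular_value F (symmetrization W)"
    unfolding regular_value_def
  proof (intro conjI ballI impI)
    show "symmetrization W \<in> sym_polydisc" using W by simp
    fix u assume u: "u \<in> sym_polydisc" "F u = symmetrization W"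
    then obtain Z where Z: "Z \<in> polydisc" "u = symmetrization Z" "symmetrization (\<chi> i. blaschke c as (Z $ i)) = symmetrization W"
      using F by (auto simp: sym_polydisc_def induced_by_def)
    then obtain \<sigma> where \<sigma>: "\<sigma> permutes UNIV" "(\<chi> i. blaschke c as (Z $ i)) = (\<chi> i. W $ \<sigma> i)"
      using symmetrization_eq_iff[of W "\<chi> i. blaschke c as (Z $ i)"] by metis
    have BZ: "blaschke c as (Z $ i) = f (\<sigma> i)" for i
      using \<sigma>(2) by (simp add: vec_eq_iff W_def)
    have \<sigma>inj: "\<sigma> i = \<sigma> j \<Longrightarrow> i = j" for i j
      using permutes_inj[OF \<sigma>(1)] by (auto simp: inj_def)
    have injBZ: "inj (\<lambda>i. (\<chi> i. blaschke c as (Z $ i)) $ i)"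
      by (rule injI) (use BZ injf \<sigma>inj in auto)
    have injZ: "inj (\<lambda>i. Z $ i)"
    proof (rule injI)
      fix i j assume "Z $ i = Z $ j"
      then have "blaschke c as (Z $ i) = blaschke c as (Z $ j)" by simp
      then show "i = j" using BZ injf \<sigma>inj by metis
    qed
    have d: "deriv (blaschke c as) (Z $ i) \<noteq> 0" for i
    proof
      assume "deriv (blaschke c as) (Z $ i) = 0"
      then have "Z $ i \<in> crit" using Z(1) by (simp add: crit_def polydisc_iff)
      then have "blaschke c as (Z $ i) \<in> blaschke c as ` crit" by (rule imageI)
      with BZ fT[of "\<sigma> i"] show False by simp
    qed
    show "det (complex_jacobian F u) \<noteq> 0"
      unfolding det_nonzero_iff_injective
    proof (intro allI impI)
      fix x assume x: "complex_jacobian F u *v x = 0"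
      obtain h where h: "sym_jacobian Z *v h = x" by (rule sym_jacobian_surj[OF injZ])
      have "sym_jacobian (\<chi> i. blaschke c as (Z $ i)) *v (\<chi> i. deriv (blaschke c as) (Z $ i) * h $ i) = 0"
        using induced_map_chain_rule[OF c as F Z(1), of h] x h Z(2) by simp
      from sym_jacobian_injective[OF injBZ this] have "h = 0"
        using d by (simp add: vec_eq_iff)
      with h show "x = 0" by simp
    qed
  qed
  then show ?thesis ..
qed

lemma map_degree_induced: "map_degree F = length as ^ CARD('n)"
  unfolding map_degree_def
proof (rule the_equality)
  show "\<forall>w. regular_value F w \<longrightarrow> card {u \<in> sym_polydisc. F u = w} = length as ^ CARD('n)"
    using card_regular_fibre by blast
  fix m assume "\<forall>w. regular_value F w \<longrightarrow> card {u \<in> sym_polydisc. F u = w} = m"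
  with ex_regular_value card_regular_fibre show "m = length as ^ CARD('n)" by blast
qed

end

section \<open>The upper bound\<close>

lemma sesq_diff_scaleR: "sesq (C *\<^sub>R A - A') x y = of_real C * sesq A x y - sesq A' x y"
proof -
  have "((C *\<^sub>R A - A') *v y) $ i = of_real C * (A *v y) $ i - (A' *v y) $ i" for i
    by (simp add: matrix_vector_mult_def sum_subtractf[symmetric] sum_distrib_left)
      (simp add: scaleR_conv_of_real algebra_simps)
  then show ?thesis
    by (simp add: sesq_def sum_subtractf[symmetric] sum_distrib_left algebra_simps)
qed

lemma sesq_conj_transpose_mult:
  fixes D :: "complex^'n^'m"
  shows "sesq (conj_transpose D ** A ** D) x y = sesq A (D *v x) (D *v y)"
proof -
  have "sesq (conj_transpose D ** A ** D) x y = (\<Sum>i\<in>UNIV. cnj (x $ i) * (conj_transpose D *v (A *v (D *v y))) $ i)"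
    by (simp add: sesq_def matrix_vector_mul_assoc matrix_mul_assoc)
  also have "\<dots> = (\<Sum>i\<in>UNIV. \<Sum>j\<in>UNIV. cnj (D $ j $ i * x $ i) * (A *v (D *v y)) $ j)"
  proof -
    have "(conj_transpose D *v w) $ i = (\<Sum>j\<in>UNIV. cnj (D $ j $ i) * w $ j)" for w i
      by (simp add: matrix_vector_mult_def conj_transpose_def)
    then show ?thesis by (simp add: sum_distrib_left mult_ac)
  qed
  also have "\<dots> = (\<Sum>j\<in>UNIV. cnj ((D *v x) $ j) * (A *v (D *v y)) $ j)"
    by (subst sum.swap) (simp add: matrix_vector_mult_def[of D] sum_distrib_right)
  finally show ?thesis by (simp add: sesq_def)
qed

lemma sesq_axis: "sesq A (axis i 1) (axis j 1) = A $ i $ j"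
proof -
  have "(A *v axis j 1) $ k = A $ k $ j" for k
    by (simp add: matrix_vector_mult_def axis_def if_distrib[of "\<lambda>x. _ * x"] cong: if_cong)
  moreover have "cnj (axis i 1 $ k) = (if k = i then 1 else 0)" for k
    by (simp add: axis_def)
  ultimately show ?thesis
    by (simp add: sesq_def if_distrib[of "\<lambda>x. x * _"] cong: if_cong)
qed

lemma pos_semidefI:
  assumes "\<And>x y. sesq A y x = cnj (sesq A x y)" "\<And>x. 0 \<le> Re (sesq A x x)"
  shows "pos_semidef A"
proof -
  have "cnj (A $ j $ i) = A $ i $ j" for i j
    using assms(1)[of "axis i 1" "axis j 1"] by (simp only: sesq_axis)
  then have "conj_transpose A = A"
    by (simp add: vec_eq_iff conj_transpose_def)
  with assms(2) show ?thesis by (simp add: pos_semidef_def sesq_def)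
qed

lemma continuous_on_sesq:
  assumes "continuous_on S A" "continuous_on S v" "continuous_on S w"
  shows "continuous_on S (\<lambda>u. sesq (A u) (v u) (w u))"
  unfolding sesq_def matrix_vector_mult_def
  using assms by (auto intro!: continuous_intros)

lemma continuous_on_matrix_vector_mult:
  fixes A :: "'a::topological_space \<Rightarrow> complex^'n^'m"
  assumes "continuous_on S A"
  shows "continuous_on S (\<lambda>u. A u *v x)"
  unfolding matrix_vector_mult_def
  using assms by (intro continuous_on_vec_lambda continuous_intros)

definition polydisc_form :: "complex^'n \<Rightarrow> complex^'n \<Rightarrow> complex^'n \<Rightarrow> complex" where
  "polydisc_form Z x y = (\<Sum>j\<in>UNIV. \<Sum>k\<in>UNIV. y $ j * cnj (x $ k) / (1 - Z $ j * cnj (Z $ k))\<^sup>2)"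

lemma polydisc_form_commute: "polydisc_form Z y x = cnj (polydisc_form Z x y)"
  unfolding polydisc_form_def by (subst sum.swap) (simp add: mult.commute)

lemma polydisc_form_eq: "polydisc_form Z x x = bergman_form UNIV (\<lambda>i. Z $ i) (\<lambda>i. x $ i)"
  by (simp add: polydisc_form_def bergman_form_def)

text \<open>
  The sesquilinear form of the matrix \<open>C g - F\<^sup>*g\<close> at \<open>u\<close>. Both arguments are kept,
  because semidefiniteness includes that the matrix is Hermitian.
\<close>

definition defect_form ::
  "(complex^('n::{finite,linorder}) \<Rightarrow> complex^('n::{finite,linorder})) \<Rightarrow> real \<Rightarrow> complex^('n::{finite,linorder})
    \<Rightarrow> complex^('n::{finite,linorder}) \<Rightarrow> complex^('n::{finite,linorder}) \<Rightarrow> complex" where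
  "defect_form F C u x y = sesq (C *\<^sub>R szego_metric u - pullback_metric F szego_metric u) x y"

lemma defect_form_eq:
  "defect_form F C u x y = of_real C * sesq (szego_metric u) x y -
    sesq (szego_metric (F u)) (complex_jacobian F u *v x) (complex_jacobian F u *v y)"
  by (simp add: defect_form_def sesq_diff_scaleR pullback_metric_def sesq_conj_transpose_mult)

lemma pullback_leI:
  assumes "\<And>u x y. u \<in> sym_polydisc \<Longrightarrow> defect_form F C u y x = cnj (defect_form F C u x y)"
    and "\<And>u x. u \<in> sym_polydisc \<Longrightarrow> 0 \<le> Re (defect_form F C u x x)"
  shows "pullback_le F C"
  unfolding pullback_le_def
  by (intro ballI pos_semidefI) (rule assms[unfolded defect_form_def]; assumption)+

lemma pullback_leD:
  assumes "pullback_le F C" "u \<in> sym_polydisc"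
  shows "0 \<le> Re (defect_form F C u x x)"
  using assms by (auto simp: pullback_le_def pos_semidef_def defect_form_def sesq_def)

context
  fixes F :: "complex^('n::{finite,linorder}) \<Rightarrow> complex^('n::{finite,linorder})" and c :: complex and as :: "complex list"
  assumes c: "norm c = 1" and as: "\<forall>a\<in>set as. norm a < 1" and ne: "as \<noteq> []" and F: "induced_by F (blaschke c as)"
begin

lemma defect_form_symmetrization:
  assumes Z: "Z \<in> polydisc"
  shows "defect_form F C (symmetrization Z) (sym_jacobian Z *v x) (sym_jacobian Z *v y) =
    of_real C * polydisc_form Z x y -
    polydisc_form (\<chi> i. blaschke c as (Z $ i)) (\<chi> i. deriv (blaschke c as) (Z $ i) * x $ i) (\<chi> i. deriv (blaschke c as) (Z $ i) * y $ i)"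
proof -
  have "F (symmetrization Z) = symmetrization (\<chi> i. blaschke c as (Z $ i))" using F Z by (simp add: induced_by_def)
  then show ?thesis
    unfolding defect_form_eq polydisc_form_def sesq_szego_metric[OF Z, symmetric]
      sesq_szego_metric[OF blaschke_map_in_polydisc[OF c as ne Z], symmetric]
    by (simp only: induced_map_chain_rule[OF c as F Z])
qed

lemma Re_defect_form_symmetrization:
  assumes Z: "Z \<in> polydisc"
  shows "Re (defect_form F C (symmetrization Z) (sym_jacobian Z *v x) (sym_jacobian Z *v x)) =
    C * Re (bergman_form UNIV (\<lambda>i. Z $ i) (\<lambda>i. x $ i)) -
    Re (bergman_form UNIV (\<lambda>i. blaschke c as (Z $ i)) (\<lambda>i. deriv (blaschke c as) (Z $ i) * x $ i))"
  by (simp add: defect_form_symmetrization[OF Z] polydisc_form_eq)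

lemma continuous_on_defect_form: "continuous_on sym_polydisc (\<lambda>u. defect_form F C u x y)"
proof -
  have img: "F ` sym_polydisc \<subseteq> sym_polydisc"
    using proper_self_map_if_induced[OF c as ne F] by (simp add: proper_holomorphic_self_map_def)
  have "continuous_on sym_polydisc (\<lambda>u. szego_metric (F u))"
    by (rule continuous_on_compose2[OF continuous_on_szego_metric continuous_on_induced_map[OF as F] img])
  then show ?thesis
    unfolding defect_form_eq
    by (intro continuous_on_diff continuous_on_mult continuous_on_sesq continuous_on_const
        continuous_on_szego_metric continuous_on_matrix_vector_mult induced_map_derivative(2)[OF as F])
qed

text \<open>
  A small shift by multiples of a vector with distinct coordinates makes the coordinates of \<open>Z\<close>
  distinct.
\<close>

lemma defect_form_limit:
  assumes Z: "Z \<in> polydisc"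
  obtains Y :: "complex \<Rightarrow> complex^('n::{finite,linorder})" where
    "\<And>x y. ((\<lambda>t. defect_form F C (symmetrization (Y t)) x y) \<longlongrightarrow> defect_form F C (symmetrization Z) x y) (at 0)"
    "\<forall>\<^sub>F t in at 0. Y t \<in> polydisc \<and> inj (\<lambda>i. Y t $ i)"
proof -
  define V :: "(complex,'n) vec" where "V = (\<chi> i. of_nat (coord_number i))"
  define Y where "Y t = Z + t *s V" for t
  have "0 \<in> line_slice Z V" using Z by (simp add: line_slice_def)
  have Y: "Y t \<in> polydisc" if "t \<in> line_slice Z V" for t
    using that by (simp add: line_slice_def Y_def)
  have "((\<lambda>t. defect_form F C (symmetrization (Y t)) x y) \<longlongrightarrow> defect_form F C (symmetrization Z) x y) (at 0)" for x y
  proof -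
    have "continuous_on (line_slice Z V) Y"
      unfolding Y_def[abs_def] vector_scalar_mult_def
      by (intro continuous_on_add continuous_on_const continuous_on_vec_lambda continuous_intros)
    then have "continuous_on (line_slice Z V) (\<lambda>t. symmetrization (Y t))"
      by (rule continuous_on_compose2[OF continuous_symmetrization]) auto
    then have "continuous_on (line_slice Z V) (\<lambda>t. defect_form F C (symmetrization (Y t)) x y)"
      by (rule continuous_on_compose2[OF continuous_on_defect_form]) (use Y in auto)
    then have "isCont (\<lambda>t. defect_form F C (symmetrization (Y t)) x y) 0"
      using open_line_slice \<open>0 \<in> line_slice Z V\<close> continuous_on_eq_continuous_at by blast
    then show ?thesis by (simp add: isCont_def Y_def)
  qed
  moreover have "\<forall>\<^sub>F t in at 0. t \<in> line_slice Z V"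
    using open_line_slice[of Z V] \<open>0 \<in> line_slice Z V\<close> by (rule eventually_at_in_open')
  moreover have "\<forall>\<^sub>F t in at 0. \<forall>i j. i \<noteq> j \<longrightarrow> Y t $ i \<noteq> Y t $ j"
  proof (intro eventually_all_finite allI)
    fix i j :: 'n
    show "\<forall>\<^sub>F t in at 0. i \<noteq> j \<longrightarrow> Y t $ i \<noteq> Y t $ j"
    proof (cases "i = j")
      case False
      have "\<forall>\<^sub>F t in at 0. t \<noteq> (Z $ j - Z $ i) / (V $ i - V $ j)"
        by (rule eventually_neq_at_within)
      then show ?thesis
      proof eventually_elim
        case (elim t)
        have "V $ i - V $ j \<noteq> 0"
          using False bij_betw_coord_number[where 'n='n] by (auto simp: V_def bij_betw_def inj_on_def)
        with elim show ?case by (auto simp: Y_def field_simps)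
      qed
    qed simp
  qed
  ultimately show ?thesis
  proof (intro that[of Y])
    show "\<forall>\<^sub>F t in at 0. Y t \<in> polydisc \<and> inj (\<lambda>i. Y t $ i)"
      using \<open>\<forall>\<^sub>F t in at 0. t \<in> line_slice Z V\<close> \<open>\<forall>\<^sub>F t in at 0. \<forall>i j. i \<noteq> j \<longrightarrow> Y t $ i \<noteq> Y t $ j\<close>
      by eventually_elim (use Y in \<open>auto simp: inj_def\<close>)
  qed
qed

text \<open>
  Where the coordinates of \<open>Z\<close> are distinct, every tangent vector at \<open>symmetrization Z\<close> comes
  from the polydisc, and \<open>bergman_form_blaschke_le\<close> applies. The remaining points are limits.
\<close>

theorem pullback_le_induced: "pullback_le F (min (real CARD('n)) (real (length as)))"
proof -
  let ?C = "min (real CARD('n)) (real (length as))"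
  have herm: "defect_form F ?C (symmetrization Z) y x = cnj (defect_form F ?C (symmetrization Z) x y)"
    and pos: "0 \<le> Re (defect_form F ?C (symmetrization Z) x x)"
    if Z: "Z \<in> polydisc" "inj (\<lambda>i. Z $ i)" for Z x y
  proof -
    obtain x' where x: "sym_jacobian Z *v x' = x" by (rule sym_jacobian_surj[OF Z(2)])
    obtain y' where y: "sym_jacobian Z *v y' = y" by (rule sym_jacobian_surj[OF Z(2)])
    show "defect_form F ?C (symmetrization Z) y x = cnj (defect_form F ?C (symmetrization Z) x y)"
      unfolding x[symmetric] y[symmetric] defect_form_symmetrization[OF Z(1)]
      by (simp add: polydisc_form_commute[of _ _ x'] polydisc_form_commute[of _ _ "\<chi> i. deriv (blaschke c as) (Z $ i) * x' $ i"])
    have "Re (bergman_form UNIV (\<lambda>i. blaschke c as (Z $ i)) (\<lambda>i. deriv (blaschke c as) (Z $ i) * x' $ i))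
      \<le> min (card (UNIV :: 'n set)) (length as) * Re (bergman_form UNIV (\<lambda>i. Z $ i) (\<lambda>i. x' $ i))"
      by (rule bergman_form_blaschke_le[OF c as ne]) (use Z(1) in \<open>auto simp: polydisc_iff\<close>)
    then show "0 \<le> Re (defect_form F ?C (symmetrization Z) x x)"
      unfolding x[symmetric] Re_defect_form_symmetrization[OF Z(1)] by simp
  qed
  show ?thesis
  proof (rule pullback_leI)
    fix u x y :: "(complex,'n) vec" assume "u \<in> sym_polydisc"
    then obtain Z where Z: "Z \<in> polydisc" "u = symmetrization Z" by (auto simp: sym_polydisc_def)
    obtain Y :: "complex \<Rightarrow> (complex,'n) vec" where lim: "\<And>x y. ((\<lambda>t. defect_form F ?C (symmetrization (Y t)) x y) \<longlongrightarrow> defect_form F ?C (symmetrization Z) x y) (at 0)"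
      and ev: "\<forall>\<^sub>F t in at 0. Y t \<in> polydisc \<and> inj (\<lambda>i. Y t $ i)"
      by (fact defect_form_limit[OF Z(1), of ?C])
    have "((\<lambda>t. cnj (defect_form F ?C (symmetrization (Y t)) x y)) \<longlongrightarrow> cnj (defect_form F ?C (symmetrization Z) x y)) (at 0)"
      by (intro tendsto_intros lim)
    moreover have "\<forall>\<^sub>F t in at 0. cnj (defect_form F ?C (symmetrization (Y t)) x y) = defect_form F ?C (symmetrization (Y t)) y x"
      using ev
    proof eventually_elim
      case (elim t)
      then show ?case by (intro herm[symmetric]) simp_all
    qed
    ultimately have "((\<lambda>t. defect_form F ?C (symmetrization (Y t)) y x) \<longlongrightarrow> cnj (defect_form F ?C (symmetrization Z) x y)) (at 0)"
      by (rule Lim_transform_eventually)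
    from tendsto_unique[OF _ lim this] show "defect_form F ?C u y x = cnj (defect_form F ?C u x y)"
      by (simp add: Z(2))
  next
    fix u x :: "(complex,'n) vec" assume "u \<in> sym_polydisc"
    then obtain Z where Z: "Z \<in> polydisc" "u = symmetrization Z" by (auto simp: sym_polydisc_def)
    obtain Y :: "complex \<Rightarrow> (complex,'n) vec" where lim: "\<And>x y. ((\<lambda>t. defect_form F ?C (symmetrization (Y t)) x y) \<longlongrightarrow> defect_form F ?C (symmetrization Z) x y) (at 0)"
      and ev: "\<forall>\<^sub>F t in at 0. Y t \<in> polydisc \<and> inj (\<lambda>i. Y t $ i)"
      by (fact defect_form_limit[OF Z(1), of ?C])
    have "((\<lambda>t. Re (defect_form F ?C (symmetrization (Y t)) x x)) \<longlongrightarrow> Re (defect_form F ?C (symmetrization Z) x x)) (at 0)"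
      by (intro tendsto_intros lim)
    then have "0 \<le> Re (defect_form F ?C (symmetrization Z) x x)"
      by (rule tendsto_lowerbound) (use ev pos in \<open>auto elim!: eventually_mono\<close>)
    then show "0 \<le> Re (defect_form F ?C u x x)" by (simp add: Z(2))
  qed
qed

end

section \<open>Sharpness\<close>

text \<open>
  Any choice of preimages under the symmetrization gives the same map.
\<close>

lemma ex_induced_map:
  fixes f :: "complex \<Rightarrow> complex"
  obtains F :: "complex^('n::{finite,linorder}) \<Rightarrow> complex^('n::{finite,linorder})" where "induced_by F f"
proof -
  define F :: "(complex,'n) vec \<Rightarrow> (complex,'n) vec" where
    "F u = symmetrization (\<chi> i. f ((SOME Z. symmetrization Z = u) $ i))" for u
  have "F (symmetrization Z) = symmetrization (\<chi> i. f (Z $ i))" for Z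
  proof -
    define Y where "Y = (SOME Y. symmetrization Y = symmetrization Z)"
    have "symmetrization Y = symmetrization Z" unfolding Y_def by (rule someI) (rule refl)
    then obtain \<sigma> where \<sigma>: "\<sigma> permutes UNIV" "Y = (\<chi> i. Z $ \<sigma> i)"
      using symmetrization_eq_iff[of Z Y] by auto
    then have "(\<chi> i. f (Y $ i)) = (\<chi> i. (\<chi> i. f (Z $ i)) $ \<sigma> i)" by simp
    then have "symmetrization (\<chi> i. f (Y $ i)) = symmetrization (\<chi> i. f (Z $ i))"
      using symmetrization_permute[OF \<sigma>(1), of "\<chi> i. f (Z $ i)"] by simp
    then show ?thesis by (simp add: F_def Y_def)
  qed
  then show ?thesis by (intro that[of F]) (simp add: induced_by_def)
qed

text \<open>
  The power series of \<open>1 / (1 - x)\<^sup>2\<close> diagonalises the form.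
\<close>

lemma bergman_form_sums:
  assumes "finite I" "\<And>i. i \<in> I \<Longrightarrow> norm (z i) < 1"
  shows "(\<lambda>k. real (Suc k) * (norm (\<Sum>i\<in>I. v i * z i ^ k))\<^sup>2) sums Re (bergman_form I z v)"
proof -
  have "(\<lambda>k. \<Sum>i\<in>I. \<Sum>j\<in>I. v i * cnj (v j) * (of_nat (Suc k) * (z i * cnj (z j)) ^ k)) sums
    (\<Sum>i\<in>I. \<Sum>j\<in>I. v i * cnj (v j) * (1 / (1 - z i * cnj (z j))\<^sup>2))"
  proof (intro sums_sum sums_mult geometric_deriv_sums)
    fix i j assume "i \<in> I" "j \<in> I"
    then have "norm (z i) * norm (z j) < 1 * 1"
      using assms(2) by (intro mult_strict_mono) auto
    then show "norm (z i * cnj (z j)) < 1" by (simp add: norm_mult)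
  qed
  moreover have "(\<Sum>i\<in>I. \<Sum>j\<in>I. v i * cnj (v j) * (of_nat (Suc k) * (z i * cnj (z j)) ^ k)) =
     of_real (real (Suc k) * (norm (\<Sum>i\<in>I. v i * z i ^ k))\<^sup>2)" for k
  proof -
    have "complex_of_real ((norm (\<Sum>i\<in>I. v i * z i ^ k))\<^sup>2) = (\<Sum>i\<in>I. \<Sum>j\<in>I. (v i * z i ^ k) * cnj (v j * z j ^ k))"
      unfolding complex_norm_square by (simp add: sum_product)
    then have "complex_of_real (real (Suc k) * (norm (\<Sum>i\<in>I. v i * z i ^ k))\<^sup>2) =
      of_nat (Suc k) * (\<Sum>i\<in>I. \<Sum>j\<in>I. (v i * z i ^ k) * cnj (v j * z j ^ k))"
      by (simp only: of_real_mult of_real_of_nat_eq)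
    then show ?thesis by (simp add: sum_distrib_left power_mult_distrib mult_ac del: of_nat_Suc)
  qed
  ultimately have "(\<lambda>k. complex_of_real (real (Suc k) * (norm (\<Sum>i\<in>I. v i * z i ^ k))\<^sup>2)) sums bergman_form I z v"
    by (simp only: bergman_form_def times_divide_eq_right mult_1_right)
  from sums_Re[OF this] show ?thesis by (simp only: Re_complex_of_real)
qed

lemma bergman_form_ge_norm_sum:
  assumes "finite I" "\<And>i. i \<in> I \<Longrightarrow> norm (z i) < 1"
  shows "(norm (\<Sum>i\<in>I. v i))\<^sup>2 \<le> Re (bergman_form I z v)"
proof -
  have "(\<Sum>k\<in>{0}. real (Suc k) * (norm (\<Sum>i\<in>I. v i * z i ^ k))\<^sup>2) \<le>
      (\<Sum>k. real (Suc k) * (norm (\<Sum>i\<in>I. v i * z i ^ k))\<^sup>2)"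
    by (rule sum_le_suminf[OF sums_summable[OF bergman_form_sums[OF assms]]]) auto
  also have "\<dots> = Re (bergman_form I z v)"
    by (rule sums_unique[OF bergman_form_sums[OF assms], symmetric])
  finally have "(\<Sum>k\<in>{0}. real (Suc k) * (norm (\<Sum>i\<in>I. v i * z i ^ k))\<^sup>2) \<le> Re (bergman_form I z v)" .
  then show ?thesis by simp
qed

text \<open>
  The points are the \<open>n\<close>-th roots of unity, scaled by \<open>r\<close>. The weights are chosen such that the sums
  \<open>\<Sum> v\<^sub>i z\<^sub>i ^ m\<close> with \<open>m < n\<close> vanish except for \<open>m = k - 1\<close>, where the sum is \<open>1\<close>.
\<close>

definition unity_root :: "'n::{finite,linorder} \<Rightarrow> complex" where
  "unity_root i = exp (2 * of_real pi * \<i> * of_nat (coord_number i) / of_nat CARD('n))"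

lemma norm_unity_root [simp]: "norm (unity_root i) = 1"
  by (simp add: unity_root_def norm_exp_eq_Re)

lemma unity_root_mult_cnj: "unity_root i ^ k * cnj (unity_root i) ^ k = 1"
proof -
  have "unity_root i * cnj (unity_root i) = 1"
    using complex_norm_square[of "unity_root i"] by simp
  then show ?thesis by (simp flip: power_mult_distrib)
qed

lemma sum_unity_root_powers:
  assumes "m < CARD('n)" "l < CARD('n)" "m \<noteq> l"
  shows "(\<Sum>i\<in>(UNIV :: 'n::{finite,linorder} set). unity_root i ^ m * cnj (unity_root i) ^ l) = 0"
proof -
  let ?n = "CARD('n)"
  define \<omega> where "\<omega> = exp (2 * of_real pi * \<i> / of_nat ?n)"
  have pow: "\<omega> ^ k = exp (2 * of_real pi * \<i> * of_nat k / of_nat ?n)" for k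
    by (simp add: \<omega>_def exp_of_nat_mult[symmetric] mult_ac)
  have u: "unity_root i = \<omega> ^ coord_number i" for i :: 'n
    by (simp add: unity_root_def pow)
  have \<omega>1: "norm \<omega> = 1" by (simp add: \<omega>_def norm_exp_eq_Re)
  then have \<omega>c: "\<omega> * cnj \<omega> = 1" using complex_norm_square[of \<omega>] by simp
  define \<zeta> where "\<zeta> = \<omega> ^ m * cnj \<omega> ^ l"
  have "\<zeta> \<noteq> 1"
  proof
    assume "\<zeta> = 1"
    then have "\<omega> ^ l = \<omega> ^ l * (\<omega> ^ m * cnj \<omega> ^ l)" by (simp add: \<zeta>_def)
    also have "\<dots> = \<omega> ^ m * (\<omega> * cnj \<omega>) ^ l" by (simp add: power_mult_distrib)
    finally have "\<omega> ^ l = \<omega> ^ m" by (simp add: \<omega>c)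
    then have "l mod ?n = m mod ?n"
      unfolding pow by (subst (asm) complex_root_unity_eq) (auto simp: Suc_le_eq)
    with assms show False by simp
  qed
  have "\<omega> ^ ?n = 1" by (simp add: pow)
  then have \<zeta>n: "\<zeta> ^ ?n = 1"
    unfolding \<zeta>_def by (simp add: power_mult_distrib power_mult[symmetric] mult.commute[of _ ?n])
      (simp add: power_mult flip: complex_cnj_power)
  have "(\<Sum>i\<in>(UNIV :: 'n set). unity_root i ^ m * cnj (unity_root i) ^ l) = (\<Sum>i\<in>(UNIV :: 'n set). \<zeta> ^ coord_number i)"
    by (simp add: u \<zeta>_def power_mult_distrib power_mult[symmetric] mult.commute)
  also have "\<dots> = (\<Sum>k\<in>{1..?n}. \<zeta> ^ k)"
    by (rule sum.reindex_bij_betw[OF bij_betw_coord_number])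
  also have "\<dots> = \<zeta> * (\<Sum>k<?n. \<zeta> ^ k)"
    by (simp add: sum.atLeast1_atMost_eq sum_distrib_left)
  also have "\<dots> = 0"
    using \<open>\<zeta> \<noteq> 1\<close> by (simp add: geometric_sum \<zeta>n)
  finally show ?thesis .
qed

definition probe_point :: "real \<Rightarrow> complex^('n::{finite,linorder})" where
  "probe_point r = (\<chi> i. of_real r * unity_root i)"

definition probe_vector :: "nat \<Rightarrow> real \<Rightarrow> complex^('n::{finite,linorder})" where
  "probe_vector k r = (\<chi> i. cnj (unity_root i) ^ (k - 1) / (of_real r ^ (k - 1) * of_nat CARD('n)))"

text \<open>
  In the series of the form, the terms with \<open>m < n\<close> add up to \<open>k\<close>, and the others are
  \<open>O(r\<^sup>2)\<close> because \<open>m - (k - 1) \<ge> 1\<close>.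
\<close>

lemma bergman_form_probe_le:
  assumes k: "1 \<le> k" "k \<le> CARD('n::{finite,linorder})" and r: "0 < r" "r \<le> 1/2"
  shows "Re (bergman_form UNIV (\<lambda>i::'n. probe_point r $ i) (\<lambda>i. probe_vector k r $ i))
    \<le> real k + r\<^sup>2 * (\<Sum>m. real (Suc (m + CARD('n))) * (1/4) ^ m)"
proof -
  let ?n = "CARD('n)"
  define s where "s m = (\<Sum>i\<in>(UNIV :: 'n set). probe_vector k r $ i * probe_point r $ i ^ m)" for m
  define t where "t m = real (Suc m) * (norm (s m))\<^sup>2" for m
  have s_eq: "s m = of_real r ^ m / (of_real r ^ (k - 1) * of_nat ?n) *
     (\<Sum>i\<in>(UNIV :: 'n set). unity_root i ^ m * cnj (unity_root i) ^ (k - 1))" for m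
    unfolding s_def probe_vector_def probe_point_def sum_distrib_left
    by (rule sum.cong) (simp_all add: power_mult_distrib)
  have s0: "s m = 0" if "m < ?n" "m \<noteq> k - 1" for m
    unfolding s_eq using that k by (subst sum_unity_root_powers) auto
  have s1: "s (k - 1) = 1"
    unfolding s_eq using r by (simp add: unity_root_mult_cnj)
  have s_le: "norm (s m) \<le> r ^ (m - (k - 1))" if "m \<ge> ?n" for m
  proof -
    have "norm (\<Sum>i\<in>(UNIV :: 'n set). unity_root i ^ m * cnj (unity_root i) ^ (k - 1)) \<le> (\<Sum>i\<in>(UNIV :: 'n set). 1)"
      by (rule sum_norm_le) (simp add: norm_mult norm_power)
    then have "norm (s m) \<le> r ^ m / (r ^ (k - 1) * real ?n) * real ?n"
      unfolding s_eq norm_mult using r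
      by (intro mult_mono) (auto simp: norm_divide norm_mult norm_power)
    also have "\<dots> = r ^ (m - (k - 1))"
      using r that k by (simp add: power_diff)
    finally show ?thesis .
  qed
  have sums: "t sums Re (bergman_form UNIV (\<lambda>i::'n. probe_point r $ i) (\<lambda>i. probe_vector k r $ i))"
    unfolding t_def s_def
    by (rule bergman_form_sums) (use r in \<open>auto simp: probe_point_def norm_mult\<close>)
  have "(\<Sum>m<?n. t m) = (\<Sum>m<?n. if m = k - 1 then real k else 0)"
    using s0 s1 k by (intro sum.cong) (auto simp: t_def)
  also have "\<dots> = real k" using k by (subst sum.delta) auto
  finally have head: "(\<Sum>m<?n. t m) = real k" .
  have tail: "t (m + ?n) \<le> r\<^sup>2 * (real (Suc (m + ?n)) * (1/4) ^ m)" for m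
  proof -
    have "(norm (s (m + ?n)))\<^sup>2 \<le> (r ^ (m + ?n - (k - 1)))\<^sup>2"
      by (rule power_mono[OF s_le]) auto
    also have "\<dots> = (r\<^sup>2) ^ (m + ?n - (k - 1))" by (simp flip: power_mult add: mult.commute)
    also have "\<dots> \<le> (r\<^sup>2) ^ Suc m"
      using k r by (intro power_decreasing) (auto simp: abs_square_le_1 power_le_one)
    also have "\<dots> = r\<^sup>2 * (r\<^sup>2) ^ m" by simp
    also have "\<dots> \<le> r\<^sup>2 * (1/4) ^ m"
    proof -
      have "r\<^sup>2 \<le> (1/2)\<^sup>2" using r by (intro power_mono) auto
      then have "(r\<^sup>2) ^ m \<le> (1/4) ^ m" by (intro power_mono) (auto simp: power2_eq_square)
      then show ?thesis by (intro mult_left_mono) auto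
    qed
    finally show ?thesis
      unfolding t_def by (simp add: mult_left_mono mult.left_commute del: of_nat_Suc)
  qed
  have summ: "summable (\<lambda>m. real (Suc (m + ?n)) * (1/4) ^ m)"
  proof -
    have "summable (\<lambda>m. real (Suc m) * (1/4) ^ m + real ?n * (1/4) ^ m)"
      by (intro summable_add summable_mult summable_geometric sums_summable[OF geometric_deriv_sums]) auto
    then show ?thesis by (simp add: algebra_simps)
  qed
  have "Re (bergman_form UNIV (\<lambda>i::'n. probe_point r $ i) (\<lambda>i. probe_vector k r $ i)) = suminf t"
    using sums by (rule sums_unique)
  also have "\<dots> = (\<Sum>m. t (m + ?n)) + (\<Sum>m<?n. t m)"
    by (rule suminf_split_initial_segment) (use sums in \<open>rule sums_summable\<close>)
  also have "(\<Sum>m. t (m + ?n)) \<le> (\<Sum>m. r\<^sup>2 * (real (Suc (m + ?n)) * (1/4) ^ m))"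
    by (intro suminf_le tail summable_mult summ summable_ignore_initial_segment) (use sums in \<open>rule sums_summable\<close>)
  also have "\<dots> = r\<^sup>2 * (\<Sum>m. real (Suc (m + ?n)) * (1/4) ^ m)"
    by (rule suminf_mult[OF summ])
  finally show ?thesis using head by simp
qed

text \<open>
  The zeros of \<open>z ^ k ((z + a) / (1 + a z)) ^ (d - k)\<close>. The zero of order \<open>k\<close> at the origin lets the
  derivative interact with the weights of the test vector, and the other factors fill up the degree; they
  tend to \<open>1\<close> as \<open>a \<rightarrow> 1\<close>.
\<close>

definition probe_zeros :: "nat \<Rightarrow> nat \<Rightarrow> real \<Rightarrow> complex list" where
  "probe_zeros k d a = replicate k 0 @ replicate (d - k) (- of_real a)"

lemma blaschke_probe: "blaschke 1 (probe_zeros k d a) z = z ^ k * blaschke 1 (replicate (d - k) (- of_real a)) z"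
  by (simp add: blaschke_def probe_zeros_def blaschke_factor_def map_replicate_const)

text \<open>
  The derivative is \<open>z ^ (k - 1) G z\<close> with \<open>G 0 = k a ^ (d - k)\<close>. The weights cancel the power
  of \<open>z\<close>, so that the sum is the mean of \<open>G\<close> over the points.
\<close>

lemma probe_lower_limit:
  assumes k: "1 \<le> k" and a: "0 \<le> a" "a < 1"
  shows "((\<lambda>r. (norm (\<Sum>i\<in>(UNIV :: 'n::{finite,linorder} set).
      deriv (blaschke 1 (probe_zeros k d a)) (probe_point r $ i) * probe_vector k r $ i))\<^sup>2)
    \<longlongrightarrow> (real k * a ^ (d - k))\<^sup>2) (at_right 0)"
proof -
  let ?n = "CARD('n)" and ?as = "replicate (d - k) (- complex_of_real a)"
  define g where "g = blaschke 1 ?as"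
  define G where "G z = of_nat k * g z + z * deriv g z" for z
  have as: "\<forall>b\<in>set ?as. norm b < 1" using a by auto
  have B: "deriv (blaschke 1 (probe_zeros k d a)) z = z ^ (k - 1) * G z" if "norm z < 1" for z
  proof -
    have dg: "(g has_field_derivative deriv g z) (at z)"
      unfolding g_def by (rule has_field_derivative_blaschke[OF norm_one as that])
    have "((\<lambda>z. z ^ k * g z) has_field_derivative (of_nat k * z ^ (k - 1)) * g z + deriv g z * z ^ k) (at z)"
    proof -
      have "((\<lambda>z. z ^ k) has_field_derivative of_nat k * z ^ (k - 1)) (at z)"
        by (auto intro!: derivative_eq_intros)
      from DERIV_mult[OF this dg] show ?thesis by (simp add: add.commute)
    qed
    moreover have "blaschke 1 (probe_zeros k d a) = (\<lambda>z. z ^ k * g z)"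
      by (simp add: fun_eq_iff blaschke_probe g_def)
    moreover have "(of_nat k * z ^ (k - 1)) * g z + deriv g z * z ^ k = z ^ (k - 1) * G z"
      using k by (simp add: G_def algebra_simps power_eq_if)
    ultimately show ?thesis by (simp only: DERIV_imp_deriv)
  qed
  have eq: "(\<Sum>i\<in>(UNIV :: 'n set). deriv (blaschke 1 (probe_zeros k d a)) (probe_point r $ i) * probe_vector k r $ i) =
      (\<Sum>i\<in>(UNIV :: 'n set). G (of_real r * unity_root i)) / of_nat ?n" if r: "0 < r" "r < 1" for r
  proof -
    have "deriv (blaschke 1 (probe_zeros k d a)) (probe_point r $ i) * probe_vector k r $ i =
      G (of_real r * unity_root i) / of_nat ?n" for i :: 'n
    proof -
      have "norm (probe_point r $ i) < 1" using r by (simp add: probe_point_def norm_mult)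
      from B[OF this] have "deriv (blaschke 1 (probe_zeros k d a)) (probe_point r $ i) * probe_vector k r $ i =
        G (of_real r * unity_root i) * ((unity_root i ^ (k - 1) * cnj (unity_root i) ^ (k - 1)) *
          (of_real r ^ (k - 1) / (of_real r ^ (k - 1) * of_nat ?n)))"
        by (simp add: probe_point_def probe_vector_def power_mult_distrib mult_ac)
      then show ?thesis using r by (simp add: unity_root_mult_cnj)
    qed
    then show ?thesis by (simp add: sum_divide_distrib)
  qed
  have g0: "g 0 = of_real a ^ (d - k)"
    by (simp add: g_def blaschke_def blaschke_factor_def map_replicate_const)
  have hol: "g holomorphic_on ball 0 1" unfolding g_def by (rule holomorphic_on_blaschke[OF norm_one as])
  have "G holomorphic_on ball 0 1"
    unfolding G_def by (intro holomorphic_intros hol holomorphic_deriv open_ball)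
  then have "isCont G 0"
    by (metis centre_in_ball continuous_on_eq_continuous_at holomorphic_on_imp_continuous_on open_ball zero_less_one)
  have "((\<lambda>r. G (of_real r * unity_root i)) \<longlongrightarrow> G 0) (at_right 0)" for i :: 'n
  proof -
    have "((\<lambda>r. complex_of_real r * unity_root i) \<longlongrightarrow> of_real 0 * unity_root i) (at_right 0)"
      by (intro tendsto_intros)
    then have "((\<lambda>r. complex_of_real r * unity_root i) \<longlongrightarrow> 0) (at_right 0)" by simp
    with \<open>isCont G 0\<close> show ?thesis by (rule isCont_tendsto_compose)
  qed
  then have "((\<lambda>r. (norm ((\<Sum>i\<in>(UNIV :: 'n set). G (of_real r * unity_root i)) / of_nat ?n))\<^sup>2) \<longlongrightarrow>
      (norm ((\<Sum>i\<in>(UNIV :: 'n set). G 0) / of_nat ?n))\<^sup>2) (at_right 0)"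
    by (intro tendsto_intros) auto
  moreover have "(norm ((\<Sum>i\<in>(UNIV :: 'n set). G 0) / of_nat ?n))\<^sup>2 = (real k * a ^ (d - k))\<^sup>2"
    using a by (simp add: G_def g0 norm_mult norm_power)
  moreover have "\<forall>\<^sub>F r in at_right 0. (norm ((\<Sum>i\<in>(UNIV :: 'n set). G (of_real r * unity_root i)) / of_nat ?n))\<^sup>2 =
     (norm (\<Sum>i\<in>(UNIV :: 'n::{finite,linorder} set).
      deriv (blaschke 1 (probe_zeros k d a)) (probe_point r $ i) * probe_vector k r $ i))\<^sup>2"
    using eventually_at_right_less[of 0] eventually_at_right_real[of 0 1]
    by (auto elim!: eventually_mono simp: eq)
  ultimately show ?thesis by (simp only: tendsto_cong[symmetric])
qed

text \<open>
  The inequality for the test vectors, in the limit \<open>r \<rightarrow> 0\<close>. The left-hand form is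
  bounded below by its first term. The maximum with \<open>0\<close> keeps the upper bound of the right-hand
  form applicable when \<open>C\<close> is negative.
\<close>

lemma pullback_le_probe_bound:
  fixes F :: "complex^('n::{finite,linorder}) \<Rightarrow> complex^('n::{finite,linorder})"
  assumes k: "1 \<le> k" "k \<le> CARD('n)" and a: "0 \<le> a" "a < 1"
    and F: "induced_by F (blaschke 1 (probe_zeros k d a))" and le: "pullback_le F C"
  shows "real k * (a ^ (d - k))\<^sup>2 \<le> max C 0"
proof -
  let ?as = "probe_zeros k d a" and ?B = "blaschke 1 (probe_zeros k d a)"
  define M where "M = (\<Sum>m. real (Suc (m + CARD('n))) * (1/4) ^ m)"
  define L where "L r = (norm (\<Sum>i\<in>(UNIV :: 'n set). deriv ?B (probe_point r $ i) * probe_vector k r $ i))\<^sup>2" for r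
  have as: "\<forall>b\<in>set ?as. norm b < 1" "?as \<noteq> []" using a k by (auto simp: probe_zeros_def)
  have "L r \<le> max C 0 * (real k + r\<^sup>2 * M)" if r: "0 < r" "r \<le> 1/2" for r
  proof -
    let ?z = "\<lambda>i :: 'n. probe_point r $ i" and ?v = "\<lambda>i :: 'n. probe_vector k r $ i"
    have Z: "(probe_point r :: (complex,'n) vec) \<in> polydisc" using r by (simp add: polydisc_iff probe_point_def norm_mult)
    have "L r \<le> Re (bergman_form UNIV (\<lambda>i. ?B (?z i)) (\<lambda>i. deriv ?B (?z i) * ?v i))"
      unfolding L_def
      by (rule bergman_form_ge_norm_sum) (use norm_blaschke_less_1[OF norm_one as] Z in \<open>auto simp: polydisc_iff\<close>)
    also have "\<dots> \<le> C * Re (bergman_form UNIV ?z ?v)"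
      using pullback_leD[OF le, of "symmetrization (probe_point r)" "sym_jacobian (probe_point r) *v probe_vector k r"] Z
      by (simp add: Re_defect_form_symmetrization[OF norm_one as F Z])
    also have "\<dots> \<le> max C 0 * Re (bergman_form UNIV ?z ?v)"
    proof (rule mult_right_mono)
      show "0 \<le> Re (bergman_form UNIV ?z ?v)"
        by (rule order_trans[OF _ bergman_form_ge_norm_sum]) (use Z in \<open>auto simp: polydisc_iff\<close>)
    qed simp
    also have "\<dots> \<le> max C 0 * (real k + r\<^sup>2 * M)"
      unfolding M_def by (intro mult_left_mono bergman_form_probe_le k r) auto
    finally show ?thesis .
  qed
  moreover have "\<forall>\<^sub>F r in at_right (0::real). 0 < r \<and> r \<le> 1/2"
    using eventually_at_right_real[of 0 "1/2::real"] by (auto elim!: eventually_mono)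
  ultimately have ev: "\<forall>\<^sub>F r in at_right 0. L r \<le> max C 0 * (real k + r\<^sup>2 * M)"
    by (auto elim!: eventually_mono)
  have "((\<lambda>r. max C 0 * (real k + r\<^sup>2 * M)) \<longlongrightarrow> max C 0 * (real k + 0\<^sup>2 * M)) (at_right 0)"
    by (intro tendsto_intros)
  moreover have "(L \<longlongrightarrow> (real k * a ^ (d - k))\<^sup>2) (at_right 0)"
    unfolding L_def[abs_def] by (rule probe_lower_limit[OF k(1) a])
  ultimately have "(real k * a ^ (d - k))\<^sup>2 \<le> max C 0 * (real k + 0\<^sup>2 * M)"
    using ev by (intro tendsto_le[OF trivial_limit_at_right_real])
  then have "real k * (real k * (a ^ (d - k))\<^sup>2) \<le> real k * max C 0"
    by (simp add: power_mult_distrib power2_eq_square mult_ac)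
  then show ?thesis using k by simp
qed

lemma ex_proper_map_not_pullback_le:
  assumes d: "1 \<le> d" and C: "C < min (real CARD('n::{finite,linorder})) (real d)"
  shows "\<exists>F :: complex^('n::{finite,linorder}) \<Rightarrow> complex^('n::{finite,linorder}).
    proper_holomorphic_self_map F \<and> map_degree F = d ^ CARD('n) \<and> \<not> pullback_le F C"
proof -
  define k where "k = min CARD('n) d"
  have k: "1 \<le> k" "k \<le> CARD('n)" "k \<le> d" using d by (auto simp: k_def Suc_le_eq)
  have "max C 0 < real k" using C d by (auto simp: k_def min_def)
  have "((\<lambda>a. real k * (a ^ (d - k))\<^sup>2) \<longlongrightarrow> real k * (1 ^ (d - k))\<^sup>2) (at_left 1)"
    by (intro tendsto_intros)
  then have "((\<lambda>a. real k * (a ^ (d - k))\<^sup>2) \<longlongrightarrow> real k) (at_left 1)" by simp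
  from order_tendstoD(1)[OF this \<open>max C 0 < real k\<close>]
  have "\<forall>\<^sub>F a in at_left 1. max C 0 < real k * (a ^ (d - k))\<^sup>2" .
  moreover have "\<forall>\<^sub>F a in at_left (1::real). 0 < a \<and> a < 1"
    using eventually_at_left_real[of 0 "1::real"] by (auto elim!: eventually_mono)
  ultimately have "\<forall>\<^sub>F a in at_left (1::real). max C 0 < real k * (a ^ (d - k))\<^sup>2 \<and> 0 < a \<and> a < 1"
    by (rule eventually_conj)
  then obtain a :: real where a: "max C 0 < real k * (a ^ (d - k))\<^sup>2" "0 < a" "a < 1"
    using eventually_happens[of _ "at_left (1::real)"] trivial_limit_at_left_real by blast
  let ?as = "probe_zeros k d a"
  have as: "\<forall>b\<in>set ?as. norm b < 1" "?as \<noteq> []" "length ?as = d"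
    using a k by (auto simp: probe_zeros_def)
  obtain F :: "(complex,'n) vec \<Rightarrow> (complex,'n) vec" where F: "induced_by F (blaschke 1 ?as)"
    by (rule ex_induced_map)
  have not_le: "\<not> pullback_le F C"
    using pullback_le_probe_bound[OF k(1,2) _ a(3) F, of C] a by auto
  have "map_degree F = d ^ CARD('n)"
    using map_degree_induced[OF norm_one as(1,2) F] by (simp only: as(3))
  then show ?thesis
    by (intro exI[of _ F] conjI proper_self_map_if_induced[OF norm_one as(1,2) F] not_le)
qed

theorem theorem3p3:
  "(\<forall>F :: complex^('n::{finite,linorder}) \<Rightarrow> complex^('n::{finite,linorder}).
      proper_holomorphic_self_map F \<longrightarrow>
      pullback_le F (min (real CARD('n)) (root CARD('n) (real (map_degree F))))) \<and>
   (\<forall>m :: nat.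
      (\<exists>F :: complex^('n::{finite,linorder}) \<Rightarrow> complex^('n::{finite,linorder}).
         proper_holomorphic_self_map F \<and> map_degree F = m) \<longrightarrow>
      \<not> (\<exists>C :: real. C < min (real CARD('n)) (root CARD('n) (real m)) \<and>
           (\<forall>F :: complex^('n::{finite,linorder}) \<Rightarrow> complex^('n::{finite,linorder}).
              proper_holomorphic_self_map F \<and> map_degree F = m \<longrightarrow> pullback_le F C)))"
proof -
  have root: "root CARD('n) (real (d ^ CARD('n))) = real d" for d
    by (simp add: real_root_power_cancel)
  have degree: "\<exists>d\<ge>1. map_degree F = d ^ CARD('n) \<and> pullback_le F (min (real CARD('n)) (real d))"
    if F: "proper_holomorphic_self_map F" for F :: "(complex,'n) vec \<Rightarrow> (complex,'n) vec"
  proof -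
    obtain c as where *: "norm c = 1" "\<forall>a\<in>set as. norm a < 1" "as \<noteq> []" "induced_by F (blaschke c as)"
      by (rule proper_self_map_induced_by_blaschke[OF F])
    from map_degree_induced[OF *] pullback_le_induced[OF *] \<open>as \<noteq> []\<close> show ?thesis
      by (intro exI[of _ "length as"]) (auto simp: Suc_le_eq)
  qed
  show ?thesis
  proof (intro conjI allI impI)
    fix F :: "(complex,'n) vec \<Rightarrow> (complex,'n) vec"
    assume "proper_holomorphic_self_map F"
    from degree[OF this] obtain d where d: "map_degree F = d ^ CARD('n)" "pullback_le F (min (real CARD('n)) (real d))"
      by blast
    then show "pullback_le F (min (real CARD('n)) (root CARD('n) (real (map_degree F))))"
      by (simp only: root)
  next
    fix m :: nat
    assume "\<exists>F :: (complex,'n) vec \<Rightarrow> (complex,'n) vec. proper_holomorphic_self_map F \<and> map_degree F = m"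
    with degree obtain d where d: "1 \<le> d" "m = d ^ CARD('n)" by blast
    show "\<not> (\<exists>C :: real. C < min (real CARD('n)) (root CARD('n) (real m)) \<and>
           (\<forall>F :: (complex,'n) vec \<Rightarrow> (complex,'n) vec.
              proper_holomorphic_self_map F \<and> map_degree F = m \<longrightarrow> pullback_le F C))"
      using ex_proper_map_not_pullback_le[OF d(1), where 'n='n] unfolding d(2) root by blast
  qed
qed

end
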